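(* (Generalized CK-extension.) Let $\Omega_0\subseteq\mathbb{R}^{p+1}$ be a domain and $A_0\in C^{\omega}(\Omega_0,\mathbb{A})$. Then there exists a unique sequence of real analytic functions $\{A_k\}_{k\ge1}\subset C^{\omega}(\Omega_0,\mathbb{A})$ such that the series $$f(\mathbf{x})=\sum_{k=0}^{\infty}\underline{\mathbf{x}}_q^{\,k}A_k(\mathbf{x}_p)$$ converges in a p-symmetric slice domain $\Omega\subseteq\Omega_0^*$ with $\Omega_0\subset\Omega$ and its sum $f$ is monogenic in $\Omega$. Furthermore, $f$ can be written formally as $$f(\mathbf{x})=\Gamma\Big(\frac q2\Big)\Big(\frac{r\sqrt{\Delta_{\mathbf{x}_p}}}{2}\Big)^{-\frac q2}\Big[\frac{r\sqrt{\Delta_{\mathbf{x}_p}}}{2}J_{\frac q2-1}\big(r\sqrt{\Delta_{\mathbf{x}_p}}\big)[A_0(\mathbf{x}_p)]+\frac{\underline{\mathbf{x}}_q}{2}J_{\frac q2}\big(r\sqrt{\Delta_{\mathbf{x}_p}}\big)[D_{\mathbf{x}_p}A_0(\mathbf{x}_p)]\Big],$$ where $r=|\underline{\mathbf{x}}_q|$, $\sqrt{\Delta_{\mathbf{x}_p}}$ is a formal square root of $\Delta_{\mathbf{x}_p}$ (only even powers of it occur in the resulting series), and $J_n(x)=\sum_{k\ge0}\frac{(-1)^k(x/2)^{n+2k}}{k!\,\Gamma(n+k+1)}$ is the Bessel function of the first kind.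
   Context: Let $\mathbb{A}$ be a real alternative algebra (the associator $[a,b,c]=(ab)c-a(bc)$ is an alternating trilinear function) with unity $1$, of finite real dimension $d>1$, equipped with an anti-involution $a\mapsto a^c$ (real linear, $a^c=a$ for real $a$, $(a^c)^c=a$, $(ab)^c=b^ca^c$). Let $t(x)=x+x^c$, $n(x)=xx^c$, $\mathbb{S}_{\mathbb{A}}=\{x: t(x)=0,\ n(x)=1\}$ (assumed nonempty) and $Q_{\mathbb{A}}=\mathbb{R}\cup\{x: t(x)\in\mathbb{R},\ n(x)\in\mathbb{R},\ 4n(x)>t(x)^2\}$. Let $M$ be a real subspace with $\mathbb{R}\subsetneq M\subseteq Q_{\mathbb{A}}$ having a basis $(v_0,\dots,v_m)$, $m\ge1$, $v_0=1$, $v_s\in\mathbb{S}_{\mathbb{A}}$, $v_sv_t=-v_tv_s$ for distinct $s,t\ge1$; complete it to a basis of $\mathbb{A}$ with associated Euclidean norm. Identify $x=\sum x_sv_s\in M$ with $(x_0,\dots,x_m)\in\mathbb{R}^{m+1}$; differentiate componentwise; $C^\omega$ means componentwise real analytic. Fix $p\in\{0,\dots,m-1\}$, $q=m-p$; $\mathbf{x}=\mathbf{x}_p+\underline{\mathbf{x}}_q$ with $\mathbf{x}_p=\sum_{s=0}^px_sv_s\in\mathbb{R}^{p+1}$, $\underline{\mathbf{x}}_q=\sum_{s=p+1}^m x_sv_s\in\mathbb{R}^q$; $\mathbb{S}=\{\sum_{s=p+1}^m x_sv_s:\sum x_s^2=1\}$; $\underline{\mathbf{x}}_q=r\underline{\omega}$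 with $r=|\underline{\mathbf{x}}_q|$. Powers $\underline{\mathbf{x}}_q^k$ are taken in $\mathbb{A}$ (note $\underline{\mathbf{x}}_q^2=-r^2$), and $\underline{\mathbf{x}}_q^kA_k$ denotes the product of $\underline{\mathbf{x}}_q^k$ with $A_k$. $D_{\mathbf{x}_p}f=\sum_{s=0}^p v_s\partial_{x_s}f$, $\Delta_{\mathbf{x}_p}=\sum_{s=0}^p\partial_{x_s}^2$, $D_{\mathbf{x}}f=\sum_{s=0}^m v_s\partial_{x_s}f$; a $C^1$ function $f$ is monogenic if $D_{\mathbf{x}}f=0$. A domain $\Omega\subseteq M$ is a slice domain if $\Omega\cap\mathbb{R}^{p+1}\ne\emptyset$ and each $\Omega\cap(\mathbb{R}^{p+1}\oplus\underline{\omega}\mathbb{R})$, $\underline{\omega}\in\mathbb{S}$, is a domain in $\mathbb{R}^{p+2}$; it is p-symmetric if $\mathbf{x}_p+r\underline{\omega}\in\Omega$ with $r>0$ implies $\mathbf{x}_p+r\underline{\eta}\in\Omega$ for all $\underline{\eta}\in\mathbb{S}$. $\Omega_0^*=\{\mathbf{x}_p+\underline{\mathbf{x}}_q:\mathbf{x}_p\in\Omega_0,\ \underline{\mathbf{x}}_q\in\mathbb{R}^q\}$. *)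

theory Defs
  imports "HOL-Analysis.Analysis"
begin

text \<open>The real alternative algebra is the finite-dimensional real vector space 'a
 (class euclidean_space) with a bilinear multiplication mul (not assumed
 associative), unity one and anti-involution cj.\<close>

definition associator :: "('a::real_vector \<Rightarrow> 'a \<Rightarrow> 'a) \<Rightarrow> 'a \<Rightarrow> 'a \<Rightarrow> 'a \<Rightarrow> 'a" where
  "associator mul a b c = mul (mul a b) c - mul a (mul b c)"

definition alt_algebra_with_anti_involution ::
  "('a::real_vector \<Rightarrow> 'a \<Rightarrow> 'a) \<Rightarrow> 'a \<Rightarrow> ('a \<Rightarrow> 'a) \<Rightarrow> bool" where
  "alt_algebra_with_anti_involution mul one cj \<longleftrightarrow>
     bilinear mul \<and>
     (\<forall>a. mul one a = a \<and> mul a one = a) \<and>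
     (\<forall>a b. associator mul a a b = 0 \<and> associator mul a b a = 0 \<and> associator mul b a a = 0) \<and>
     linear cj \<and>
     (\<forall>r. cj (r *\<^sub>R one) = r *\<^sub>R one) \<and>
     (\<forall>a. cj (cj a) = a) \<and>
     (\<forall>a b. cj (mul a b) = mul (cj b) (cj a))"

definition trA :: "('a::real_vector \<Rightarrow> 'a) \<Rightarrow> 'a \<Rightarrow> 'a" where
  "trA cj x = x + cj x"

definition nA :: "('a::real_vector \<Rightarrow> 'a \<Rightarrow> 'a) \<Rightarrow> ('a \<Rightarrow> 'a) \<Rightarrow> 'a \<Rightarrow> 'a" where
  "nA mul cj x = mul x (cj x)"

definition sphereA :: "('a::real_vector \<Rightarrow> 'a \<Rightarrow> 'a) \<Rightarrow> 'a \<Rightarrow> ('a \<Rightarrow> 'a) \<Rightarrow> 'a set" where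
  "sphereA mul one cj = {x. trA cj x = 0 \<and> nA mul cj x = one}"

definition QA :: "('a::real_vector \<Rightarrow> 'a \<Rightarrow> 'a) \<Rightarrow> 'a \<Rightarrow> ('a \<Rightarrow> 'a) \<Rightarrow> 'a set" where
  "QA mul one cj = {x. \<exists>a. x = a *\<^sub>R one} \<union>
     {x. \<exists>a b. trA cj x = a *\<^sub>R one \<and> nA mul cj x = b *\<^sub>R one \<and> 4 * b > a\<^sup>2}"

primrec powA :: "('a \<Rightarrow> 'a \<Rightarrow> 'a) \<Rightarrow> 'a \<Rightarrow> 'a \<Rightarrow> nat \<Rightarrow> 'a" where
  "powA mul one x 0 = one"
| "powA mul one x (Suc k) = mul x (powA mul one x k)"

definition embv :: "(nat \<Rightarrow> 'a::real_vector) \<Rightarrow> nat set \<Rightarrow> (nat \<Rightarrow> real) \<Rightarrow> 'a" where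
  "embv v I c = (\<Sum>s\<in>I. c s *\<^sub>R v s)"

definition pderiv_v :: "(nat \<Rightarrow> 'a::real_normed_vector) \<Rightarrow> nat \<Rightarrow> ('a \<Rightarrow> 'b::real_normed_vector) \<Rightarrow> 'a \<Rightarrow> 'b" where
  "pderiv_v v s f x = vector_derivative (\<lambda>t. f (x + t *\<^sub>R v s)) (at 0)"

definition domain_in :: "'a::real_normed_vector set \<Rightarrow> 'a set \<Rightarrow> bool" where
  "domain_in X \<Omega> \<longleftrightarrow> openin (top_of_set X) \<Omega> \<and> connected \<Omega> \<and> \<Omega> \<noteq> {}"

definition C1_on :: "(nat \<Rightarrow> 'a::real_normed_vector) \<Rightarrow> nat \<Rightarrow> ('a \<Rightarrow> 'a) \<Rightarrow> 'a set \<Rightarrow> bool" where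
  "C1_on v m f \<Omega> \<longleftrightarrow>
     (\<forall>s\<le>m. (\<forall>x\<in>\<Omega>. (\<lambda>t. f (x + t *\<^sub>R v s)) differentiable (at 0)) \<and>
             continuous_on \<Omega> (pderiv_v v s f))"

definition monogenic_on ::
  "('a::real_normed_vector \<Rightarrow> 'a \<Rightarrow> 'a) \<Rightarrow> (nat \<Rightarrow> 'a) \<Rightarrow> nat \<Rightarrow> ('a \<Rightarrow> 'a) \<Rightarrow> 'a set \<Rightarrow> bool" where
  "monogenic_on mul v m f \<Omega> \<longleftrightarrow>
     C1_on v m f \<Omega> \<and> (\<forall>x\<in>\<Omega>. (\<Sum>s\<le>m. mul (v s) (pderiv_v v s f x)) = 0)"

text \<open>Real analytic (componentwise) on \<Omega>0 \<subseteq> R^{p+1} = span{v_0..v_p}: locally the sum of an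
  absolutely (= unconditionally) convergent power series in the coordinates x_0..x_p.\<close>
definition real_analytic_on_v :: "(nat \<Rightarrow> 'a::real_normed_vector) \<Rightarrow> nat \<Rightarrow> ('a \<Rightarrow> 'b::real_normed_vector) \<Rightarrow> 'a set \<Rightarrow> bool" where
  "real_analytic_on_v v p f \<Omega>0 \<longleftrightarrow>
     (\<forall>y\<in>\<Omega>0. \<exists>\<epsilon>>0. \<exists>coef :: (nat \<Rightarrow> nat) \<Rightarrow> 'b.
        \<forall>h. (\<Sum>s\<le>p. (h s)\<^sup>2) < \<epsilon>\<^sup>2 \<and> y + embv v {..p} h \<in> \<Omega>0 \<longrightarrow>
          ((\<lambda>\<alpha>. (\<Prod>s\<le>p. h s ^ \<alpha> s) *\<^sub>R coef \<alpha>) has_sum f (y + embv v {..p} h))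
             {\<alpha>. \<forall>s>p. \<alpha> s = 0})"

definition lap_p :: "(nat \<Rightarrow> 'a::real_normed_vector) \<Rightarrow> nat \<Rightarrow> ('a \<Rightarrow> 'a) \<Rightarrow> 'a \<Rightarrow> 'a" where
  "lap_p v p f = (\<lambda>x. \<Sum>s\<le>p. pderiv_v v s (pderiv_v v s f) x)"

definition D_p :: "('a::real_normed_vector \<Rightarrow> 'a \<Rightarrow> 'a) \<Rightarrow> (nat \<Rightarrow> 'a) \<Rightarrow> nat \<Rightarrow> ('a \<Rightarrow> 'a) \<Rightarrow> 'a \<Rightarrow> 'a" where
  "D_p mul v p f = (\<lambda>x. \<Sum>s\<le>p. mul (v s) (pderiv_v v s f x))"

definition sphere_q :: "(nat \<Rightarrow> 'a::real_vector) \<Rightarrow> nat \<Rightarrow> nat \<Rightarrow> 'a set" where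
  "sphere_q v p m = {embv v {p+1..m} c | c. (\<Sum>s\<in>{p+1..m}. (c s)\<^sup>2) = 1}"

definition slice_domain :: "(nat \<Rightarrow> 'a::real_normed_vector) \<Rightarrow> nat \<Rightarrow> nat \<Rightarrow> 'a set \<Rightarrow> bool" where
  "slice_domain v p m \<Omega> \<longleftrightarrow>
     domain_in (span (v ` {..m})) \<Omega> \<and>
     \<Omega> \<inter> span (v ` {..p}) \<noteq> {} \<and>
     (\<forall>\<omega>\<in>sphere_q v p m.
        let L = {y + t *\<^sub>R \<omega> | y t. y \<in> span (v ` {..p})} in domain_in L (\<Omega> \<inter> L))"

definition p_symmetric :: "(nat \<Rightarrow> 'a::real_normed_vector) \<Rightarrow> nat \<Rightarrow> nat \<Rightarrow> 'a set \<Rightarrow> bool" where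
  "p_symmetric v p m \<Omega> \<longleftrightarrow>
     (\<forall>xp\<in>span (v ` {..p}). \<forall>\<omega>\<in>sphere_q v p m. \<forall>r>0.
        xp + r *\<^sub>R \<omega> \<in> \<Omega> \<longrightarrow> (\<forall>\<eta>\<in>sphere_q v p m. xp + r *\<^sub>R \<eta> \<in> \<Omega>))"

definition star_set :: "(nat \<Rightarrow> 'a::real_vector) \<Rightarrow> nat \<Rightarrow> nat \<Rightarrow> 'a set \<Rightarrow> 'a set" where
  "star_set v p m \<Omega>0 = {xp + xq | xp xq. xp \<in> \<Omega>0 \<and> xq \<in> span (v ` {p+1..m})}"

definition CK_extension ::
  "('a::real_normed_vector \<Rightarrow> 'a \<Rightarrow> 'a) \<Rightarrow> 'a \<Rightarrow> (nat \<Rightarrow> 'a) \<Rightarrow> nat \<Rightarrow> nat \<Rightarrow> 'a set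
   \<Rightarrow> (nat \<Rightarrow> 'a \<Rightarrow> 'a) \<Rightarrow> 'a set \<Rightarrow> ('a \<Rightarrow> 'a) \<Rightarrow> bool" where
  "CK_extension mul one v p m \<Omega>0 A \<Omega> f \<longleftrightarrow>
     slice_domain v p m \<Omega> \<and> p_symmetric v p m \<Omega> \<and>
     \<Omega> \<subseteq> star_set v p m \<Omega>0 \<and> \<Omega>0 \<subseteq> \<Omega> \<and>
     (\<forall>c. embv v {..m} c \<in> \<Omega> \<longrightarrow>
        (\<lambda>k. mul (powA mul one (embv v {p+1..m} c) k) (A k (embv v {..p} c)))
          sums f (embv v {..m} c)) \<and>
     monogenic_on mul v m f \<Omega>"

text \<open>Coefficients of the Bessel function J_nu(x) = sum_k bessel_coeff nu k (x/2)^(nu+2k).\<close>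
definition bessel_coeff :: "real \<Rightarrow> nat \<Rightarrow> real" where
  "bessel_coeff \<nu> k = (-1) ^ k / (fact k * Gamma (\<nu> + real k + 1))"

text \<open>The formal expression
  Gamma(q/2) (r sqrt(Lap)/2)^(-q/2) [ (r sqrt(Lap)/2) J_{q/2-1}(r sqrt(Lap)) [A0]
                                    + (x_q/2) J_{q/2}(r sqrt(Lap)) [D A0] ],
  expanded termwise (only even powers of sqrt(Lap) occur): its k-th term.\<close>
definition bessel_term ::
  "('a::real_normed_vector \<Rightarrow> 'a \<Rightarrow> 'a) \<Rightarrow> (nat \<Rightarrow> 'a) \<Rightarrow> nat \<Rightarrow> nat \<Rightarrow> ('a \<Rightarrow> 'a)
   \<Rightarrow> (nat \<Rightarrow> real) \<Rightarrow> nat \<Rightarrow> 'a" where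
  "bessel_term mul v p m A0 c k =
     (let q = real (m - p);
          r = sqrt (\<Sum>s\<in>{p+1..m}. (c s)\<^sup>2);
          xp = embv v {..p} c;
          xq = embv v {p+1..m} c
      in (Gamma (q/2) * bessel_coeff (q/2 - 1) k * (r/2) ^ (2*k)) *\<^sub>R ((lap_p v p ^^ k) A0 xp)
         + mul ((1/2) *\<^sub>R xq)
             ((Gamma (q/2) * bessel_coeff (q/2) k * (r/2) ^ (2*k)) *\<^sub>R
                ((lap_p v p ^^ k) (D_p mul v p A0) xp)))"

end

theory Submission
  imports Defs
begin

text \<open>Write \<open>r\<close> for the Euclidean norm of \<open>x\<^sub>q\<close>. Since \<open>x\<^sub>q\<^sup>2 = - r\<^sup>2\<close> and \<open>v\<^sub>s\<close> anticommutes with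
  \<open>x\<^sub>q\<close> for \<open>1 \<le> s \<le> p\<close>, alternativity turns the Dirac equation for \<open>\<Sum> x\<^sub>q\<^sup>k A\<^sub>k\<close> into the recursion
  \<open>A\<^sub>k\<^sub>+\<^sub>1 = D\<^sub>k A\<^sub>k / \<gamma>\<^sub>k\<close>, where \<open>D\<^sub>k\<close> is \<open>D\<^sub>p\<close> for even \<open>k\<close> and its conjugate for odd \<open>k\<close>. Two steps
  give the Laplacian, and the constants multiply up to the Bessel coefficients.

  Convergence is the Cauchy-Kovalevskaya argument in the scale of weighted \<open>l\<^sup>1\<close> norms of
  multi-index coefficients: one derivative costs \<open>1 / (\<rho> - \<rho>')\<close>, the factor \<open>1 / \<gamma>\<^sub>k\<close> pays for it.

  For uniqueness, let \<open>C\<^sub>k\<close> be the first nonzero difference of the coefficients of two extensions.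
  The series is only assumed to converge pointwise, but Baire's theorem gives geometric bounds for
  all \<open>C\<^sub>j\<close> on a small box. There \<open>t\<^sup>-\<^sup>k h(x\<^sub>p + t x\<^sub>q)\<close>, with \<open>h\<close> the difference of the sums, tends
  uniformly to \<open>x\<^sub>q\<^sup>k C\<^sub>k\<close>. The divergence theorem on cubes passes the Dirac equation to the limit and
  shows that the Dirac operator in \<open>x\<^sub>q\<close> annihilates \<open>x\<^sub>q\<^sup>k C\<^sub>k\<close>, which forces \<open>C\<^sub>k = 0\<close>.\<close>

section \<open>Multi-index power series\<close>

text \<open>Longer products of vectors cannot be regrouped in \<open>mul\<close>. Vectors therefore
  act by left multiplication, and linearised left alternativity gives these operators the Clifford
  relations; \<open>E\<close> and \<open>dirac\<close> are built from such operators applied to a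
  value. The constants \<open>\<gamma> k\<close> come from differentiating a power: the Dirac
  operator in the last q variables sends x_q^(k+1) a to - \<gamma> k x_q^k a. Since \<gamma> k is at
  least k + 1, taking k derivatives and paying a k-th part of the radius for each costs about k^k /
  k!, which grows only geometrically. The radius obtained depends on the point of
  \<open>\<Omega>0\<close>, so the domain is a union of small pieces. In the uniqueness part an
  extension offers pointwise convergence and a C^1 sum, so neither termwise nor repeated
  differentiation of the sum is available. The rescaled difference is instead packed into a vector
  field of size O(t) whose divergence stays above a positive constant independent of t, which is
  impossible on a fixed cube.\<close>

definition multi_indices :: "nat \<Rightarrow> (nat \<Rightarrow> nat) set" where
  "multi_indices p = {\<alpha>. \<forall>s>p. \<alpha> s = 0}"

definition mdeg :: "nat \<Rightarrow> (nat \<Rightarrow> nat) \<Rightarrow> nat" where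
  "mdeg p \<alpha> = (\<Sum>s\<le>p. \<alpha> s)"

definition mpow :: "nat \<Rightarrow> (nat \<Rightarrow> real) \<Rightarrow> (nat \<Rightarrow> nat) \<Rightarrow> real" where
  "mpow p h \<alpha> = (\<Prod>s\<le>p. h s ^ \<alpha> s)"

text \<open>Absolute convergence at the corner (\<rho>, ..., \<rho>), which dominates the series on
  the whole closed box of half-width \<rho>.\<close>

definition wsummable :: "nat \<Rightarrow> real \<Rightarrow> ((nat \<Rightarrow> nat) \<Rightarrow> 'b::banach) \<Rightarrow> bool" where
  "wsummable p \<rho> a \<longleftrightarrow> (\<lambda>\<alpha>. norm (a \<alpha>) * \<rho> ^ mdeg p \<alpha>) summable_on multi_indices p"

definition wnorm :: "nat \<Rightarrow> real \<Rightarrow> ((nat \<Rightarrow> nat) \<Rightarrow> 'b::banach) \<Rightarrow> real" where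
  "wnorm p \<rho> a = (\<Sum>\<^sub>\<infinity>\<alpha>\<in>multi_indices p. norm (a \<alpha>) * \<rho> ^ mdeg p \<alpha>)"

definition mseries :: "nat \<Rightarrow> ((nat \<Rightarrow> nat) \<Rightarrow> 'b::banach) \<Rightarrow> (nat \<Rightarrow> real) \<Rightarrow> 'b" where
  "mseries p a h = (\<Sum>\<^sub>\<infinity>\<alpha>\<in>multi_indices p. mpow p h \<alpha> *\<^sub>R a \<alpha>)"

text \<open>The coefficients of the formal partial derivative in the variable
  \<open>s\<close>.\<close>

definition mshift :: "nat \<Rightarrow> ((nat \<Rightarrow> nat) \<Rightarrow> 'b::banach) \<Rightarrow> (nat \<Rightarrow> nat) \<Rightarrow> 'b" where
  "mshift s a \<alpha> = real (Suc (\<alpha> s)) *\<^sub>R a (\<alpha>(s := Suc (\<alpha> s)))"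

lemma has_vector_derivative_suminf:
  fixes f :: "nat \<Rightarrow> real \<Rightarrow> 'b::banach"
  assumes S: "convex S" "open S" and t: "t \<in> S"
    and f': "\<And>n x. x \<in> S \<Longrightarrow> (f n has_vector_derivative f' n x) (at x)"
    and M: "\<And>n x. x \<in> S \<Longrightarrow> norm (f' n x) \<le> M n" "summable M"
    and sm: "\<And>x. x \<in> S \<Longrightarrow> summable (\<lambda>n. f n x)"
  shows "((\<lambda>x. \<Sum>n. f n x) has_vector_derivative (\<Sum>n. f' n t)) (at t)"
proof -
  have u: "uniform_limit S (\<lambda>n x. \<Sum>i<n. f' i x) (\<lambda>x. \<Sum>n. f' n x) sequentially"
    by (rule Weierstrass_m_test) (use M in auto)
  have ex: "\<exists>g. \<forall>x\<in>S. (\<lambda>n. f n x) sums g x \<and>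
      (g has_derivative (\<lambda>h. h *\<^sub>R (\<Sum>n. f' n x))) (at x within S)"
  proof (rule has_derivative_series[where f' = "\<lambda>n x h. h *\<^sub>R f' n x"])
    show "(f n has_derivative (\<lambda>h. h *\<^sub>R f' n x)) (at x within S)" if "x \<in> S" for n x
      using f'[OF that, of n] by (simp add: has_vector_derivative_def has_derivative_at_withinI)
    show "\<forall>\<^sub>F n in sequentially. \<forall>x\<in>S. \<forall>h. norm ((\<Sum>i<n. h *\<^sub>R f' i x) - h *\<^sub>R (\<Sum>n. f' n x)) \<le> e * norm h"
      if "e > 0" for e
      using uniform_limitD[OF u that]
    proof eventually_elim
      case (elim n)
      show ?case
      proof (intro ballI allI)
        fix x h assume "x \<in> S"
        hence "dist (\<Sum>i<n. f' i x) (\<Sum>n. f' n x) \<le> e" using elim by force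
        hence "\<bar>h\<bar> * dist (\<Sum>i<n. f' i x) (\<Sum>n. f' n x) \<le> \<bar>h\<bar> * e" by (rule mult_left_mono) auto
        thus "norm ((\<Sum>i<n. h *\<^sub>R f' i x) - h *\<^sub>R (\<Sum>n. f' n x)) \<le> e * norm h"
          by (simp add: dist_norm scaleR_right.sum[symmetric] scaleR_diff_right[symmetric] mult.commute)
      qed
    qed
    show "(\<lambda>n. f n t) sums (\<Sum>n. f n t)" using sm[OF t] by (rule summable_sums)
  qed (use S t in auto)
  then obtain g where g: "\<And>x. x \<in> S \<Longrightarrow> (\<lambda>n. f n x) sums g x"
     "\<And>x. x \<in> S \<Longrightarrow> (g has_derivative (\<lambda>h. h *\<^sub>R (\<Sum>n. f' n x))) (at x within S)" by blast
  have "(g has_vector_derivative (\<Sum>n. f' n t)) (at t)"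
    using g(2)[OF t] at_within_open[OF t S(2)] by (simp add: has_vector_derivative_def)
  thus ?thesis
    by (rule has_vector_derivative_transform_within_open[OF _ S(2) t]) (use g(1) in \<open>auto simp: sums_iff\<close>)
qed

text \<open>An enumeration of the countably infinite index set turns the unordered sums into
  ordinary series; the dominating families make both series absolutely convergent, so the order does
  not matter.\<close>

lemma has_vector_derivative_infsum:
  fixes f :: "'i \<Rightarrow> real \<Rightarrow> 'b::banach"
  assumes I: "countable I" "infinite I" and S: "convex S" "open S" and t: "t \<in> S"
    and f': "\<And>i x. i \<in> I \<Longrightarrow> x \<in> S \<Longrightarrow> (f i has_vector_derivative f' i x) (at x)"
    and M: "\<And>i x. i \<in> I \<Longrightarrow> x \<in> S \<Longrightarrow> norm (f' i x) \<le> M i" "M summable_on I"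
    and N: "\<And>i x. i \<in> I \<Longrightarrow> x \<in> S \<Longrightarrow> norm (f i x) \<le> N i" "N summable_on I"
  shows "((\<lambda>x. \<Sum>\<^sub>\<infinity>i\<in>I. f i x) has_vector_derivative (\<Sum>\<^sub>\<infinity>i\<in>I. f' i t)) (at t)"
proof -
  let ?b = "from_nat_into I"
  have b: "bij_betw ?b UNIV I" using I by (rule bij_betw_from_nat_into)
  have bI: "?b n \<in> I" for n using I by (simp add: from_nat_into infinite_imp_nonempty)
  have M': "summable (\<lambda>n. M (?b n))" and N': "summable (\<lambda>n. N (?b n))"
    using M(2) N(2) summable_on_reindex_bij_betw[OF b, of M] summable_on_reindex_bij_betw[OF b, of N]
    by (auto intro: summable_on_imp_summable)
  have fs: "(\<lambda>n. f (?b n) x) sums (\<Sum>\<^sub>\<infinity>i\<in>I. f i x)" if "x \<in> S" for x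
  proof -
    have sn: "summable (\<lambda>n. norm (f (?b n) x))"
      by (rule summable_comparison_test'[OF N']) (use N(1)[OF bI that] in auto)
    hence "((\<lambda>n. f (?b n) x) has_sum (\<Sum>n. f (?b n) x)) UNIV"
      by (intro norm_summable_imp_has_sum summable_sums summable_norm_cancel[OF sn] sn)
    hence "((\<lambda>i. f i x) has_sum (\<Sum>n. f (?b n) x)) I"
      using has_sum_reindex_bij_betw[OF b, of "\<lambda>i. f i x"] by simp
    thus ?thesis 
      using summable_sums[OF summable_norm_cancel[OF sn]] by (simp add: infsumI)
  qed
  have fs': "(\<lambda>n. f' (?b n) x) sums (\<Sum>\<^sub>\<infinity>i\<in>I. f' i x)" if "x \<in> S" for x
  proof -
    have sn: "summable (\<lambda>n. norm (f' (?b n) x))"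
      by (rule summable_comparison_test'[OF M']) (use M(1)[OF bI that] in auto)
    hence "((\<lambda>n. f' (?b n) x) has_sum (\<Sum>n. f' (?b n) x)) UNIV"
      by (intro norm_summable_imp_has_sum summable_sums summable_norm_cancel[OF sn] sn)
    hence "((\<lambda>i. f' i x) has_sum (\<Sum>n. f' (?b n) x)) I"
      using has_sum_reindex_bij_betw[OF b, of "\<lambda>i. f' i x"] by simp
    thus ?thesis 
      using summable_sums[OF summable_norm_cancel[OF sn]] by (simp add: infsumI)
  qed
  have "((\<lambda>x. \<Sum>n. f (?b n) x) has_vector_derivative (\<Sum>n. f' (?b n) t)) (at t)"
  proof (rule has_vector_derivative_suminf[OF S t _ _ M'])
    show "(f (?b n) has_vector_derivative f' (?b n) x) (at x)" if "x \<in> S" for n x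
      using f'[OF bI that] .
    show "norm (f' (?b n) x) \<le> M (?b n)" if "x \<in> S" for n x using M(1)[OF bI that] .
    show "summable (\<lambda>n. f (?b n) x)" if "x \<in> S" for x using fs[OF that] sums_summable by blast
  qed
  hence "((\<lambda>x. \<Sum>n. f (?b n) x) has_vector_derivative (\<Sum>\<^sub>\<infinity>i\<in>I. f' i t)) (at t)"
    using fs'[OF t] by (simp add: sums_iff)
  thus ?thesis
    by (rule has_vector_derivative_transform_within_open[OF _ S(2) t]) (use fs in \<open>auto simp: sums_iff\<close>)
qed

section \<open>Degrees, monomials and weighted norms\<close>

lemma mdeg_upd: "s \<le> p \<Longrightarrow> mdeg p (\<alpha>(s := n)) = n + (\<Sum>i\<in>{..p} - {s}. \<alpha> i)"
  unfolding mdeg_def by (subst sum.remove[of _ s]) auto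

lemma mdeg_Suc: "s \<le> p \<Longrightarrow> mdeg p (\<alpha>(s := Suc (\<alpha> s))) = Suc (mdeg p \<alpha>)"
  using mdeg_upd[of s p \<alpha> "Suc (\<alpha> s)"] mdeg_upd[of s p \<alpha> "\<alpha> s"] by simp

lemma le_mdeg: "s \<le> p \<Longrightarrow> \<alpha> s \<le> mdeg p \<alpha>"
  unfolding mdeg_def by (rule member_le_sum) auto

lemma mpow_remove: "s \<le> p \<Longrightarrow> mpow p h \<alpha> = h s ^ \<alpha> s * (\<Prod>i\<in>{..p} - {s}. h i ^ \<alpha> i)"
  unfolding mpow_def by (subst prod.remove[of _ s]) auto

lemma abs_mpow_le: "(\<And>s. s \<le> p \<Longrightarrow> \<bar>h s\<bar> \<le> \<rho>) \<Longrightarrow> \<bar>mpow p h \<alpha>\<bar> \<le> \<rho> ^ mdeg p \<alpha>"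
  unfolding mpow_def mdeg_def abs_prod power_sum power_abs by (rule prod_mono) (auto intro: power_mono)

text \<open>Lists of length p + 1 parametrise the multi-indices; countability is read off from
  this.\<close>

lemma multi_indices_eq: "multi_indices p = (\<lambda>xs s. if s \<le> p then xs ! s else 0) ` {xs. length xs = Suc p}"
proof safe
  fix \<alpha> assume "\<alpha> \<in> multi_indices p"
  hence "\<alpha> = (\<lambda>s. if s \<le> p then map \<alpha> [0..<Suc p] ! s else 0)"
    by (auto simp: multi_indices_def fun_eq_iff nth_append simp del: upt_Suc)
  thus "\<alpha> \<in> (\<lambda>xs s. if s \<le> p then xs ! s else 0) ` {xs. length xs = Suc p}"
    by (rule image_eqI) simp
qed (auto simp: multi_indices_def)

lemma countable_multi_indices: "countable (multi_indices p)"
  unfolding multi_indices_eq by (intro countable_image) auto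

lemma infinite_multi_indices: "infinite (multi_indices p)"
proof
  assume "finite (multi_indices p)"
  hence "finite ((\<lambda>\<alpha>. \<alpha> 0) ` multi_indices p)" by simp
  moreover have "(\<lambda>\<alpha>. \<alpha> 0) ` multi_indices p = (UNIV :: nat set)"
  proof (intro equalityI subsetI)
    fix n :: nat
    show "n \<in> (\<lambda>\<alpha>. \<alpha> 0) ` multi_indices p"
      by (rule image_eqI[of _ _ "(\<lambda>_. 0)(0 := n)"]) (auto simp: multi_indices_def)
  qed auto
  ultimately show False by simp
qed

lemma wnorm_nonneg: "0 \<le> \<rho> \<Longrightarrow> 0 \<le> wnorm p \<rho> a"
  unfolding wnorm_def by (intro infsum_nonneg) auto

lemma wsummable_mono: "wsummable p \<rho> a \<Longrightarrow> 0 \<le> \<rho>' \<Longrightarrow> \<rho>' \<le> \<rho> \<Longrightarrow> wsummable p \<rho>' a"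
  unfolding wsummable_def
  by (erule summable_on_comparison_test) (auto intro!: mult_left_mono power_mono)

lemma mseries_summable:
  assumes "wsummable p \<rho> a" "\<And>s. s \<le> p \<Longrightarrow> \<bar>h s\<bar> \<le> \<rho>"
  shows "(\<lambda>\<alpha>. norm (mpow p h \<alpha> *\<^sub>R a \<alpha>)) summable_on multi_indices p"
  using assms(1) unfolding wsummable_def
  by (rule summable_on_comparison_test)
     (use abs_mpow_le[OF assms(2)] in \<open>auto simp: mult.commute intro!: mult_left_mono\<close>)

lemma mseries_has_sum:
  assumes "wsummable p \<rho> a" "\<And>s. s \<le> p \<Longrightarrow> \<bar>h s\<bar> \<le> \<rho>"
  shows "((\<lambda>\<alpha>. mpow p h \<alpha> *\<^sub>R a \<alpha>) has_sum mseries p a h) (multi_indices p)"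
  unfolding mseries_def by (rule has_sum_infsum, rule abs_summable_summable, rule mseries_summable[OF assms])

lemma norm_mseries_le:
  assumes "wsummable p \<rho> a" "\<And>s. s \<le> p \<Longrightarrow> \<bar>h s\<bar> \<le> \<rho>"
  shows "norm (mseries p a h) \<le> wnorm p \<rho> a"
proof -
  have "norm (mseries p a h) \<le> (\<Sum>\<^sub>\<infinity>\<alpha>\<in>multi_indices p. norm (mpow p h \<alpha> *\<^sub>R a \<alpha>))"
    unfolding mseries_def by (rule norm_infsum_bound, rule mseries_summable[OF assms])
  also have "\<dots> \<le> wnorm p \<rho> a" unfolding wnorm_def
    by (rule infsum_mono[OF mseries_summable[OF assms]])
       (use assms(1) abs_mpow_le[OF assms(2)] in \<open>auto simp: wsummable_def mult.commute intro!: mult_left_mono\<close>)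
  finally show ?thesis .
qed

lemma inj_on_upd_Suc: "inj_on (\<lambda>\<alpha>::nat \<Rightarrow> nat. \<alpha>(s := Suc (\<alpha> s))) A"
proof (rule inj_onI)
  fix \<alpha> \<beta> :: "nat \<Rightarrow> nat" assume eq: "\<alpha>(s := Suc (\<alpha> s)) = \<beta>(s := Suc (\<beta> s))"
  show "\<alpha> = \<beta>"
  proof
    fix i show "\<alpha> i = \<beta> i" using fun_cong[OF eq, of i] by (auto split: if_splits)
  qed
qed

lemma image_upd_Suc:
  assumes "s \<le> p"
  shows "(\<lambda>\<alpha>::nat \<Rightarrow> nat. \<alpha>(s := Suc (\<alpha> s))) ` multi_indices p = {\<beta> \<in> multi_indices p. \<beta> s \<noteq> 0}"
proof safe
  fix \<beta> assume "\<beta> \<in> multi_indices p" "0 < \<beta> s"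
  thus "\<beta> \<in> (\<lambda>\<alpha>. \<alpha>(s := Suc (\<alpha> s))) ` multi_indices p"
    using assms by (intro image_eqI[of _ _ "\<beta>(s := \<beta> s - 1)"]) (auto simp: multi_indices_def)
qed (use assms in \<open>auto simp: multi_indices_def\<close>)

text \<open>Factor \<rho>^(n+1) - \<rho>'^(n+1) as (\<rho> - \<rho>') times a sum of n + 1 products,
  each at least \<rho>'^n. This is the source of the price 1 / (\<rho> - \<rho>') of a
  derivative.\<close>

lemma power_diff_bound:
  fixes \<rho> \<rho>' :: real
  assumes "0 \<le> \<rho>'" "\<rho>' < \<rho>"
  shows "real (Suc n) * \<rho>' ^ n \<le> \<rho> ^ Suc n / (\<rho> - \<rho>')"
proof -
  have "real (Suc n) * \<rho>' ^ n * (\<rho> - \<rho>') \<le> \<rho> ^ Suc n - \<rho>' ^ Suc n"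
  proof -
    have "(\<Sum>i<Suc n. \<rho>' ^ n) \<le> (\<Sum>i<Suc n. \<rho> ^ (n - i) * \<rho>' ^ i)"
    proof (rule sum_mono)
      fix i assume "i \<in> {..<Suc n}"
      hence "\<rho>' ^ n = \<rho>' ^ (n - i) * \<rho>' ^ i" by (simp flip: power_add)
      also have "\<dots> \<le> \<rho> ^ (n - i) * \<rho>' ^ i" using assms by (intro mult_right_mono power_mono) auto
      finally show "\<rho>' ^ n \<le> \<rho> ^ (n - i) * \<rho>' ^ i" .
    qed
    hence "real (Suc n) * \<rho>' ^ n * (\<rho> - \<rho>') \<le> (\<Sum>i<Suc n. \<rho> ^ (n - i) * \<rho>' ^ i) * (\<rho> - \<rho>')"
      using assms by (intro mult_right_mono) auto
    also have "\<dots> = \<rho> ^ Suc n - \<rho>' ^ Suc n"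
      using power_diff_sumr2[of \<rho>' "Suc n" \<rho>] by (simp only: diff_Suc_Suc minus_mult_left[symmetric] minus_diff_eq[symmetric, of \<rho>' \<rho>] mult.commute[of "sum _ _"])
    finally show ?thesis .
  qed
  also have "\<dots> \<le> \<rho> ^ Suc n" using assms by simp
  finally show ?thesis using assms by (simp add: pos_le_divide_eq)
qed

text \<open>A Cauchy estimate: the coefficient at \<beta> contributes to the derivative once, with
  the factor \<beta> s <= |\<beta>| and one power of the radius less, and
  \<open>power_diff_bound\<close> absorbs that factor into the larger radius.\<close>

lemma wnorm_mshift:
  assumes a: "wsummable p \<rho> a" and \<rho>: "0 \<le> \<rho>'" "\<rho>' < \<rho>" and s: "s \<le> p"
  shows "wsummable p \<rho>' (mshift s a)" "wnorm p \<rho>' (mshift s a) \<le> wnorm p \<rho> a / (\<rho> - \<rho>')"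
proof -
  let ?u = "\<lambda>\<alpha>::nat \<Rightarrow> nat. \<alpha>(s := Suc (\<alpha> s))"
  let ?g = "\<lambda>\<beta>. norm (a \<beta>) * \<rho> ^ mdeg p \<beta> / (\<rho> - \<rho>')"
  have gs: "?g summable_on multi_indices p"
    using a unfolding wsummable_def divide_inverse by (rule summable_on_cmult_left)
  have gs': "?g summable_on ?u ` multi_indices p"
    by (rule summable_on_subset_banach[OF gs]) (auto simp: image_upd_Suc[OF s])
  hence g2: "(?g \<circ> ?u) summable_on multi_indices p"
    by (simp add: summable_on_reindex[OF inj_on_upd_Suc])
  have le: "norm (mshift s a \<alpha>) * \<rho>' ^ mdeg p \<alpha> \<le> (?g \<circ> ?u) \<alpha>" for \<alpha>
  proof -
    have "real (Suc (\<alpha> s)) * \<rho>' ^ mdeg p \<alpha> \<le> real (Suc (mdeg p \<alpha>)) * \<rho>' ^ mdeg p \<alpha>"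
      using le_mdeg[OF s, of \<alpha>] \<rho> by (intro mult_right_mono) auto
    also have "\<dots> \<le> \<rho> ^ Suc (mdeg p \<alpha>) / (\<rho> - \<rho>')" by (rule power_diff_bound[OF \<rho>])
    finally have "norm (a (?u \<alpha>)) * (real (Suc (\<alpha> s)) * \<rho>' ^ mdeg p \<alpha>) \<le> norm (a (?u \<alpha>)) * (\<rho> ^ Suc (mdeg p \<alpha>) / (\<rho> - \<rho>'))"
      by (rule mult_left_mono) auto
    thus ?thesis by (simp only: mshift_def o_def mdeg_Suc[OF s]) (simp add: mult_ac)
  qed
  show 1: "wsummable p \<rho>' (mshift s a)"
    unfolding wsummable_def using \<rho> by (intro summable_on_comparison_test[OF g2] le) auto
  have "wnorm p \<rho>' (mshift s a) \<le> infsum (?g \<circ> ?u) (multi_indices p)"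
    unfolding wnorm_def using 1 g2 le by (intro infsum_mono) (auto simp: wsummable_def)
  also have "\<dots> = infsum ?g (?u ` multi_indices p)"
    by (simp add: infsum_reindex[OF inj_on_upd_Suc])
  also have "\<dots> \<le> infsum ?g (multi_indices p)"
    using \<rho> by (intro infsum_mono2 gs gs') (auto simp: image_upd_Suc[OF s])
  also have "\<dots> = wnorm p \<rho> a / (\<rho> - \<rho>')"
    unfolding wnorm_def divide_inverse using a by (intro infsum_cmult_left) (auto simp: wsummable_def)
  finally show "wnorm p \<rho>' (mshift s a) \<le> wnorm p \<rho> a / (\<rho> - \<rho>')" .
qed

text \<open>Finitely many strict inequalities leave room for a radius in between. It is used where
  summability is known only strictly inside the box.\<close>

lemma radius_between:
  fixes h :: "nat \<Rightarrow> real"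
  assumes "\<And>i. i \<le> p \<Longrightarrow> \<bar>h i\<bar> < \<rho>"
  obtains \<rho>' where "\<And>i. i \<le> p \<Longrightarrow> \<bar>h i\<bar> < \<rho>'" "0 < \<rho>'" "\<rho>' < \<rho>"
proof -
  define K where "K = Max ((\<lambda>i. \<bar>h i\<bar>) ` {..p})"
  have "K < \<rho>" using assms unfolding K_def by (subst Max_less_iff) auto
  have le: "\<bar>h i\<bar> \<le> K" if "i \<le> p" for i using that unfolding K_def by (intro Max_ge) auto
  from le[of 0] have "0 \<le> K" using abs_ge_zero[of "h 0"] by linarith
  show ?thesis
  proof (rule that[of "(K + \<rho>) / 2"])
    fix i assume "i \<le> p"
    hence "\<bar>h i\<bar> \<le> K" by (rule le)
    also have "K < (K + \<rho>) / 2" using \<open>K < \<rho>\<close> by simp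
    finally show "\<bar>h i\<bar> < (K + \<rho>) / 2" .
  qed (use \<open>K < \<rho>\<close> \<open>0 \<le> K\<close> in auto)
qed

lemma mseries_has_vector_derivative:
  assumes a: "wsummable p \<rho> a" and s: "s \<le> p" and h: "\<And>i. i \<le> p \<Longrightarrow> \<bar>h i\<bar> < \<rho>"
  shows "((\<lambda>t. mseries p a (h(s := t))) has_vector_derivative mseries p (mshift s a) h) (at (h s))"
proof -
  obtain \<rho>' where \<rho>': "\<And>i. i \<le> p \<Longrightarrow> \<bar>h i\<bar> < \<rho>'" "0 < \<rho>'" "\<rho>' < \<rho>"
    using radius_between[of p h \<rho>] h by blast
  let ?r = "\<lambda>\<alpha>. \<Prod>i\<in>{..p} - {s}. h i ^ \<alpha> i"
  let ?f' = "\<lambda>\<alpha> t. (real (\<alpha> s) * t ^ (\<alpha> s - 1) * ?r \<alpha>) *\<^sub>R a \<alpha>"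
  let ?u = "\<lambda>\<alpha>::nat \<Rightarrow> nat. \<alpha>(s := Suc (\<alpha> s))"
  have r_eq: "mpow p (h(s := t)) \<alpha> = t ^ \<alpha> s * ?r \<alpha>" for \<alpha> t
    unfolding mpow_remove[OF s] by (auto intro!: arg_cong2[where f = "(*)"] prod.cong)
  have r_le: "\<bar>?r \<alpha>\<bar> \<le> \<rho>' ^ (\<Sum>i\<in>{..p} - {s}. \<alpha> i)" for \<alpha>
    unfolding abs_prod power_sum power_abs by (rule prod_mono) (use \<rho>' in \<open>force intro: power_mono\<close>)
  have M0: "(\<lambda>\<beta>. norm (a \<beta>) * \<rho> ^ mdeg p \<beta> / (\<rho> - \<rho>')) summable_on multi_indices p"
    using a unfolding wsummable_def divide_inverse by (rule summable_on_cmult_left)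
  have "((\<lambda>t. \<Sum>\<^sub>\<infinity>\<alpha>\<in>multi_indices p. mpow p (h(s := t)) \<alpha> *\<^sub>R a \<alpha>) has_vector_derivative
          (\<Sum>\<^sub>\<infinity>\<alpha>\<in>multi_indices p. ?f' \<alpha> (h s))) (at (h s))"
  \<comment> \<open>Only the coordinate \<open>s\<close> moves, over the interval of radius \<rho>';
    the gap \<rho> - \<rho>' pays for the differentiated monomials uniformly in t.\<close>
  proof (rule has_vector_derivative_infsum[OF countable_multi_indices infinite_multi_indices, where S = "{-\<rho>'<..<\<rho>'}"])
    show "h s \<in> {- \<rho>'<..<\<rho>'}" using \<rho>'(1)[OF s] by auto
    fix \<alpha> t assume t: "t \<in> {- \<rho>'<..<\<rho>'}"
    show "((\<lambda>t. mpow p (h(s := t)) \<alpha> *\<^sub>R a \<alpha>) has_vector_derivative ?f' \<alpha> t) (at t)"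
      unfolding r_eq by (auto intro!: derivative_eq_intros has_vector_derivative_real_field simp: has_real_derivative_iff_has_vector_derivative[symmetric])
    show "norm (?f' \<alpha> t) \<le> norm (a \<alpha>) * \<rho> ^ mdeg p \<alpha> / (\<rho> - \<rho>')"
    proof (cases "\<alpha> s")
      case (Suc n)
      have md: "mdeg p \<alpha> = Suc (n + (\<Sum>i\<in>{..p} - {s}. \<alpha> i))"
        using mdeg_upd[OF s, of \<alpha> "\<alpha> s", unfolded fun_upd_triv] Suc by simp
      have "\<bar>t\<bar> ^ n * \<bar>?r \<alpha>\<bar> \<le> \<rho>' ^ n * \<rho>' ^ (\<Sum>i\<in>{..p} - {s}. \<alpha> i)"
        using t \<rho>' by (intro mult_mono power_mono r_le) auto
      also have "\<dots> = \<rho>' ^ (mdeg p \<alpha> - 1)" by (simp add: md power_add)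
      finally have "real (\<alpha> s) * (\<bar>t\<bar> ^ n * \<bar>?r \<alpha>\<bar>) \<le> real (mdeg p \<alpha>) * \<rho>' ^ (mdeg p \<alpha> - 1)"
        using le_mdeg[OF s, of \<alpha>] by (intro mult_mono) auto
      also have "\<dots> \<le> \<rho> ^ mdeg p \<alpha> / (\<rho> - \<rho>')"
        using power_diff_bound[of \<rho>' \<rho> "mdeg p \<alpha> - 1"] \<rho>' by (simp add: md)
      finally have "(real (\<alpha> s) * (\<bar>t\<bar> ^ n * \<bar>?r \<alpha>\<bar>)) * norm (a \<alpha>) \<le> (\<rho> ^ mdeg p \<alpha> / (\<rho> - \<rho>')) * norm (a \<alpha>)"
        by (rule mult_right_mono) auto
      thus ?thesis by (simp add: Suc abs_mult power_abs mult_ac)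
    qed (use \<rho>' in auto)
    show "norm (mpow p (h(s := t)) \<alpha> *\<^sub>R a \<alpha>) \<le> norm (a \<alpha>) * \<rho> ^ mdeg p \<alpha>"
    proof -
      have "\<bar>mpow p (h(s := t)) \<alpha>\<bar> \<le> \<rho> ^ mdeg p \<alpha>"
        by (rule abs_mpow_le) (use \<rho>' t h in \<open>auto intro: less_imp_le\<close>)
      thus ?thesis by (simp add: mult.commute mult_left_mono)
    qed
  qed (use a M0 in \<open>auto simp: wsummable_def\<close>)
  \<comment> \<open>Monomials without the variable \<open>s\<close> have derivative 0, so only the
    indices in the image of the shift survive and the sum can be reindexed.\<close>
  also have "(\<Sum>\<^sub>\<infinity>\<alpha>\<in>multi_indices p. ?f' \<alpha> (h s)) = infsum (\<lambda>\<alpha>. ?f' \<alpha> (h s)) (?u ` multi_indices p)"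
    unfolding image_upd_Suc[OF s] by (rule infsum_cong_neutral) auto
  also have "\<dots> = mseries p (mshift s a) h"
    unfolding infsum_reindex[OF inj_on_upd_Suc] mseries_def
  proof (rule infsum_cong)
    fix \<alpha>
    have "?r (?u \<alpha>) = ?r \<alpha>" by (rule prod.cong) auto
    thus "((\<lambda>\<alpha>. ?f' \<alpha> (h s)) \<circ> ?u) \<alpha> = mpow p h \<alpha> *\<^sub>R mshift s a \<alpha>"
      by (simp add: mpow_remove[OF s] mshift_def mult_ac)
  qed
  finally show ?thesis unfolding mseries_def .
qed

lemma continuous_on_mseries:
  assumes a: "wsummable p \<rho> a" and g: "\<And>s. s \<le> p \<Longrightarrow> continuous_on X (\<lambda>x. g x s)"
    "\<And>s x. x \<in> X \<Longrightarrow> s \<le> p \<Longrightarrow> \<bar>g x s\<bar> \<le> \<rho>"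
  shows "continuous_on X (\<lambda>x. mseries p a (g x))"
proof -
  have "uniform_limit X (\<lambda>F x. \<Sum>\<alpha>\<in>F. mpow p (g x) \<alpha> *\<^sub>R a \<alpha>) (\<lambda>x. mseries p a (g x))
     (finite_subsets_at_top (multi_indices p))"
  proof (rule Weierstrass_m_test_general')
    show "((\<lambda>\<alpha>. mpow p (g x) \<alpha> *\<^sub>R a \<alpha>) has_sum mseries p a (g x)) (multi_indices p)" if "x \<in> X" for x
      by (rule mseries_has_sum[OF a]) (use g that in auto)
    show "norm (mpow p (g x) \<alpha> *\<^sub>R a \<alpha>) \<le> norm (a \<alpha>) * \<rho> ^ mdeg p \<alpha>" if "x \<in> X" for \<alpha> x
      using abs_mpow_le[of p "g x" \<rho> \<alpha>] g(2)[OF that] by (simp add: mult.commute mult_left_mono)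
  qed (use a in \<open>auto simp: wsummable_def\<close>)
  thus ?thesis
    by (rule uniform_limit_theorem[rotated])
       (auto simp: mpow_def intro!: always_eventually continuous_intros g)
qed

text \<open>In finite dimension unconditional and absolute convergence agree, by the real case in
  each coordinate. This connects the definition of analyticity with the weighted norms.\<close>

lemma summable_on_norm_euclidean:
  fixes f :: "'i \<Rightarrow> 'a::euclidean_space"
  assumes "f summable_on A"
  shows "(\<lambda>x. norm (f x)) summable_on A"
proof -
  have ab: "(\<lambda>x. \<bar>f x \<bullet> b\<bar>) summable_on A" for b
    using summable_on_bounded_linear[OF bounded_linear_inner_left[of b] assms]
    by (subst (asm) summable_on_iff_abs_summable_on_real) simp
  have "(\<lambda>x. \<Sum>b\<in>B. \<bar>f x \<bullet> b\<bar>) summable_on A" if "finite B" for B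
    using that by (induction B rule: finite_induct) (auto intro: summable_on_add ab)
  from this[OF finite_Basis] show ?thesis
    by (rule summable_on_comparison_test) (auto intro: norm_le_l1)
qed

lemma wnorm_mono:
  assumes "wsummable p \<rho> a" "0 \<le> \<rho>'" "\<rho>' \<le> \<rho>"
  shows "wnorm p \<rho>' a \<le> wnorm p \<rho> a"
  using assms wsummable_mono[OF assms] unfolding wnorm_def wsummable_def
  by (intro infsum_mono) (auto intro!: mult_left_mono power_mono)

lemma wnorm_linear_sum:
  fixes L :: "'i \<Rightarrow> 'b::banach \<Rightarrow> 'c::banach"
  assumes b: "\<And>s. s \<in> S \<Longrightarrow> wsummable p \<rho> (b s)" and \<rho>: "0 \<le> \<rho>"
    and L: "\<And>s x. s \<in> S \<Longrightarrow> norm (L s x) \<le> N * norm x" and S: "finite S"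
  shows "wsummable p \<rho> (\<lambda>\<alpha>. \<Sum>s\<in>S. L s (b s \<alpha>))"
    "wnorm p \<rho> (\<lambda>\<alpha>. \<Sum>s\<in>S. L s (b s \<alpha>)) \<le> N * (\<Sum>s\<in>S. wnorm p \<rho> (b s))"
proof -
  let ?g = "\<lambda>\<alpha>. N * (\<Sum>s\<in>S. norm (b s \<alpha>) * \<rho> ^ mdeg p \<alpha>)"
  have gs: "((\<lambda>\<alpha>. \<Sum>s\<in>T. norm (b s \<alpha>) * \<rho> ^ mdeg p \<alpha>) has_sum (\<Sum>s\<in>T. wnorm p \<rho> (b s))) (multi_indices p)"
    if "T \<subseteq> S" for T
    using finite_subset[OF that S] that
  proof (induction T rule: finite_induct)
    case (insert s T)
    have "((\<lambda>\<alpha>. norm (b s \<alpha>) * \<rho> ^ mdeg p \<alpha>) has_sum wnorm p \<rho> (b s)) (multi_indices p)"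
      using b[of s] insert.prems unfolding wnorm_def wsummable_def by (intro has_sum_infsum) auto
    from has_sum_add[OF this insert.IH] insert show ?case by simp
  qed simp
  have g: "(?g has_sum N * (\<Sum>s\<in>S. wnorm p \<rho> (b s))) (multi_indices p)"
    by (rule has_sum_cmult_right[OF gs]) simp
  have le: "norm (\<Sum>s\<in>S. L s (b s \<alpha>)) * \<rho> ^ mdeg p \<alpha> \<le> ?g \<alpha>" for \<alpha>
  proof -
    have "norm (\<Sum>s\<in>S. L s (b s \<alpha>)) \<le> (\<Sum>s\<in>S. N * norm (b s \<alpha>))"
      by (rule sum_norm_le) (rule L)
    hence "norm (\<Sum>s\<in>S. L s (b s \<alpha>)) * \<rho> ^ mdeg p \<alpha> \<le> (\<Sum>s\<in>S. N * norm (b s \<alpha>)) * \<rho> ^ mdeg p \<alpha>"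
      using \<rho> by (intro mult_right_mono) auto
    thus ?thesis by (simp add: sum_distrib_left sum_distrib_right mult_ac)
  qed
  show 1: "wsummable p \<rho> (\<lambda>\<alpha>. \<Sum>s\<in>S. L s (b s \<alpha>))"
    unfolding wsummable_def using \<rho> by (intro summable_on_comparison_test[OF has_sum_imp_summable[OF g]] le) auto
  show "wnorm p \<rho> (\<lambda>\<alpha>. \<Sum>s\<in>S. L s (b s \<alpha>)) \<le> N * (\<Sum>s\<in>S. wnorm p \<rho> (b s))"
    unfolding wnorm_def[of p \<rho> "\<lambda>\<alpha>. \<Sum>s\<in>S. L s (b s \<alpha>)"]
    by (rule has_sum_mono[OF has_sum_infsum g le]) (use 1 in \<open>simp add: wsummable_def\<close>)
qed

lemma mseries_linear_sum:
  fixes L :: "'i \<Rightarrow> 'b::banach \<Rightarrow> 'c::banach"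
  assumes b: "\<And>s. s \<in> S \<Longrightarrow> wsummable p \<rho> (b s)" and h: "\<And>s. s \<le> p \<Longrightarrow> \<bar>h s\<bar> \<le> \<rho>"
    and L: "\<And>s. s \<in> S \<Longrightarrow> bounded_linear (L s)" and S: "finite S"
  shows "mseries p (\<lambda>\<alpha>. \<Sum>s\<in>S. L s (b s \<alpha>)) h = (\<Sum>s\<in>S. L s (mseries p (b s) h))"
proof -
  have "((\<lambda>\<alpha>. mpow p h \<alpha> *\<^sub>R (\<Sum>s\<in>T. L s (b s \<alpha>))) has_sum (\<Sum>s\<in>T. L s (mseries p (b s) h))) (multi_indices p)"
    if "T \<subseteq> S" for T
    using finite_subset[OF that S] that
  proof (induction T rule: finite_induct)
    case (insert s T)
    have sS: "s \<in> S" using insert.prems by auto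
    have "((\<lambda>\<alpha>. L s (mpow p h \<alpha> *\<^sub>R b s \<alpha>)) has_sum L s (mseries p (b s) h)) (multi_indices p)"
      by (rule has_sum_bounded_linear[OF L[OF sS] mseries_has_sum[OF b[OF sS] h]])
    hence 1: "((\<lambda>\<alpha>. mpow p h \<alpha> *\<^sub>R L s (b s \<alpha>)) has_sum L s (mseries p (b s) h)) (multi_indices p)"
      by (simp add: linear_simps(5)[OF L[OF sS]])
    from has_sum_add[OF this insert.IH] insert show ?case by (simp add: scaleR_add_right)
  qed simp
  from this[OF order.refl] show ?thesis unfolding mseries_def[of p "\<lambda>\<alpha>. \<Sum>s\<in>S. L s (b s \<alpha>)"] by (rule infsumI)
qed

text \<open>Symmetry of second derivatives, which is immediate for coefficients.\<close>

lemma mshift_commute: "mshift s (mshift t a) = mshift t (mshift s a)"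
  by (cases "s = t") (auto simp: mshift_def fun_eq_iff fun_upd_twist mult.commute)

lemma mseries_scale: "mseries p (\<lambda>\<alpha>. c *\<^sub>R b \<alpha>) h = c *\<^sub>R mseries p b h"
proof -
  have "mseries p (\<lambda>\<alpha>. c *\<^sub>R b \<alpha>) h = (\<Sum>\<^sub>\<infinity>\<alpha>\<in>multi_indices p. c *\<^sub>R (mpow p h \<alpha> *\<^sub>R b \<alpha>))"
    by (simp add: mseries_def mult.commute)
  thus ?thesis unfolding mseries_def by (simp only: infsum_scaleR_right)
qed

section \<open>A divergence bound on cubes\<close>

text \<open>Points are functions vanishing outside \<open>S\<close>, so an induction over
  \<open>S\<close> can integrate out one coordinate without changing the type.\<close>

definition cube :: "nat set \<Rightarrow> real \<Rightarrow> (nat \<Rightarrow> real) set" where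
  "cube S \<eta> = {x. (\<forall>s\<in>S. 0 \<le> x s \<and> x s \<le> \<eta>) \<and> (\<forall>s. s \<notin> S \<longrightarrow> x s = 0)}"

lemma continuous_on_fun_upd:
  fixes f :: "'b::topological_space \<Rightarrow> nat \<Rightarrow> real"
  assumes "continuous_on A f" "continuous_on A g"
  shows "continuous_on A (\<lambda>x. (f x)(s := g x))"
proof (rule continuous_on_coordinatewise_then_product)
  fix i
  have "continuous_on A (\<lambda>x. f x i)"
    by (rule continuous_on_product_then_coordinatewise[OF assms(1)])
  thus "continuous_on A (\<lambda>x. ((f x)(s := g x)) i)" using assms(2) by (cases "i = s") auto
qed

text \<open>The integral of the divergence is at least c \<eta>^n, while the flux through the 2 n
  faces is at most 2 n \<epsilon> \<eta>^(n-1), with n = card S. The bound involves the size of the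
  field alone and not that of its derivatives. The induction integrates one coordinate at a
  time.\<close>

lemma divergence_cube_bound:
  fixes g d :: "nat \<Rightarrow> (nat \<Rightarrow> real) \<Rightarrow> real"
  assumes "finite S" and \<eta>: "0 < \<eta>"
    and "\<And>s. s \<in> S \<Longrightarrow> continuous_on (cube S \<eta>) (g s)"
    and "\<And>s. s \<in> S \<Longrightarrow> continuous_on (cube S \<eta>) (d s)"
    and "\<And>s x. s \<in> S \<Longrightarrow> x \<in> cube S \<eta> \<Longrightarrow>
          ((\<lambda>t. g s (x(s := t))) has_real_derivative d s x) (at (x s) within {0..\<eta>})"
    and "\<And>s x. s \<in> S \<Longrightarrow> x \<in> cube S \<eta> \<Longrightarrow> \<bar>g s x\<bar> \<le> \<epsilon>"
    and "\<And>x. x \<in> cube S \<eta> \<Longrightarrow> c \<le> (\<Sum>s\<in>S. d s x)"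
  shows "c * \<eta> \<le> 2 * real (card S) * \<epsilon>"
  using assms(1,3-)
proof (induction S arbitrary: g d c rule: finite_induct)
  case empty
  have "(\<lambda>_. 0) \<in> cube {} \<eta>" by (auto simp: cube_def)
  from empty(5)[OF this] have "c \<le> 0" by simp
  thus ?case using \<eta> by (simp add: mult_nonpos_nonneg)
next
  case (insert u S)
  have upd: "x(u := t) \<in> cube (insert u S) \<eta>" if "x \<in> cube S \<eta>" "t \<in> {0..\<eta>}" for x t
    using that by (auto simp: cube_def)
  have cu: "continuous_on (cube S \<eta> \<times> cbox 0 \<eta>) (\<lambda>(x, t). F (x(u := t)))"
    if "continuous_on (cube (insert u S) \<eta>) F" for F :: "(nat \<Rightarrow> real) \<Rightarrow> real"
    unfolding case_prod_beta
    by (rule continuous_on_compose2[OF that], intro continuous_on_fun_upd continuous_on_fst continuous_on_snd continuous_on_id)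
       (auto intro!: upd simp: cbox_interval)
  \<comment> \<open>Averages over the coordinate \<open>u\<close>: dividing by \<eta> keeps the
    bound \<epsilon> on the field unchanged.\<close>
  define g' where "g' s x = integral (cbox 0 \<eta>) (\<lambda>t. g s (x(u := t))) / \<eta>" for s x
  define d' where "d' s x = integral (cbox 0 \<eta>) (\<lambda>t. d s (x(u := t))) / \<eta>" for s x
  have cl: "continuous_on (cbox 0 \<eta>) (\<lambda>t. F (x(u := t)))"
    if "continuous_on (cube (insert u S) \<eta>) F" "x \<in> cube S \<eta>" for F :: "(nat \<Rightarrow> real) \<Rightarrow> real" and x
    by (rule continuous_on_compose2[OF that(1)], intro continuous_on_fun_upd continuous_on_const continuous_on_id)
       (use that(2) in \<open>auto intro!: upd simp: cbox_interval\<close>)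
  \<comment> \<open>The two faces orthogonal to direction \<open>u\<close> carry an averaged flux of
    at most 2 \<epsilon> / \<eta>, which is deducted from the lower bound for the remaining
    divergence.\<close>
  have "(c - 2 * \<epsilon> / \<eta>) * \<eta> \<le> 2 * real (card S) * \<epsilon>"
  proof (rule insert.IH[of g' d'])
    fix s assume s: "s \<in> S"
    have cg: "continuous_on (cube (insert u S) \<eta>) (g s)" and cd: "continuous_on (cube (insert u S) \<eta>) (d s)"
      using insert.prems(1,2)[of s] s by auto
    show "continuous_on (cube S \<eta>) (g' s)" "continuous_on (cube S \<eta>) (d' s)"
      unfolding g'_def d'_def divide_inverse
      by (intro continuous_on_mult continuous_on_const integral_continuous_on_param cu cg cd)+
    fix x assume x: "x \<in> cube S \<eta>"
    have su: "s \<noteq> u" using s insert.hyps by auto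
    show "((\<lambda>t. g' s (x(s := t))) has_real_derivative d' s x) (at (x s) within {0..\<eta>})"
    proof -
      have xs: "x(s := r) \<in> cube S \<eta>" if "r \<in> {0..\<eta>}" for r
        using x s that by (auto simp: cube_def)
      have "((\<lambda>r. integral (cbox 0 \<eta>) (\<lambda>t. g s (x(s := r, u := t)))) has_field_derivative
            integral (cbox 0 \<eta>) (\<lambda>t. d s (x(s := x s, u := t)))) (at (x s) within {0..\<eta>})"
      proof (rule leibniz_rule_field_derivative)
        fix r t assume r: "r \<in> {0..\<eta>}" and t: "t \<in> cbox 0 \<eta>"
        have "x(s := r, u := t) \<in> cube (insert u S) \<eta>" using upd[OF xs[OF r]] t by (simp add: cbox_interval)
        note D = insert.prems(3)[OF _ this, of s]
        have eq: "(x(s := r, u := t))(s := r') = x(s := r', u := t)" for r' using su by (auto simp: fun_eq_iff)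
        have xr: "(x(s := r, u := t)) s = r" using su by simp
        from D[unfolded eq xr] s show "((\<lambda>r. g s (x(s := r, u := t))) has_real_derivative d s (x(s := r, u := t))) (at r within {0..\<eta>})"
          by blast
      next
        fix r assume r: "r \<in> {0..\<eta>}"
        show "(\<lambda>t. g s (x(s := r, u := t))) integrable_on cbox 0 \<eta>"
          by (rule integrable_continuous, rule cl[OF cg xs[OF r]])
      next
        show "continuous_on ({0..\<eta>} \<times> cbox 0 \<eta>) (\<lambda>(r, t). d s (x(s := r, u := t)))"
          unfolding case_prod_beta
          by (rule continuous_on_compose2[OF cd],
              intro continuous_on_fun_upd continuous_on_fst continuous_on_snd continuous_on_id continuous_on_const)
             (auto intro!: upd xs simp: cbox_interval)
      qed (use x s in \<open>auto simp: cube_def\<close>)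
      hence "((\<lambda>r. integral (cbox 0 \<eta>) (\<lambda>t. g s (x(s := r, u := t))) / \<eta>) has_field_derivative
            integral (cbox 0 \<eta>) (\<lambda>t. d s (x(s := x s, u := t))) / \<eta>) (at (x s) within {0..\<eta>})"
        by (rule DERIV_cdivide)
      thus ?thesis unfolding g'_def d'_def by simp
    qed
    show "\<bar>g' s x\<bar> \<le> \<epsilon>"
    proof -
      have "norm (integral (cbox 0 \<eta>) (\<lambda>t. g s (x(u := t)))) \<le> \<epsilon> * measure lborel (cbox 0 \<eta>)"
      proof (rule integrable_bound)
        have "(\<lambda>_. 0) (u := 0) \<in> cube (insert u S) \<eta>" using \<eta> by (auto simp: cube_def)
        from insert.prems(4)[OF _ this, of s] s show "0 \<le> \<epsilon>" by auto
        show "(\<lambda>t. g s (x(u := t))) integrable_on cbox 0 \<eta>"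
          by (rule integrable_continuous, rule cl[OF cg x])
        show "norm (g s (x(u := t))) \<le> \<epsilon>" if "t \<in> cbox 0 \<eta>" for t
          unfolding real_norm_def by (rule insert.prems(4)[OF insertI2[OF s] upd[OF x]]) (use that in \<open>simp add: cbox_interval\<close>)
      qed
      thus ?thesis using \<eta> by (simp add: g'_def field_simps)
    qed
  next
    fix x assume x: "x \<in> cube S \<eta>"
    let ?D = "\<lambda>s. integral (cbox 0 \<eta>) (\<lambda>t. d s (x(u := t)))"
    have int: "(\<lambda>t. d s (x(u := t))) integrable_on cbox 0 \<eta>" if "s \<in> insert u S" for s
      by (rule integrable_continuous, rule cl[OF insert.prems(2)[OF that] x])
    have "((\<lambda>t. d u (x(u := t))) has_integral g u (x(u := \<eta>)) - g u (x(u := 0))) {0..\<eta>}"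
    proof (rule fundamental_theorem_of_calculus)
      fix t assume t: "t \<in> {0..\<eta>}"
      note D = insert.prems(3)[OF insertI1 upd[OF x t]]
      show "((\<lambda>t. g u (x(u := t))) has_vector_derivative d u (x(u := t))) (at t within {0..\<eta>})"
        using D by (simp only: has_real_derivative_iff_has_vector_derivative fun_upd_upd fun_upd_same)
    qed (use \<eta> in auto)
    hence "?D u = g u (x(u := \<eta>)) - g u (x(u := 0))" by (simp add: cbox_interval integral_unique)
    moreover have "\<bar>g u (x(u := \<eta>))\<bar> \<le> \<epsilon>" "\<bar>g u (x(u := 0))\<bar> \<le> \<epsilon>"
      by (intro insert.prems(4) insertI1 upd x; use \<eta> in simp)+
    ultimately have Du: "?D u \<le> 2 * \<epsilon>" by linarith
    have "c * \<eta> = integral (cbox 0 \<eta>) (\<lambda>t. c)" using \<eta> by simp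
    also have "\<dots> \<le> integral (cbox 0 \<eta>) (\<lambda>t. \<Sum>s\<in>insert u S. d s (x(u := t)))"
      using insert.hyps(1) by (intro integral_le integrable_sum int insert.prems(5) upd x) (auto simp: cbox_interval)
    also have "\<dots> = (\<Sum>s\<in>insert u S. ?D s)"
      by (rule integral_sum) (use insert.hyps int in auto)
    also have "\<dots> = ?D u + \<eta> * (\<Sum>s\<in>S. d' s x)"
      using insert.hyps \<eta> by (simp add: d'_def sum_divide_distrib[symmetric])
    finally have "c * \<eta> \<le> 2 * \<epsilon> + \<eta> * (\<Sum>s\<in>S. d' s x)" using Du by simp
    thus "c - 2 * \<epsilon> / \<eta> \<le> (\<Sum>s\<in>S. d' s x)" using \<eta> by (simp add: field_simps)
  qed
  hence "c * \<eta> \<le> 2 * \<epsilon> + 2 * real (card S) * \<epsilon>" using \<eta> by (simp add: left_diff_distrib)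
  thus ?case using insert.hyps by (simp add: algebra_simps)
qed

section \<open>The algebra and its Dirac operators\<close>

text \<open>Left alternativity stands in for associativity: together with \<open>v_sq\<close> and
  \<open>v_anti\<close> it makes the left multiplications by \<open>v 1\<close>, ...,
  \<open>v m\<close> generators of a Clifford algebra of operators.\<close>

locale ck_frame =
  fixes mul :: "'a::euclidean_space \<Rightarrow> 'a \<Rightarrow> 'a" and one :: 'a and v :: "nat \<Rightarrow> 'a" and m p :: nat
  assumes bilinear_mul: "bilinear mul"
    and one_mul: "mul one a = a"
    and mul_one: "mul a one = a"
    and left_alt: "mul a (mul a b) = mul (mul a a) b"
    and v_0: "v 0 = one"
    and v_sq: "1 \<le> s \<Longrightarrow> s \<le> m \<Longrightarrow> mul (v s) (v s) = - one"
    and v_anti: "1 \<le> s \<Longrightarrow> s \<le> m \<Longrightarrow> 1 \<le> t \<Longrightarrow> t \<le> m \<Longrightarrow> s \<noteq> t \<Longrightarrow> mul (v s) (v t) = - mul (v t) (v s)"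
    and v_inj: "inj_on v {..m}"
    and v_indep: "independent (v ` {..m})"
    and p_less_m: "p < m"
begin

sublocale mul: bounded_bilinear mul
  using bilinear_mul bilinear_conv_bounded_bilinear by blast

text \<open>A dual functional on the whole space, so that coordinates are linear and continuous
  everywhere; its values off the span of the frame depend on the choice of the extension.\<close>

definition crd :: "nat \<Rightarrow> 'a \<Rightarrow> real" where
  "crd s = (SOME g. linear g \<and> (\<forall>t\<le>m. g (v t) = (if t = s then 1 else 0)))"

lemma crd_linear: "linear (crd s)"
  and crd_v: "t \<le> m \<Longrightarrow> crd s (v t) = (if t = s then 1 else 0)"
proof -
  \<comment> \<open>The guard \<open>s \<le> m\<close> makes the functional vanish on the frame for
    larger \<open>s\<close>, even if \<open>v s\<close> should coincide with some frame
    vector.\<close>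
  let ?f = "\<lambda>x. if x = v s \<and> s \<le> m then 1 else 0 :: real"
  obtain g :: "'a \<Rightarrow> real" where g: "linear g" "\<forall>x\<in>v ` {..m}. g x = ?f x"
    using linear_independent_extend[OF v_indep, of ?f] by (elim exE conjE)
  have "g (v t) = (if t = s then 1 else 0)" if t: "t \<le> m" for t
  proof -
    have "g (v t) = ?f (v t)" using g(2) t by (meson atMost_iff imageI)
    moreover have "v t = v s \<and> s \<le> m \<longleftrightarrow> t = s" using t inj_onD[OF v_inj, of t s] by (metis atMost_iff)
    ultimately show ?thesis by presburger
  qed
  with g(1) have "\<exists>g. linear g \<and> (\<forall>t\<le>m. g (v t) = (if t = s then 1 else 0::real))" by blast
  hence "linear (crd s) \<and> (\<forall>t\<le>m. crd s (v t) = (if t = s then 1 else 0))"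
    unfolding crd_def by (rule someI_ex)
  thus "linear (crd s)" "t \<le> m \<Longrightarrow> crd s (v t) = (if t = s then 1 else 0)" by blast+
qed

lemmas crd_add = linear_add[OF crd_linear]
  and crd_diff = linear_diff[OF crd_linear]
  and crd_scale = linear_scale[OF crd_linear]
  and crd_sum = linear_sum[OF crd_linear]
  and crd_0 = linear_0[OF crd_linear]

lemma continuous_on_crd [continuous_intros]: "continuous_on A f \<Longrightarrow> continuous_on A (\<lambda>x. crd s (f x))"
  by (rule bounded_linear.continuous_on[OF crd_linear[unfolded linear_conv_bounded_linear]])

lemma crd_embv:
  assumes "I \<subseteq> {..m}"
  shows "crd s (embv v I c) = (if s \<in> I then c s else 0)"
proof -
  have "finite I" using assms finite_subset by blast
  have "crd s (embv v I c) = (\<Sum>t\<in>I. if t = s then c t else 0)"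
    unfolding embv_def crd_sum by (rule sum.cong) (use assms in \<open>auto simp: crd_scale crd_v\<close>)
  thus ?thesis using \<open>finite I\<close> by simp
qed

lemma embv_in_span: "I \<subseteq> J \<Longrightarrow> embv v I c \<in> span (v ` J)"
  unfolding embv_def by (intro span_sum span_scale span_base) auto

lemma span_embv:
  assumes "x \<in> span (v ` I)" "I \<subseteq> {..m}"
  shows "x = embv v I (\<lambda>s. crd s x)"
proof -
  have fin: "finite I" using assms(2) finite_subset by blast
  have "\<exists>c. x = embv v I c" using assms(1)
  proof (induction rule: span_induct_alt)
    case base
    have "0 = embv v I (\<lambda>_. 0)" by (simp add: embv_def)
    thus ?case by blast
  next
    case (step r b x)
    then obtain t c where "t \<in> I" "b = v t" "x = embv v I c" by blast
    hence "r *\<^sub>R b + x = embv v I (\<lambda>s. (if s = t then r else 0) + c s)"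
      using fin by (simp add: embv_def scaleR_add_left sum.distrib if_distrib[of "\<lambda>r. r *\<^sub>R _"] cong: if_cong)
    thus ?case by blast
  qed
  then obtain c where c: "x = embv v I c" ..
  hence "embv v I (\<lambda>s. crd s x) = embv v I c"
    using crd_embv[OF assms(2), of _ c] by (simp add: embv_def)
  with c show ?thesis by simp
qed

section \<open>The splitting of \<open>M\<close> into the first p + 1 and the last q
  coordinates\<close>

definition xp :: "'a \<Rightarrow> 'a" where "xp x = embv v {..p} (\<lambda>s. crd s x)"
definition xq :: "'a \<Rightarrow> 'a" where "xq x = embv v {p+1..m} (\<lambda>s. crd s x)"
definition r2 :: "'a \<Rightarrow> real" where "r2 x = (\<Sum>s\<in>{p+1..m}. (crd s x)\<^sup>2)"

abbreviation "M \<equiv> span (v ` {..m})"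

lemma atMost_m: "{..m} = {..p} \<union> {p+1..m}" "{..p} \<inter> {p+1..m} = {}"
  using p_less_m by auto

lemma embv_split: "embv v {..m} c = embv v {..p} c + embv v {p+1..m} c"
  unfolding embv_def atMost_m(1) by (rule sum.union_disjoint) auto

lemma xp_xq: "x \<in> M \<Longrightarrow> xp x + xq x = x"
  using span_embv[of x "{..m}"] embv_split[of "\<lambda>s. crd s x"] by (simp add: xp_def xq_def)

lemma crd_xp: "crd s (xp x) = (if s \<le> p then crd s x else 0)"
  unfolding xp_def using p_less_m by (subst crd_embv) auto

lemma crd_xq: "crd s (xq x) = (if p < s \<and> s \<le> m then crd s x else 0)"
  unfolding xq_def by (subst crd_embv) auto

lemma xp_embv: "xp (embv v {..m} c) = embv v {..p} c"
  unfolding xp_def crd_embv[OF order.refl] using p_less_m by (auto simp: embv_def intro!: sum.cong)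

lemma xq_embv: "xq (embv v {..m} c) = embv v {p+1..m} c"
  unfolding xq_def crd_embv[OF order.refl] by (auto simp: embv_def intro!: sum.cong)

lemma xp_id: "x \<in> span (v ` {..p}) \<Longrightarrow> xp x = x"
  unfolding xp_def using span_embv[of x "{..p}"] p_less_m by simp

lemma r2_span_p:
  assumes "x \<in> span (v ` {..p})"
  shows "r2 x = 0"
proof -
  have "crd s x = 0" if "s \<in> {p+1..m}" for s
    using crd_xp[of s x] that by (simp add: xp_id[OF assms])
  thus ?thesis by (simp add: r2_def)
qed

lemma xp_linear: "linear xp" and xq_linear: "linear xq"
  unfolding xp_def xq_def embv_def
  by (auto intro!: linearI simp: crd_add crd_scale scaleR_add_left sum.distrib scaleR_sum_right)

lemmas xp_add = linear_add[OF xp_linear] and xp_scale = linear_scale[OF xp_linear]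
  and xq_add = linear_add[OF xq_linear] and xq_scale = linear_scale[OF xq_linear]

lemma continuous_on_xp [continuous_intros]: "continuous_on A f \<Longrightarrow> continuous_on A (\<lambda>x. xp (f x))"
  and continuous_on_xq [continuous_intros]: "continuous_on A f \<Longrightarrow> continuous_on A (\<lambda>x. xq (f x))"
  and continuous_on_r2 [continuous_intros]: "continuous_on A f \<Longrightarrow> continuous_on A (\<lambda>x. r2 (f x))"
  unfolding xp_def xq_def r2_def embv_def by (intro continuous_intros; assumption)+

lemma r2_nonneg: "0 \<le> r2 x"
  unfolding r2_def by (intro sum_nonneg) auto

lemma crd_le_r2: "s \<in> {p+1..m} \<Longrightarrow> \<bar>crd s x\<bar> \<le> sqrt (r2 x)"
  unfolding r2_def by (rule real_le_rsqrt) (auto intro!: member_le_sum[of s _ "\<lambda>s. (crd s x)\<^sup>2"])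

lemma xp_v: "s \<le> m \<Longrightarrow> xp (v s) = (if s \<le> p then v s else 0)"
  and xq_v: "s \<le> m \<Longrightarrow> xq (v s) = (if s \<le> p then 0 else v s)"
  by (auto simp: xp_def xq_def embv_def crd_v if_distrib[of "\<lambda>r. r *\<^sub>R _"] cong: if_cong)

lemma r2_line_p: "s \<le> p \<Longrightarrow> r2 (x + t *\<^sub>R v s) = r2 x"
  unfolding r2_def using p_less_m by (intro sum.cong) (auto simp: crd_add crd_scale crd_v)

lemma r2_line_q:
  assumes "s \<in> {p+1..m}"
  shows "r2 (x + t *\<^sub>R v s) = r2 x + 2 * t * crd s x + t\<^sup>2"
proof -
  have "r2 (x + t *\<^sub>R v s) = (\<Sum>j\<in>{p+1..m}. (crd j x)\<^sup>2 + (if j = s then 2 * t * crd s x + t\<^sup>2 else 0))"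
    unfolding r2_def using assms
    by (intro sum.cong) (auto simp: crd_add crd_scale crd_v power2_eq_square algebra_simps)
  thus ?thesis using assms by (simp add: sum.distrib r2_def)
qed

text \<open>Left alternativity at x + y, minus its instances at x and y. Anticommutation of two
  vectors thereby passes to their left multiplications.\<close>

lemma left_alt_polar: "mul x (mul y a) + mul y (mul x a) = mul (mul x y + mul y x) a"
  using left_alt[of "x + y" a] left_alt[of x a] left_alt[of y a]
  by (simp add: mul.add_left mul.add_right algebra_simps)

lemma v_mul_v: "1 \<le> s \<Longrightarrow> s \<le> m \<Longrightarrow> mul (v s) (mul (v s) a) = - a"
  by (simp add: left_alt v_sq mul.minus_left one_mul)

lemma v_mul_anti:
  "1 \<le> s \<Longrightarrow> s \<le> m \<Longrightarrow> 1 \<le> t \<Longrightarrow> t \<le> m \<Longrightarrow> s \<noteq> t \<Longrightarrow> mul (v s) (mul (v t) a) = - mul (v t) (mul (v s) a)"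
  using left_alt_polar[of "v s" "v t" a] v_anti[of s t] by (simp add: mul.zero_left eq_neg_iff_add_eq_0)

lemma xq_sq: "mul (xq x) (xq x) = (- r2 x) *\<^sub>R one"
proof -
  let ?I = "{p+1..m}" and ?c = "\<lambda>s. crd s x"
  let ?S = "\<lambda>s t. (?c s * ?c t) *\<^sub>R mul (v s) (v t)"
  have S: "mul (xq x) (xq x) = (\<Sum>s\<in>?I. \<Sum>t\<in>?I. ?S s t)"
    unfolding xq_def embv_def mul.sum_left
    by (simp only: mul.sum_right mul.scaleR_left mul.scaleR_right scaleR_scaleR mult.commute)
  \<comment> \<open>Doubling pairs each term with its transpose; anticommutation then leaves only
    the diagonal.\<close>
  have "2 *\<^sub>R mul (xq x) (xq x) = (\<Sum>s\<in>?I. \<Sum>t\<in>?I. ?S s t + ?S t s)"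
    unfolding S sum.distrib using sum.swap[of ?S ?I ?I] by (simp add: scaleR_2)
  also have "\<dots> = (\<Sum>s\<in>?I. \<Sum>t\<in>?I. if t = s then (- 2 * (?c s)\<^sup>2) *\<^sub>R one else 0)"
  proof (intro sum.cong refl)
    fix s t assume "s \<in> ?I" "t \<in> ?I"
    thus "?S s t + ?S t s = (if t = s then (- 2 * (?c s)\<^sup>2) *\<^sub>R one else 0)"
      using v_sq[of s] v_anti[of s t] by (auto simp: power2_eq_square scaleR_2[symmetric] mult.commute)
  qed
  also have "\<dots> = 2 *\<^sub>R (- r2 x) *\<^sub>R one"
    by (simp add: r2_def scaleR_sum_left scaleR_sum_right sum_distrib_left sum_negf)
  finally show ?thesis unfolding scaleR_cancel_left by simp
qed

lemma xq_mul_xq: "mul (xq x) (mul (xq x) a) = (- r2 x) *\<^sub>R a"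
  by (simp only: left_alt xq_sq mul.scaleR_left one_mul)

text \<open>\<open>E k x a\<close> is the product of the \<open>k\<close>-th power of \<open>x\<^sub>q\<close> with \<open>a\<close>, evaluated through \<open>x\<^sub>q\<^sup>2 = - r\<^sup>2\<close>;
  \<open>dE s k x a\<close> is its derivative in direction \<open>v s\<close>, where the truncated exponent \<open>k div 2 - 1\<close> is
  harmless because its coefficient vanishes. The sign \<open>\<sigma> k s\<close> arises from moving \<open>v s\<close> past that power.\<close>

definition E :: "nat \<Rightarrow> 'a \<Rightarrow> 'a \<Rightarrow> 'a" where
  "E k x a = (- r2 x) ^ (k div 2) *\<^sub>R (if even k then a else mul (xq x) a)"

definition dE :: "nat \<Rightarrow> nat \<Rightarrow> 'a \<Rightarrow> 'a \<Rightarrow> 'a" where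
  "dE s k x a = (real (k div 2) * (- r2 x) ^ (k div 2 - 1) * (- 2 * crd s x)) *\<^sub>R (if even k then a else mul (xq x) a)
     + (if even k then 0 else (- r2 x) ^ (k div 2) *\<^sub>R mul (v s) a)"

text \<open>For even k the power x_q^(k+1) is r^k x_q up to sign: the radial factor contributes k
  and the linear factor x_q contributes q = m - p. For odd k the power is purely radial and
  contributes k + 1.\<close>

definition \<gamma> :: "nat \<Rightarrow> real" where
  "\<gamma> k = (if even k then real k + real (m - p) else real k + 1)"

definition \<sigma> :: "nat \<Rightarrow> nat \<Rightarrow> real" where
  "\<sigma> k s = (if even k \<or> s = 0 then 1 else - 1)"

text \<open>The partial derivatives are an argument, so the same algebra serves derivatives of
  functions at a point and shifted coefficient families. Even k gives the operator of
  \<open>D_p\<close>, odd k its conjugate.\<close>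

definition dirac :: "nat \<Rightarrow> (nat \<Rightarrow> 'a) \<Rightarrow> 'a" where
  "dirac k b = (\<Sum>s\<le>p. \<sigma> k s *\<^sub>R mul (v s) (b s))"

lemma \<gamma>_ge: "real (Suc k) \<le> \<gamma> k"
  using p_less_m by (auto simp: \<gamma>_def)

text \<open>The nested power collapses two factors at a time to the scalar - r^2, so at most one
  factor x_q is left.\<close>

lemma powA_xq: "mul (powA mul one (xq x) k) a = E k x a"
proof -
  have "powA mul one (xq x) k = (- r2 x) ^ (k div 2) *\<^sub>R (if even k then one else xq x)"
  proof (induction k)
    case (Suc k)
    thus ?case
      by (cases "even k")
         (auto simp: mul.scaleR_right mul_one xq_sq elim!: oddE simp del: scaleR_minus_left)
  qed simp
  thus ?thesis by (auto simp: E_def mul.scaleR_left one_mul)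
qed

lemma E_linear: "linear (E k x)"
  by (rule linearI) (auto simp: E_def mul.add_right mul.scaleR_right scaleR_add_right)

lemmas E_bounded_linear = E_linear[unfolded linear_conv_bounded_linear]

lemma E_scale_point: "E k (xp x + t *\<^sub>R xq x) a = t ^ k *\<^sub>R E k x a"
proof -
  have "r2 (xp x + t *\<^sub>R xq x) = t\<^sup>2 * r2 x"
    unfolding r2_def sum_distrib_left
    by (rule sum.cong) (auto simp: crd_add crd_scale crd_xp crd_xq power_mult_distrib)
  moreover have "xq (xp x + t *\<^sub>R xq x) = t *\<^sub>R xq x"
    unfolding xq_def[of "xp x + _"] crd_add crd_scale crd_xp crd_xq
    by (auto simp: xq_def embv_def scaleR_sum_right intro!: sum.cong)
  moreover have "(- (t\<^sup>2 * r2 x)) ^ (k div 2) = t ^ (2 * (k div 2)) * (- r2 x) ^ (k div 2)"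
    by (metis mult_minus_right power_mult power_mult_distrib)
  ultimately show ?thesis unfolding E_def
    by (cases "even k") (auto simp: mul.scaleR_left elim!: evenE oddE)
qed

lemma xq_eq_sum: "mul (xq x) a = (\<Sum>s\<in>{p+1..m}. crd s x *\<^sub>R mul (v s) a)"
  by (simp add: xq_def embv_def mul.sum_left mul.scaleR_left)

text \<open>Differentiating the radial factor reassembles the sum of the x_s v_s into x_q; for even
  k this meets the x_q already present and gives - r^2. Differentiating the linear factor gives q
  copies of - a.\<close>

lemma dirac_q_E: "(\<Sum>s\<in>{p+1..m}. mul (v s) (dE s (Suc k) x a)) = (- \<gamma> k) *\<^sub>R E k x a"
proof -
  let ?I = "{p+1..m}"
  have sq: "(\<Sum>s\<in>?I. mul (v s) (mul (v s) a)) = (- real (m - p)) *\<^sub>R a"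
  proof -
    have "(\<Sum>s\<in>?I. mul (v s) (mul (v s) a)) = (\<Sum>s\<in>?I. - a)"
      by (rule sum.cong) (auto intro!: v_mul_v)
    thus ?thesis by (simp add: sum_constant_scaleR del: sum_negf)
  qed
  have lin: "(\<Sum>s\<in>?I. (c * (- 2 * crd s x)) *\<^sub>R mul (v s) b) = (- 2 * c) *\<^sub>R mul (xq x) b" for c b
    unfolding xq_eq_sum scaleR_sum_right by (rule sum.cong) (auto simp: mult_ac)
  show ?thesis
  proof (cases "even k")
    case False
    then obtain l where k: "k = 2 * l + 1" by (auto elim: oddE)
    have "(\<Sum>s\<in>?I. mul (v s) (dE s (Suc k) x a)) = (- 2 * (real (Suc l) * (- r2 x) ^ l)) *\<^sub>R mul (xq x) a"
      unfolding lin[symmetric] by (simp add: dE_def k mul.scaleR_right mul.minus_right)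
    thus ?thesis by (simp add: E_def \<gamma>_def k algebra_simps)
  next
    case True
    then obtain l where k: "k = 2 * l" by (auto elim: evenE)
    let ?c = "real l * (- r2 x) ^ (l - 1)"
    have "(\<Sum>s\<in>?I. mul (v s) (dE s (Suc k) x a))
        = (\<Sum>s\<in>?I. (?c * (- 2 * crd s x)) *\<^sub>R mul (v s) (mul (xq x) a)) + (- r2 x) ^ l *\<^sub>R (\<Sum>s\<in>?I. mul (v s) (mul (v s) a))"
      unfolding scaleR_sum_right sum.distrib[symmetric]
      by (simp add: dE_def k mul.scaleR_right mul.add_right mul.minus_right mul.diff_right)
    also have "\<dots> = (- 2 * ?c * (- r2 x)) *\<^sub>R a + (- r2 x) ^ l *\<^sub>R (- real (m - p)) *\<^sub>R a"
      unfolding lin sq xq_mul_xq by simp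
    also have "?c * (- r2 x) = real l * (- r2 x) ^ l"
      by (cases l) auto
    hence "- 2 * ?c * (- r2 x) = - 2 * real l * (- r2 x) ^ l" by (simp only: mult.assoc)
    finally show ?thesis
      by (simp add: E_def \<gamma>_def k scaleR_add_left[symmetric] algebra_simps del: scaleR_minus_left)
  qed
qed

lemma v_mul_xq:
  assumes "s \<le> p"
  shows "mul (v s) (mul (xq x) a) = \<sigma> 1 s *\<^sub>R mul (xq x) (mul (v s) a)"
proof (cases "s = 0")
  case False
  thus ?thesis unfolding xq_eq_sum mul.sum_right mul.scaleR_right scaleR_sum_right using assms p_less_m
    by (intro sum.cong) (auto simp: \<sigma>_def v_mul_anti[of s])
qed (auto simp: v_0 one_mul \<sigma>_def)

lemma dirac_p_E: "(\<Sum>s\<le>p. mul (v s) (E k x (b s))) = E k x (dirac k b)"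
proof -
  have "mul (v s) (E k x (b s)) = E k x (\<sigma> k s *\<^sub>R mul (v s) (b s))" if "s \<le> p" for s
    using v_mul_xq[OF that] by (auto simp: E_def mul.scaleR_right \<sigma>_def)
  thus ?thesis by (simp add: dirac_def linear_sum[OF E_linear])
qed

text \<open>The polarised norm form of the vectors with indices 0 to p, with \<sigma> 1 as
  conjugation: the unit keeps its sign and the other \<open>v s\<close> change theirs.\<close>

lemma conj_pair:
  assumes "s \<le> p" "t \<le> p"
  shows "\<sigma> 1 t *\<^sub>R mul (v t) (mul (v s) a) + \<sigma> 1 s *\<^sub>R mul (v s) (mul (v t) a) = (if s = t then 2 *\<^sub>R a else 0)"
  using assms p_less_m by (auto simp: \<sigma>_def v_0 one_mul v_mul_v v_mul_anti[of t s] scaleR_2)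

text \<open>The operator and its conjugate factor the Laplacian in either order;
  \<open>odd (k + l)\<close> says that exactly one of the two is conjugated, and \<open>b\<close>
  plays the Hessian. Pairing each term with its transpose cancels the mixed derivatives.\<close>

lemma dirac_laplace:
  assumes b: "\<And>s t. s \<le> p \<Longrightarrow> t \<le> p \<Longrightarrow> b s t = b t s" and kl: "odd (k + l)"
  shows "dirac k (\<lambda>t. dirac l (b t)) = (\<Sum>s\<le>p. b s s)"
proof -
  let ?S = "\<lambda>t s. (\<sigma> k t * \<sigma> l s) *\<^sub>R mul (v t) (mul (v s) (b t s))"
  have S: "dirac k (\<lambda>t. dirac l (b t)) = (\<Sum>t\<le>p. \<Sum>s\<le>p. ?S t s)"
    by (simp add: dirac_def mul.sum_right mul.scaleR_right scaleR_sum_right)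
  have "2 *\<^sub>R dirac k (\<lambda>t. dirac l (b t)) = (\<Sum>t\<le>p. \<Sum>s\<le>p. ?S t s + ?S s t)"
    unfolding S sum.distrib using sum.swap[of ?S "{..p}" "{..p}"] by (simp add: scaleR_2)
  also have "\<dots> = (\<Sum>t\<le>p. \<Sum>s\<le>p. if s = t then 2 *\<^sub>R b s s else 0)"
  proof (intro sum.cong refl)
    fix t s assume st: "t \<in> {..p}" "s \<in> {..p}"
    hence eq: "b s t = b t s" using b by auto
    \<comment> \<open>The first alternative has the conjugate as the outer operator, the second as
      the inner one.\<close>
    have "(\<sigma> k t * \<sigma> l s = \<sigma> 1 t \<and> \<sigma> k s * \<sigma> l t = \<sigma> 1 s) \<or> (\<sigma> k t * \<sigma> l s = \<sigma> 1 s \<and> \<sigma> k s * \<sigma> l t = \<sigma> 1 t)"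
      using kl by (auto simp: \<sigma>_def)
    moreover have "\<sigma> 1 s *\<^sub>R mul (v t) (mul (v s) a) + \<sigma> 1 t *\<^sub>R mul (v s) (mul (v t) a) = (if s = t then 2 *\<^sub>R a else 0)" for a
      using st p_less_m by (auto simp: \<sigma>_def v_0 one_mul v_mul_v v_mul_anti[of t s] scaleR_2)
    ultimately show "?S t s + ?S s t = (if s = t then 2 *\<^sub>R b s s else 0)"
      using conj_pair[of s t "b t s"] st eq by auto
  qed
  also have "\<dots> = 2 *\<^sub>R (\<Sum>s\<le>p. b s s)" by (simp add: scaleR_sum_right)
  finally show ?thesis by simp
qed

section \<open>Derivatives, continuity and size of the power terms\<close>

lemma E_line_p: "s \<le> p \<Longrightarrow> E k (x + t *\<^sub>R v s) a = E k x a"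
  using p_less_m by (simp add: E_def r2_line_p xq_add xq_scale xq_v)

lemma E_line_q_deriv:
  assumes s: "s \<in> {p+1..m}"
  shows "((\<lambda>t. E k (x + t *\<^sub>R v s) a) has_vector_derivative dE s k (x + t *\<^sub>R v s) a) (at t)"
proof -
  have cs: "crd s (x + t *\<^sub>R v s) = crd s x + t" using s by (simp add: crd_add crd_scale crd_v)
  have r: "((\<lambda>t. (- r2 (x + t *\<^sub>R v s)) ^ n) has_real_derivative
        real n * (- r2 (x + t *\<^sub>R v s)) ^ (n - 1) * (- 2 * crd s (x + t *\<^sub>R v s))) (at t)" for n
    unfolding cs unfolding r2_line_q[OF s] by (auto intro!: derivative_eq_intros simp: algebra_simps)
  have q: "((\<lambda>t. mul (xq (x + t *\<^sub>R v s)) a) has_vector_derivative mul (v s) a) (at t)"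
    using s unfolding xq_add xq_scale mul.add_left mul.scaleR_left
    by (auto simp: xq_v intro!: derivative_eq_intros)
  show ?thesis
  proof (cases "even k")
    case True
    have "((\<lambda>t. (- r2 (x + t *\<^sub>R v s)) ^ (k div 2) *\<^sub>R a) has_vector_derivative
       (- r2 (x + t *\<^sub>R v s)) ^ (k div 2) *\<^sub>R 0 +
       (real (k div 2) * (- r2 (x + t *\<^sub>R v s)) ^ (k div 2 - 1) * (- 2 * crd s (x + t *\<^sub>R v s))) *\<^sub>R a) (at t)"
      by (rule has_vector_derivative_scaleR[OF r has_vector_derivative_const])
    thus ?thesis using True by (simp add: E_def dE_def)
  next
    case False
    have "((\<lambda>t. (- r2 (x + t *\<^sub>R v s)) ^ (k div 2) *\<^sub>R mul (xq (x + t *\<^sub>R v s)) a) has_vector_derivative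
       (- r2 (x + t *\<^sub>R v s)) ^ (k div 2) *\<^sub>R mul (v s) a +
       (real (k div 2) * (- r2 (x + t *\<^sub>R v s)) ^ (k div 2 - 1) * (- 2 * crd s (x + t *\<^sub>R v s))) *\<^sub>R mul (xq (x + t *\<^sub>R v s)) a) (at t)"
      by (rule has_vector_derivative_scaleR[OF r q])
    thus ?thesis using False by (simp add: E_def dE_def add.commute)
  qed
qed

lemma continuous_on_E:
  assumes "continuous_on X A"
  shows "continuous_on X (\<lambda>x. E k x (A x))"
  unfolding E_def by (cases "even k") (auto intro!: continuous_intros mul.continuous_on assms)

lemma continuous_on_dE:
  assumes "continuous_on X A"
  shows "continuous_on X (\<lambda>x. dE s k x (A x))"
  unfolding dE_def by (cases "even k") (auto intro!: continuous_intros mul.continuous_on assms)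

text \<open>The norm need not be multiplicative, but a power of x_q is a scalar times at most one
  factor x_q. Hence a single constant serves all k, and no factor N^k arises.\<close>

lemma E_bounds:
  obtains N where "0 < N" "\<And>k x a. norm (E k x a) \<le> N * sqrt (r2 x) ^ k * norm a"
    "\<And>s k x a. s \<in> {p+1..m} \<Longrightarrow> norm (dE s k x a) \<le> N * (real k * sqrt (r2 x) ^ (k - 1)) * norm a"
    "\<And>s a. s \<le> m \<Longrightarrow> norm (mul (v s) a) \<le> N * norm a"
proof -
  obtain K where K: "0 < K" "\<And>x y. norm (mul x y) \<le> norm x * norm y * K"
    using mul.pos_bounded by blast
  define B where "B = (\<Sum>s\<le>m. norm (v s))"
  have B: "0 \<le> B" by (auto simp: B_def intro: sum_nonneg)
  have vB: "norm (v s) \<le> B" if "s \<le> m" for s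
    unfolding B_def using that by (intro member_le_sum) auto
  have mv: "norm (mul (v s) a) \<le> B * K * norm a" if "s \<le> m" for s a
  proof -
    have "norm (v s) * norm a * K \<le> B * norm a * K"
      using vB[OF that] K(1) by (intro mult_right_mono) auto
    thus ?thesis using K(2)[of "v s" a] by (simp add: mult_ac)
  qed
  have mq: "norm (mul (xq x) a) \<le> B * K * sqrt (r2 x) * norm a" for x a
  proof -
    have "norm (xq x) \<le> (\<Sum>s\<in>{p+1..m}. norm (v s) * sqrt (r2 x))"
      unfolding xq_def embv_def
      by (rule sum_norm_le) (auto simp: mult.commute intro!: mult_left_mono crd_le_r2)
    also have "\<dots> \<le> B * sqrt (r2 x)"
      unfolding B_def sum_distrib_right[symmetric] using r2_nonneg by (intro mult_right_mono sum_mono2) auto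
    finally have "norm (xq x) * norm a * K \<le> B * sqrt (r2 x) * norm a * K"
      using K(1) by (intro mult_right_mono) auto
    thus ?thesis using K(2)[of "xq x" a] by (simp add: mult_ac)
  qed
  define N where "N = 1 + B * K"
  have N: "1 \<le> N" "B * K \<le> N" using B K by (auto simp: N_def)
  have pw: "(sqrt (r2 x))\<^sup>2 = r2 x" for x using r2_nonneg by simp
  have ev: "sqrt (r2 x) ^ (2 * l) = r2 x ^ l" for x l by (simp add: power_mult pw)
  have rn: "0 \<le> sqrt (r2 x)" for x using r2_nonneg by simp
  show ?thesis
  proof (rule that[of N])
    show "0 < N" using N by simp
    show "norm (mul (v s) a) \<le> N * norm a" if "s \<le> m" for s a
      using mv[OF that, of a] N(2) mult_right_mono[of "B * K" N "norm a"] by auto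
    fix k x a
    let ?r = "sqrt (r2 x)"
    note rn' = rn[of x] r2_nonneg[of x]
    show "norm (E k x a) \<le> N * ?r ^ k * norm a"
    proof (cases "even k")
      case True
      then obtain l where k: "k = 2 * l" by (auto elim: evenE)
      have "1 * (r2 x ^ l * norm a) \<le> N * (r2 x ^ l * norm a)"
        using N rn' by (intro mult_right_mono) auto
      thus ?thesis using rn' ev[of x l] by (simp add: E_def k power_abs mult_ac)
    next
      case False
      then obtain l where k: "k = 2 * l + 1" by (auto elim: oddE)
      have "r2 x ^ l * norm (mul (xq x) a) \<le> r2 x ^ l * (B * K * ?r * norm a)"
        using rn' mq[of x a] by (intro mult_left_mono) auto
      also have "\<dots> \<le> r2 x ^ l * (N * ?r * norm a)"
        using rn' N by (intro mult_left_mono mult_right_mono) auto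
      finally show ?thesis using rn' ev[of x l] by (simp add: E_def k power_abs mult_ac)
    qed
    fix s assume s: "s \<in> {p+1..m}"
    show "norm (dE s k x a) \<le> N * (real k * ?r ^ (k - 1)) * norm a"
    proof (cases "even k")
      case True
      then obtain l where k: "k = 2 * l" by (auto elim: evenE)
      show ?thesis
      proof (cases l)
        case (Suc j)
        have "norm (dE s k x a) = (2 * real l * r2 x ^ j * norm a) * \<bar>crd s x\<bar>"
          using rn' by (simp add: dE_def k Suc abs_mult power_abs mult_ac)
        also have "\<dots> \<le> (2 * real l * r2 x ^ j * norm a) * ?r"
          using crd_le_r2[OF s] rn' by (intro mult_left_mono) auto
        also have "\<dots> = 1 * (real k * ?r ^ (k - 1) * norm a)"
          using ev[of x j] by (simp add: k Suc mult_ac)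
        also have "\<dots> \<le> N * (real k * ?r ^ (k - 1) * norm a)"
          using N rn' by (intro mult_right_mono) auto
        finally show ?thesis by (simp add: mult_ac)
      qed (simp add: dE_def k)
    next
      case False
      then obtain l where k: "k = 2 * l + 1" by (auto elim: oddE)
      have 1: "norm ((real l * (- r2 x) ^ (l - 1) * (- 2 * crd s x)) *\<^sub>R mul (xq x) a) \<le> 2 * real l * r2 x ^ l * (N * norm a)"
      proof (cases l)
        case (Suc j)
        have "norm ((real l * (- r2 x) ^ (l - 1) * (- 2 * crd s x)) *\<^sub>R mul (xq x) a)
            = 2 * real l * r2 x ^ j * (\<bar>crd s x\<bar> * norm (mul (xq x) a))"
          using rn' by (simp add: Suc abs_mult power_abs mult_ac)
        also have "\<dots> \<le> 2 * real l * r2 x ^ j * (?r * (B * K * ?r * norm a))"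
          using crd_le_r2[OF s] mq[of x a] rn' by (intro mult_left_mono mult_mono) auto
        also have "\<dots> = 2 * real l * r2 x ^ l * (B * K * norm a)"
          using pw[of x] by (simp add: Suc power2_eq_square mult_ac)
        also have "\<dots> \<le> 2 * real l * r2 x ^ l * (N * norm a)"
          using rn' N by (intro mult_left_mono mult_right_mono) auto
        finally show ?thesis .
      qed simp
      have 2: "norm ((- r2 x) ^ l *\<^sub>R mul (v s) a) \<le> r2 x ^ l * (N * norm a)"
      proof -
        have "norm (mul (v s) a) \<le> N * norm a"
          using mv[of s a] s N(2) mult_right_mono[of "B * K" N "norm a"] by auto
        thus ?thesis using rn' by (simp add: power_abs mult_left_mono)
      qed
      have "norm (dE s k x a) \<le> 2 * real l * r2 x ^ l * (N * norm a) + r2 x ^ l * (N * norm a)"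
        using norm_triangle_mono[OF 1 2] by (simp add: dE_def k)
      also have "\<dots> = N * (real k * ?r ^ (k - 1)) * norm a"
        using ev[of x l] by (simp add: k algebra_simps)
      finally show ?thesis .
    qed
  qed
qed

section \<open>The coefficient recursion\<close>

text \<open>Summability is asked only for radii strictly below \<rho>, so a derivative has an
  expansion with the same \<rho> and the recursion can run forever without shrinking the
  box.\<close>

definition local_series :: "'a \<Rightarrow> real \<Rightarrow> ('a \<Rightarrow> 'a) \<Rightarrow> ((nat \<Rightarrow> nat) \<Rightarrow> 'a) \<Rightarrow> bool" where
  "local_series y \<rho> f a \<longleftrightarrow> (\<forall>\<rho>'. 0 < \<rho>' \<and> \<rho>' < \<rho> \<longrightarrow> wsummable p \<rho>' a) \<and>
     (\<forall>h. (\<forall>s\<le>p. \<bar>h s\<bar> < \<rho>) \<longrightarrow> f (y + embv v {..p} h) = mseries p a h)"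

lemma local_seriesD:
  assumes "local_series y \<rho> f a" "\<And>s. s \<le> p \<Longrightarrow> \<bar>h s\<bar> < \<rho>"
  shows "f (y + embv v {..p} h) = mseries p a h"
  by (rule assms(1)[unfolded local_series_def, THEN conjunct2, rule_format]) (rule assms(2))

lemma embv_upd:
  assumes "s \<le> p"
  shows "embv v {..p} (h(s := h s + t)) = embv v {..p} h + t *\<^sub>R v s"
proof -
  have "embv v {..p} (h(s := h s + t)) = (\<Sum>i\<le>p. h i *\<^sub>R v i + (if i = s then t *\<^sub>R v s else 0))"
    unfolding embv_def by (rule sum.cong) (auto simp: scaleR_add_left)
  thus ?thesis using assms by (simp add: sum.distrib embv_def)
qed

lemma local_series_has_vector_derivative:
  assumes f: "local_series y \<rho> f a" and s: "s \<le> p" and h: "\<And>i. i \<le> p \<Longrightarrow> \<bar>h i\<bar> < \<rho>"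
  shows "((\<lambda>t. f (y + embv v {..p} h + t *\<^sub>R v s)) has_vector_derivative mseries p (mshift s a) h) (at 0)"
proof -
  obtain \<rho>' where \<rho>': "\<And>i. i \<le> p \<Longrightarrow> \<bar>h i\<bar> < \<rho>'" "0 < \<rho>'" "\<rho>' < \<rho>"
    using radius_between[of p h \<rho>] h by blast
  have "((\<lambda>t. mseries p a (h(s := t))) has_vector_derivative mseries p (mshift s a) h) (at (h s))"
    using f \<rho>' s by (intro mseries_has_vector_derivative[where \<rho> = \<rho>']) (auto simp: local_series_def)
  hence D: "((\<lambda>t. mseries p a (h(s := t))) has_vector_derivative mseries p (mshift s a) h) (at (h s + 0))" by simp
  have "((\<lambda>t. h s + t) has_vector_derivative 1) (at 0)" by (auto intro!: derivative_eq_intros)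
  from vector_diff_chain_at[OF this D]
  have "((\<lambda>t. mseries p a (h(s := h s + t))) has_vector_derivative 1 *\<^sub>R mseries p (mshift s a) h) (at 0)"
    by (simp only: o_def)
  hence D': "((\<lambda>t. mseries p a (h(s := h s + t))) has_vector_derivative mseries p (mshift s a) h) (at 0)" by simp
  show ?thesis
  proof (rule has_vector_derivative_transform_within_open[OF D'])
    show "open {- (\<rho> - \<bar>h s\<bar>)<..<\<rho> - \<bar>h s\<bar>}" by simp
    show "0 \<in> {- (\<rho> - \<bar>h s\<bar>)<..<\<rho> - \<bar>h s\<bar>}" using h[OF s] by simp
    fix t assume "t \<in> {- (\<rho> - \<bar>h s\<bar>)<..<\<rho> - \<bar>h s\<bar>}"
    hence "\<bar>h s + t\<bar> < \<rho>" by (auto simp: abs_if split: if_splits)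
    hence "f (y + embv v {..p} (h(s := h s + t))) = mseries p a (h(s := h s + t))"
      using f h by (auto simp: local_series_def)
    thus "mseries p a (h(s := h s + t)) = f (y + embv v {..p} h + t *\<^sub>R v s)"
      unfolding embv_upd[OF s] by (simp add: add.assoc)
  qed
qed

lemma local_series_pderiv:
  assumes f: "local_series y \<rho> f a" and s: "s \<le> p"
  shows "local_series y \<rho> (pderiv_v v s f) (mshift s a)"
  unfolding local_series_def
proof (intro conjI allI impI)
  fix \<rho>' assume "0 < \<rho>' \<and> \<rho>' < \<rho>"
  moreover from this have "wsummable p ((\<rho>' + \<rho>) / 2) a" using f by (auto simp: local_series_def)
  ultimately show "wsummable p \<rho>' (mshift s a)" using s by (intro wnorm_mshift(1)) auto
next
  fix h assume "\<forall>s\<le>p. \<bar>h s\<bar> < \<rho>"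
  thus "pderiv_v v s f (y + embv v {..p} h) = mseries p (mshift s a) h"
    unfolding pderiv_v_def by (intro vector_derivative_at local_series_has_vector_derivative[OF f s]) auto
qed

lemma local_series_linear_sum:
  assumes b: "\<And>s. s \<in> S \<Longrightarrow> local_series y \<rho> (g s) (b s)"
    and L: "\<And>s. s \<in> S \<Longrightarrow> bounded_linear (L s)" and S: "finite S"
  shows "local_series y \<rho> (\<lambda>x. \<Sum>s\<in>S. L s (g s x)) (\<lambda>\<alpha>. \<Sum>s\<in>S. L s (b s \<alpha>))"
proof -
  have "\<forall>s\<in>S. \<exists>K. \<forall>x. norm (L s x) \<le> norm x * K" using L bounded_linear.bounded by blast
  then obtain K where K: "\<And>s x. s \<in> S \<Longrightarrow> norm (L s x) \<le> norm x * K s" by metis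
  define N where "N = (\<Sum>s\<in>S. \<bar>K s\<bar>)"
  have N: "norm (L s x) \<le> N * norm x" if "s \<in> S" for s x
  proof -
    have "\<bar>K s\<bar> \<le> N" unfolding N_def using that S by (intro member_le_sum) auto
    hence "norm x * K s \<le> norm x * N" by (intro mult_left_mono) auto
    thus ?thesis using K[OF that, of x] by (simp add: mult.commute)
  qed
  show ?thesis unfolding local_series_def
  proof (intro conjI allI impI)
    fix \<rho>' assume "0 < \<rho>' \<and> \<rho>' < \<rho>"
    thus "wsummable p \<rho>' (\<lambda>\<alpha>. \<Sum>s\<in>S. L s (b s \<alpha>))"
      using b by (intro wnorm_linear_sum(1)[where L = L and b = b and N = N] N S) (auto simp: local_series_def)
  next
    fix h assume h: "\<forall>s\<le>p. \<bar>h s\<bar> < \<rho>"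
    obtain \<rho>' where \<rho>': "\<And>i. i \<le> p \<Longrightarrow> \<bar>h i\<bar> < \<rho>'" "0 < \<rho>'" "\<rho>' < \<rho>"
      using radius_between[of p h \<rho>] h by blast
    have "mseries p (\<lambda>\<alpha>. \<Sum>s\<in>S. L s (b s \<alpha>)) h = (\<Sum>s\<in>S. L s (mseries p (b s) h))"
      by (rule mseries_linear_sum[where \<rho> = \<rho>', OF _ _ L S])
         (use \<rho>' b in \<open>auto simp: local_series_def intro: less_imp_le\<close>)
    thus "(\<Sum>s\<in>S. L s (g s (y + embv v {..p} h))) = mseries p (\<lambda>\<alpha>. \<Sum>s\<in>S. L s (b s \<alpha>)) h"
      using b h by (auto simp: local_series_def intro!: sum.cong arg_cong[of _ _ "L _"])
  qed
qed

lemma dirac_bounded_linear: "bounded_linear (\<lambda>x. c *\<^sub>R mul (v s) x)"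
  by (intro bounded_linear_scaleR_right[THEN bounded_linear_compose] mul.bounded_linear_right)

lemma local_series_dirac:
  assumes "\<And>s. s \<le> p \<Longrightarrow> local_series y \<rho> (g s) (b s)"
  shows "local_series y \<rho> (\<lambda>x. c *\<^sub>R dirac k (\<lambda>s. g s x)) (\<lambda>\<alpha>. c *\<^sub>R dirac k (\<lambda>s. b s \<alpha>))"
  unfolding dirac_def scaleR_sum_right scaleR_scaleR
  using assms by (intro local_series_linear_sum dirac_bounded_linear) auto

definition lap_coeff :: "((nat \<Rightarrow> nat) \<Rightarrow> 'a) \<Rightarrow> (nat \<Rightarrow> nat) \<Rightarrow> 'a" where
  "lap_coeff a \<alpha> = (\<Sum>s\<le>p. mshift s (mshift s a) \<alpha>)"

lemma local_series_lap:
  assumes "local_series y \<rho> f a"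
  shows "local_series y \<rho> ((lap_p v p ^^ l) f) ((lap_coeff ^^ l) a)"
proof (induction l)
  case (Suc l)
  have "local_series y \<rho> (\<lambda>x. \<Sum>s\<in>{..p}. id (pderiv_v v s (pderiv_v v s ((lap_p v p ^^ l) f)) x))
     (\<lambda>\<alpha>. \<Sum>s\<in>{..p}. id (mshift s (mshift s ((lap_coeff ^^ l) a)) \<alpha>))"
    by (rule local_series_linear_sum) (auto intro!: local_series_pderiv Suc simp: id_def bounded_linear_ident)
  moreover have "lap_coeff ((lap_coeff ^^ l) a) = (\<lambda>\<alpha>. \<Sum>s\<le>p. mshift s (mshift s ((lap_coeff ^^ l) a)) \<alpha>)"
    by (rule ext) (rule lap_coeff_def)
  ultimately show ?case by (simp only: funpow.simps o_apply lap_p_def[of v p "(lap_p v p ^^ l) f"] id_apply)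
qed (use assms in simp)

primrec ck_coeff :: "((nat \<Rightarrow> nat) \<Rightarrow> 'a) \<Rightarrow> nat \<Rightarrow> (nat \<Rightarrow> nat) \<Rightarrow> 'a" where
  "ck_coeff a 0 = a"
| "ck_coeff a (Suc k) = (\<lambda>\<alpha>. (1 / \<gamma> k) *\<^sub>R dirac k (\<lambda>s. mshift s (ck_coeff a k) \<alpha>))"

text \<open>The recursion on functions refers to no centre of expansion, so the local expansions
  given by \<open>ck_coeff\<close> belong to one global sequence.\<close>

primrec ck_fun :: "('a \<Rightarrow> 'a) \<Rightarrow> nat \<Rightarrow> 'a \<Rightarrow> 'a" where
  "ck_fun A0 0 = A0"
| "ck_fun A0 (Suc k) = (\<lambda>x. (1 / \<gamma> k) *\<^sub>R dirac k (\<lambda>s. pderiv_v v s (ck_fun A0 k) x))"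

lemma local_series_ck_fun:
  assumes "local_series y \<rho> A0 a"
  shows "local_series y \<rho> (ck_fun A0 k) (ck_coeff a k)"
proof (induction k)
  case (Suc k)
  thus ?case unfolding ck_fun.simps ck_coeff.simps
    by (intro local_series_dirac local_series_pderiv)
qed (use assms in simp)

section \<open>Two steps of the recursion, and its growth\<close>

lemma dirac_mshift:
  "mshift t (\<lambda>\<beta>. c *\<^sub>R dirac k (\<lambda>s. b s \<beta>)) \<alpha> = c *\<^sub>R dirac k (\<lambda>s. mshift t (b s) \<alpha>)"
  by (simp add: mshift_def dirac_def mul.scaleR_right scaleR_sum_right mult_ac)

lemma dirac_scale: "dirac k (\<lambda>s. c *\<^sub>R b s) = c *\<^sub>R dirac k b"
  by (simp add: dirac_def mul.scaleR_right scaleR_sum_right mult_ac)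

lemma ck_coeff_Suc_Suc:
  "ck_coeff a (Suc (Suc k)) = (\<lambda>\<alpha>. (1 / (\<gamma> k * \<gamma> (Suc k))) *\<^sub>R lap_coeff (ck_coeff a k) \<alpha>)"
proof
  fix \<alpha>
  have "dirac (Suc k) (\<lambda>t. dirac k (\<lambda>s. mshift t (mshift s (ck_coeff a k)) \<alpha>)) = lap_coeff (ck_coeff a k) \<alpha>"
    unfolding lap_coeff_def by (rule dirac_laplace) (auto simp: mshift_commute)
  thus "ck_coeff a (Suc (Suc k)) \<alpha> = (1 / (\<gamma> k * \<gamma> (Suc k))) *\<^sub>R lap_coeff (ck_coeff a k) \<alpha>"
    by (simp add: dirac_mshift dirac_scale)
qed

lemma lap_coeff_scale: "lap_coeff (\<lambda>\<alpha>. c *\<^sub>R a \<alpha>) = (\<lambda>\<alpha>. c *\<^sub>R lap_coeff a \<alpha>)"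
  by (simp add: lap_coeff_def[abs_def] mshift_def scaleR_sum_right mult_ac)

text \<open>The cases i = 0 and i = 1 are the even and the odd branch, issuing from A_0 and from
  A_1.\<close>

lemma ck_coeff_lap:
  "ck_coeff a (2 * l + i) = (\<lambda>\<alpha>. (\<Prod>j<l. 1 / (\<gamma> (2 * j + i) * \<gamma> (2 * j + i + 1))) *\<^sub>R (lap_coeff ^^ l) (ck_coeff a i) \<alpha>)"
proof (induction l)
  case (Suc l)
  have "ck_coeff a (2 * Suc l + i) = ck_coeff a (Suc (Suc (2 * l + i)))" by simp
  thus ?case unfolding ck_coeff_Suc_Suc Suc lap_coeff_scale by (simp add: mult_ac)
qed simp

text \<open>Induction on k over all smaller radii at once: each step applies one derivative between
  an intermediate radius and \<rho>', and the factor 1 / \<gamma> k keeps the growth geometric with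
  a rate \<open>K\<close> that depends neither on k nor on the function.\<close>

lemma ck_coeff_bound:
  obtains K where "0 < K"
    "\<And>a \<rho> \<rho>' k. wsummable p \<rho> a \<Longrightarrow> 0 < \<rho>' \<Longrightarrow> \<rho>' < \<rho> \<Longrightarrow>
       wsummable p \<rho>' (ck_coeff a k) \<and> wnorm p \<rho>' (ck_coeff a k) \<le> wnorm p \<rho> a * (K / (\<rho> - \<rho>')) ^ k"
proof -
  obtain N where N: "0 < N" "\<And>s a. s \<le> m \<Longrightarrow> norm (mul (v s) a) \<le> N * norm a"
    using E_bounds by metis
  \<comment> \<open>Per step, N bounds the left multiplications, \<open>Suc p\<close> counts the
    derivatives in \<open>dirac\<close>, and exp 1 covers the splitting of the radius.\<close>
  define K where "K = exp 1 * (N * real (Suc p))"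
  have K: "0 < K" using N by (simp add: K_def)
  have main: "wsummable p \<rho>' (ck_coeff a k) \<and> wnorm p \<rho>' (ck_coeff a k) \<le> wnorm p \<rho> a * (K / (\<rho> - \<rho>')) ^ k"
    if a: "wsummable p \<rho> a" and "0 < \<rho>'" "\<rho>' < \<rho>" for a \<rho> \<rho>' k
    using that(2,3)
  proof (induction k arbitrary: \<rho>')
    case 0
    thus ?case using a wsummable_mono[of p \<rho> a \<rho>'] wnorm_mono[of p \<rho> a \<rho>'] by simp
  next
    case (Suc k)
    \<comment> \<open>Giving up the fraction \<open>1 / (n + 1)\<close> of the remaining radius costs the factor
      \<open>(1 + 1 / n) ^ n \<le> exp 1\<close> only.\<close>
    define n where "n = real (Suc k)"
    define d where "d = \<rho> - \<rho>'"
    define \<rho>'' where "\<rho>'' = \<rho>' + d / (n + 1)"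
    have n: "1 \<le> n" and d: "0 < d" using Suc.prems by (auto simp: n_def d_def)
    have r: "0 < \<rho>'" "\<rho>' < \<rho>''" "\<rho>'' < \<rho>" "\<rho>'' - \<rho>' = d / (n + 1)" "\<rho> - \<rho>'' = d * n / (n + 1)"
    proof -
      have "d / (n + 1) < d" using n d by (simp add: divide_less_eq)
      thus "\<rho>'' < \<rho>" by (simp add: \<rho>''_def d_def)
      show "\<rho> - \<rho>'' = d * n / (n + 1)" using n by (simp add: \<rho>''_def d_def field_simps)
    qed (use Suc.prems n d in \<open>auto simp: \<rho>''_def\<close>)
    let ?W = "wnorm p \<rho> a" and ?a = "ck_coeff a k"
    have IH: "wsummable p \<rho>'' ?a" "wnorm p \<rho>'' ?a \<le> ?W * (K / (\<rho> - \<rho>'')) ^ k"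
      using Suc.IH[of \<rho>''] r by auto
    have sh: "wsummable p \<rho>' (mshift s ?a)" "wnorm p \<rho>' (mshift s ?a) \<le> wnorm p \<rho>'' ?a / (\<rho>'' - \<rho>')"
      if "s \<le> p" for s
      using wnorm_mshift[OF IH(1), of \<rho>' s] r that by auto
    have L: "norm ((1 / \<gamma> k * \<sigma> k s) *\<^sub>R mul (v s) x) \<le> N / n * norm x" if "s \<in> {..p}" for s x
    proof -
      have "norm ((1 / \<gamma> k * \<sigma> k s) *\<^sub>R mul (v s) x) = norm (mul (v s) x) / \<gamma> k"
        using \<gamma>_ge[of k] by (auto simp: \<sigma>_def)
      also have "\<dots> \<le> N * norm x / n"
        using N(2)[of s x] that p_less_m \<gamma>_ge[of k] n N(1) by (intro frac_le) (auto simp: n_def)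
      finally show ?thesis by simp
    qed
    have eq: "ck_coeff a (Suc k) = (\<lambda>\<alpha>. \<Sum>s\<le>p. (1 / \<gamma> k * \<sigma> k s) *\<^sub>R mul (v s) (mshift s ?a \<alpha>))"
      by (simp add: dirac_def scaleR_sum_right)
    have 1: "wsummable p \<rho>' (ck_coeff a (Suc k))" unfolding eq
      by (rule wnorm_linear_sum(1)[OF sh(1) _ L]) (use r in auto)
    have "wnorm p \<rho>' (ck_coeff a (Suc k)) \<le> N / n * (\<Sum>s\<le>p. wnorm p \<rho>' (mshift s ?a))" unfolding eq
      by (rule wnorm_linear_sum(2)[OF sh(1) _ L]) (use r in auto)
    also have "\<dots> \<le> N / n * (\<Sum>s\<le>p. ?W * (K / (\<rho> - \<rho>'')) ^ k / (\<rho>'' - \<rho>'))"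
    proof (intro mult_left_mono sum_mono)
      fix s assume "s \<in> {..p}"
      hence "wnorm p \<rho>' (mshift s ?a) \<le> wnorm p \<rho>'' ?a / (\<rho>'' - \<rho>')" using sh by auto
      also have "\<dots> \<le> ?W * (K / (\<rho> - \<rho>'')) ^ k / (\<rho>'' - \<rho>')" using r IH(2) by (intro divide_right_mono) auto
      finally show "wnorm p \<rho>' (mshift s ?a) \<le> ?W * (K / (\<rho> - \<rho>'')) ^ k / (\<rho>'' - \<rho>')" .
    qed (use N n in auto)
    \<comment> \<open>The last derivative costs (n + 1) / d. Combined with the 1 / n coming from
      \<gamma>, it supplies one more factor (n + 1) / n next to the k factors from the induction
      hypothesis.\<close>
    also have "\<dots> = ?W * (K / d) ^ k * (N * real (Suc p) / d) * ((n + 1) / n) ^ Suc k"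
    proof -
      have e: "K / (\<rho> - \<rho>'') = K / d * ((n + 1) / n)" using n d by (simp add: r)
      have "N / n * (P * (W * (Q * R) / (d / (n + 1)))) = W * Q * (N * P / d) * ((n + 1) / n * R)" for P Q R W :: real
        using n d by (simp add: field_simps)
      thus ?thesis unfolding e r(4) power_mult_distrib by (simp only: sum_constant card_atMost power_Suc)
    qed
    also have "\<dots> \<le> ?W * (K / d) ^ k * (N * real (Suc p) / d) * exp 1"
    proof (rule mult_left_mono)
      have "((n + 1) / n) ^ Suc k \<le> exp (1 / n) ^ Suc k"
      proof (rule power_mono)
        have "(n + 1) / n = 1 + 1 / n" using n by (simp add: field_simps)
        thus "(n + 1) / n \<le> exp (1 / n)" using exp_ge_add_one_self[of "1 / n"] by simp
      qed (use n in auto)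
      also have "\<dots> = exp 1" using n by (simp add: exp_of_nat_mult[symmetric] n_def del: power_Suc of_nat_Suc)
      finally show "((n + 1) / n) ^ Suc k \<le> exp 1" .
      show "0 \<le> ?W * (K / d) ^ k * (N * real (Suc p) / d)"
        using K d N wnorm_nonneg[of \<rho> p a] r by (intro mult_nonneg_nonneg zero_le_power) auto
    qed
    also have "\<dots> = ?W * (K / (\<rho> - \<rho>')) ^ Suc k" by (simp add: K_def d_def)
    finally show ?case using 1 by blast
  qed
  show ?thesis by (rule that[OF K main])
qed

text \<open>Convergence at one corner of a small box is unconditional, hence absolute, and so
  dominates the series on the entire box.\<close>

lemma real_analytic_local_series:
  assumes dom: "domain_in (span (v ` {..p})) \<Omega>0" and an: "real_analytic_on_v v p f \<Omega>0" and y: "y \<in> \<Omega>0"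
  obtains \<rho> a where "0 < \<rho>" "wsummable p \<rho> a" "local_series y \<rho> f a"
    "\<And>h. (\<And>s. s \<le> p \<Longrightarrow> \<bar>h s\<bar> \<le> \<rho>) \<Longrightarrow> y + embv v {..p} h \<in> \<Omega>0"
proof -
  obtain \<epsilon> coef where \<epsilon>: "\<epsilon> > 0" and C: "\<forall>h. (\<Sum>s\<le>p. (h s)\<^sup>2) < \<epsilon>\<^sup>2 \<and> y + embv v {..p} h \<in> \<Omega>0 \<longrightarrow>
      ((\<lambda>\<alpha>. (\<Prod>s\<le>p. h s ^ \<alpha> s) *\<^sub>R coef \<alpha>) has_sum f (y + embv v {..p} h)) {\<alpha>. \<forall>s>p. \<alpha> s = 0}"
    using bspec[OF an[unfolded real_analytic_on_v_def] y] by (elim exE conjE)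
  have coef: "((\<lambda>\<alpha>. mpow p h \<alpha> *\<^sub>R coef \<alpha>) has_sum f (y + embv v {..p} h)) (multi_indices p)"
    if "(\<Sum>s\<le>p. (h s)\<^sup>2) < \<epsilon>\<^sup>2" "y + embv v {..p} h \<in> \<Omega>0" for h
    unfolding mpow_def multi_indices_def using that by (intro C[rule_format]) simp
  have op: "openin (top_of_set (span (v ` {..p}))) \<Omega>0" using dom by (simp add: domain_in_def)
  then obtain e where e: "e > 0" "\<And>x. x \<in> span (v ` {..p}) \<Longrightarrow> dist x y < e \<Longrightarrow> x \<in> \<Omega>0"
    using y by (auto simp: openin_euclidean_subtopology_iff)
  have ysp: "y \<in> span (v ` {..p})" using op y openin_subset by force
  define B where "B = (\<Sum>s\<le>p. norm (v s)) + 1"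
  have B: "B > 0" unfolding B_def using sum_nonneg[of "{..p}" "\<lambda>s. norm (v s)"] by simp
  \<comment> \<open>The first bound keeps the closed box inside \<open>\<Omega>0\<close>, the second
    inside the ball where the given expansion holds.\<close>
  define \<rho> where "\<rho> = min (e / (2 * B)) (\<epsilon> / (2 * real (Suc p)))"
  have \<rho>: "0 < \<rho>" using e \<epsilon> B by (simp add: \<rho>_def)
  have in0: "y + embv v {..p} h \<in> \<Omega>0" if h: "\<And>s. s \<le> p \<Longrightarrow> \<bar>h s\<bar> \<le> \<rho>" for h
  proof (rule e(2))
    show "y + embv v {..p} h \<in> span (v ` {..p})" using ysp embv_in_span by (intro span_add) auto
    have "norm (embv v {..p} h) \<le> (\<Sum>s\<le>p. \<rho> * norm (v s))"
      unfolding embv_def by (rule sum_norm_le) (auto intro!: mult_right_mono h)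
    also have "\<dots> < \<rho> * B" using \<rho> by (simp add: B_def sum_distrib_left distrib_left)
    also have "\<dots> \<le> e / (2 * B) * B" using B by (intro mult_right_mono) (auto simp: \<rho>_def)
    also have "\<dots> < e" using B e by simp
    finally show "dist (y + embv v {..p} h) y < e" by (simp add: dist_norm)
  qed
  have small: "(\<Sum>s\<le>p. (h s)\<^sup>2) < \<epsilon>\<^sup>2" if h: "\<And>s. s \<le> p \<Longrightarrow> \<bar>h s\<bar> \<le> \<rho>" for h :: "nat \<Rightarrow> real"
  proof -
    have r2: "\<rho> \<le> \<epsilon> / (2 * real (Suc p))" by (simp add: \<rho>_def)
    have "(\<Sum>s\<le>p. (h s)\<^sup>2) \<le> (\<Sum>s\<le>p. \<rho>\<^sup>2)"
      using h \<rho> by (intro sum_mono) (auto simp: abs_le_square_iff[symmetric])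
    also have "\<dots> = real (Suc p) * \<rho>\<^sup>2" by simp
    also have "\<dots> \<le> (real (Suc p))\<^sup>2 * \<rho>\<^sup>2" by (intro mult_right_mono) (auto simp: power2_eq_square)
    also have "\<dots> = (real (Suc p) * \<rho>)\<^sup>2" by (simp add: power_mult_distrib)
    also have "\<dots> \<le> (\<epsilon> / 2)\<^sup>2"
      using r2 \<rho> by (intro power_mono) (auto simp: field_simps)
    also have "\<dots> < \<epsilon>\<^sup>2" using \<epsilon> by (intro power_strict_mono) auto
    finally show ?thesis .
  qed
  \<comment> \<open>At the corner the monomial equals \<rho> to the total degree, so the absolute
    summability here is exactly \<open>wsummable\<close>.\<close>
  have "((\<lambda>\<alpha>. mpow p (\<lambda>_. \<rho>) \<alpha> *\<^sub>R coef \<alpha>) has_sum f (y + embv v {..p} (\<lambda>_. \<rho>))) (multi_indices p)"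
    by (intro coef small in0) (use \<rho> in auto)
  from summable_on_norm_euclidean[OF has_sum_imp_summable[OF this]]
  have ws: "wsummable p \<rho> coef"
    unfolding wsummable_def using \<rho>
    by (simp add: mpow_def mdeg_def power_sum[symmetric] mult.commute)
  have "local_series y \<rho> f coef"
    unfolding local_series_def
  proof (intro conjI allI impI)
    show "wsummable p \<rho>' coef" if "0 < \<rho>' \<and> \<rho>' < \<rho>" for \<rho>' using wsummable_mono[OF ws, of \<rho>'] that by auto
    fix h assume "\<forall>s\<le>p. \<bar>h s\<bar> < \<rho>"
    hence h: "\<And>s. s \<le> p \<Longrightarrow> \<bar>h s\<bar> \<le> \<rho>" by auto
    show "f (y + embv v {..p} h) = mseries p coef h"
    proof -
      have "(\<Sum>s\<le>p. (h s)\<^sup>2) < \<epsilon>\<^sup>2" by (rule small) (rule h)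
      moreover have "y + embv v {..p} h \<in> \<Omega>0" by (rule in0) (rule h)
      ultimately show ?thesis unfolding mseries_def by (rule infsumI[OF coef, symmetric])
    qed
  qed
  from that[OF \<rho> ws this in0] show ?thesis .
qed

lemma local_series_imp_real_analytic:
  assumes "\<And>y. y \<in> \<Omega>0 \<Longrightarrow> \<exists>\<rho>>0. \<exists>a. local_series y \<rho> f a"
  shows "real_analytic_on_v v p f \<Omega>0"
  unfolding real_analytic_on_v_def
proof
  fix y assume "y \<in> \<Omega>0"
  from assms[OF this] obtain \<rho> a where \<rho>: "\<rho> > 0" and f: "local_series y \<rho> f a" by (elim exE conjE)
  have "((\<lambda>\<alpha>. mpow p h \<alpha> *\<^sub>R a \<alpha>) has_sum f (y + embv v {..p} h)) (multi_indices p)"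
    if sm: "(\<Sum>s\<le>p. (h s)\<^sup>2) < \<rho>\<^sup>2" for h :: "nat \<Rightarrow> real"
  proof -
    have h: "\<bar>h s\<bar> < \<rho>" if "s \<le> p" for s
    proof -
      have "(h s)\<^sup>2 \<le> (\<Sum>s\<le>p. (h s)\<^sup>2)" using that by (intro member_le_sum[of s "{..p}" "\<lambda>s. (h s)\<^sup>2"]) auto
      with sm have "(h s)\<^sup>2 < \<rho>\<^sup>2" by simp
      hence "\<bar>h s\<bar>\<^sup>2 < \<rho>\<^sup>2" by simp
      thus ?thesis by (rule power2_less_imp_less) (use \<rho> in simp)
    qed
    obtain \<rho>' where \<rho>': "\<And>i. i \<le> p \<Longrightarrow> \<bar>h i\<bar> < \<rho>'" "0 < \<rho>'" "\<rho>' < \<rho>"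
      using radius_between[of p h \<rho>] h by blast
    have "((\<lambda>\<alpha>. mpow p h \<alpha> *\<^sub>R a \<alpha>) has_sum mseries p a h) (multi_indices p)"
      by (rule mseries_has_sum[where \<rho> = \<rho>']) (use f \<rho>' less_imp_le[OF \<rho>'(1)] in \<open>auto simp: local_series_def\<close>)
    moreover have "f (y + embv v {..p} h) = mseries p a h"
      by (rule local_seriesD[OF f]) (rule h)
    ultimately show ?thesis by (simp only:)
  qed
  hence "\<forall>h. (\<Sum>s\<le>p. (h s)\<^sup>2) < \<rho>\<^sup>2 \<and> y + embv v {..p} h \<in> \<Omega>0 \<longrightarrow>
      ((\<lambda>\<alpha>. (\<Prod>s\<le>p. h s ^ \<alpha> s) *\<^sub>R a \<alpha>) has_sum f (y + embv v {..p} h)) {\<alpha>. \<forall>s>p. \<alpha> s = 0}"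
    unfolding mpow_def multi_indices_def by (intro allI impI) (elim conjE)
  with \<rho> show "\<exists>\<epsilon>>0. \<exists>coef. \<forall>h. (\<Sum>s\<le>p. (h s)\<^sup>2) < \<epsilon>\<^sup>2 \<and> y + embv v {..p} h \<in> \<Omega>0 \<longrightarrow>
      ((\<lambda>\<alpha>. (\<Prod>s\<le>p. h s ^ \<alpha> s) *\<^sub>R coef \<alpha>) has_sum f (y + embv v {..p} h)) {\<alpha>. \<forall>s>p. \<alpha> s = 0}"
    by (intro exI[of _ \<rho>] conjI exI[of _ a])
qed

lemma local_series_continuous:
  assumes f: "local_series y \<rho> f a" and \<rho>': "0 < \<rho>'" "\<rho>' < \<rho>"
    and X: "X \<subseteq> {x \<in> span (v ` {..p}). \<forall>s\<le>p. \<bar>crd s (x - y)\<bar> \<le> \<rho>'}" and y: "y \<in> span (v ` {..p})"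
  shows "continuous_on X f"
proof -
  have "continuous_on X (\<lambda>x. mseries p a (\<lambda>s. crd s (x - y)))"
    by (rule continuous_on_mseries[where \<rho> = \<rho>']) (use f \<rho>' X in \<open>auto simp: local_series_def intro!: continuous_intros\<close>)
  moreover have "mseries p a (\<lambda>s. crd s (x - y)) = f x" if "x \<in> X" for x
  proof -
    have "x - y \<in> span (v ` {..p})" using X y that by (auto intro: span_diff)
    hence "y + embv v {..p} (\<lambda>s. crd s (x - y)) = x"
      using span_embv[of "x - y" "{..p}"] p_less_m by (simp add: algebra_simps)
    moreover have "\<forall>s\<le>p. \<bar>crd s (x - y)\<bar> < \<rho>" using X that \<rho>' by fastforce
    ultimately show ?thesis using f unfolding local_series_def by metis
  qed
  ultimately show ?thesis by (simp cong: continuous_on_cong)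
qed

section \<open>Existence\<close>

text \<open>A box in the first p + 1 coordinates times a round ball in the others: the ball gives
  p-symmetry, convexity gives connected slices, and the box fits the power series.\<close>

definition piece :: "'a \<Rightarrow> real \<Rightarrow> 'a set" where
  "piece y \<delta> = {x \<in> M. (\<forall>s\<le>p. \<bar>crd s (x - y)\<bar> < \<delta>) \<and> r2 x < \<delta>\<^sup>2}"

lemma piece_open: obtains U where "open U" "piece y \<delta> = M \<inter> U"
proof
  have "{x. (\<forall>s\<le>p. \<bar>crd s (x - y)\<bar> < \<delta>) \<and> r2 x < \<delta>\<^sup>2}
      = (\<Inter>s\<in>{..p}. {x. \<bar>crd s (x - y)\<bar> < \<delta>}) \<inter> {x. r2 x < \<delta>\<^sup>2}" by auto
  moreover have "open \<dots>"
    by (intro open_Int open_INT open_Collect_less continuous_intros ballI) auto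
  ultimately show "open {x. (\<forall>s\<le>p. \<bar>crd s (x - y)\<bar> < \<delta>) \<and> r2 x < \<delta>\<^sup>2}" by simp
qed (auto simp: piece_def)

lemma r2_eq_setL2: "r2 x = (L2_set (\<lambda>s. crd s x) {p+1..m})\<^sup>2"
  unfolding L2_set_def r2_def by (rule real_sqrt_pow2[symmetric]) (auto intro: sum_nonneg)

lemma convex_piece:
  assumes "0 < \<delta>"
  shows "convex (piece y \<delta>)"
proof (rule convexI)
  fix a b and u w :: real
  assume ab: "a \<in> piece y \<delta>" "b \<in> piece y \<delta>" and u: "0 \<le> u" "0 \<le> w" "u + w = 1"
  have cc: "u * c + w * d < \<delta>" if "c < \<delta>" "d < \<delta>" for c d
    using convex_bound_lt[OF that u] .
  let ?x = "u *\<^sub>R a + w *\<^sub>R b"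
  have "\<bar>crd s (?x - y)\<bar> < \<delta>" if "s \<le> p" for s
  proof -
    have "?x - y = u *\<^sub>R (a - y) + w *\<^sub>R (b - y)"
      using u by (simp add: algebra_simps scaleR_add_left[symmetric])
    hence "\<bar>crd s (?x - y)\<bar> \<le> u * \<bar>crd s (a - y)\<bar> + w * \<bar>crd s (b - y)\<bar>"
      using u by (simp add: crd_add crd_scale abs_mult order_trans[OF abs_triangle_ineq])
    also have "\<dots> < \<delta>" using ab that by (intro cc) (auto simp: piece_def)
    finally show ?thesis .
  qed
  moreover have "r2 ?x < \<delta>\<^sup>2"
  proof -
    let ?l = "\<lambda>x. L2_set (\<lambda>s. crd s x) {p+1..m}"
    have lt: "?l x < \<delta>" if "x \<in> piece y \<delta>" for x
      using that assms by (auto simp: piece_def r2_eq_setL2 intro: power2_less_imp_less)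
    have "?l ?x \<le> L2_set (\<lambda>s. u * crd s a) {p+1..m} + L2_set (\<lambda>s. w * crd s b) {p+1..m}"
      unfolding crd_add crd_scale real_scaleR_def by (rule L2_set_triangle_ineq)
    also have "\<dots> = u * ?l a + w * ?l b" using u by (simp add: L2_set_right_distrib)
    also have "\<dots> < \<delta>" by (intro cc lt ab)
    finally show ?thesis unfolding r2_eq_setL2 by (intro power_strict_mono) auto
  qed
  moreover have "?x \<in> M" using ab by (auto simp: piece_def intro: span_add span_scale)
  ultimately show "?x \<in> piece y \<delta>" by (simp add: piece_def)
qed

lemma span_p_subset_M: "span (v ` {..p}) \<subseteq> M"
  using p_less_m by (intro span_mono image_mono) auto

lemma center_in_piece: "y \<in> span (v ` {..p}) \<Longrightarrow> 0 < \<delta> \<Longrightarrow> y \<in> piece y \<delta>"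
  using span_p_subset_M by (auto simp: piece_def crd_0 r2_span_p)

lemma line_in_open:
  assumes "openin (top_of_set M) \<Omega>" "x \<in> \<Omega>" "s \<le> m"
  obtains \<eta> where "0 < \<eta>" "\<And>t. \<bar>t\<bar> < \<eta> \<Longrightarrow> x + t *\<^sub>R v s \<in> \<Omega>"
proof -
  obtain e where e: "e > 0" "\<And>z. z \<in> M \<Longrightarrow> dist z x < e \<Longrightarrow> z \<in> \<Omega>" and xM: "x \<in> M"
    using assms(1,2) unfolding openin_euclidean_subtopology_iff by blast
  show ?thesis
  proof (rule that[of "e / (norm (v s) + 1)"])
    show "0 < e / (norm (v s) + 1)" using e by (intro divide_pos_pos add_nonneg_pos) auto
    fix t assume t: "\<bar>t\<bar> < e / (norm (v s) + 1)"
    have pos: "0 < norm (v s) + 1" by (intro add_nonneg_pos) auto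
    have "\<bar>t\<bar> * norm (v s) \<le> \<bar>t\<bar> * (norm (v s) + 1)" by (intro mult_left_mono) auto
    also have "\<dots> < e" using t pos by (simp add: pos_less_divide_eq)
    finally have "dist (x + t *\<^sub>R v s) x < e" by (simp add: dist_norm)
    moreover have "x + t *\<^sub>R v s \<in> M" by (rule span_add[OF xM span_scale[OF span_base]]) (use assms(3) in auto)
    ultimately show "x + t *\<^sub>R v s \<in> \<Omega>" by (intro e)
  qed
qed

lemma domain_in_subset: "domain_in X \<Omega> \<Longrightarrow> \<Omega> \<subseteq> X"
  unfolding domain_in_def by (blast dest: openin_imp_subset)

lemma xp_in_span: "xp x \<in> span (v ` {..p})"
  unfolding xp_def by (rule embv_in_span) simp

lemma xp_local: 
  assumes "y \<in> span (v ` {..p})"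
  shows "y + embv v {..p} (\<lambda>s. crd s (x - y)) = xp x"
proof -
  have "xp x - y \<in> span (v ` {..p})" using assms xp_in_span by (intro span_diff)
  hence "xp x - y = embv v {..p} (\<lambda>s. crd s (xp x - y))" using p_less_m by (intro span_embv) auto
  also have "\<dots> = embv v {..p} (\<lambda>s. crd s (x - y))"
    unfolding embv_def by (rule sum.cong) (auto simp: crd_diff crd_xp)
  finally show ?thesis by (simp add: algebra_simps)
qed

definition ck_term :: "(nat \<Rightarrow> 'a \<Rightarrow> 'a) \<Rightarrow> nat \<Rightarrow> 'a \<Rightarrow> 'a" where
  "ck_term A k x = E k x (A k (xp x))"

text \<open>The first p + 1 directions see only the coefficient function, the others only the power
  of x_q.\<close>

definition ck_term_deriv :: "(nat \<Rightarrow> 'a \<Rightarrow> 'a) \<Rightarrow> nat \<Rightarrow> nat \<Rightarrow> 'a \<Rightarrow> 'a" where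
  "ck_term_deriv A s k x = (if s \<le> p then E k x (pderiv_v v s (A k) (xp x)) else dE s k x (A k (xp x)))"

text \<open>On a small piece the terms and all their first derivatives share one summable majorant,
  which is what termwise differentiation and continuity of the derivatives require.\<close>

lemma ck_local_estimates:
  assumes dom: "domain_in (span (v ` {..p})) \<Omega>0" and an: "real_analytic_on_v v p A0 \<Omega>0" and y: "y \<in> \<Omega>0"
  defines "A \<equiv> ck_fun A0"
  obtains \<delta> Mb where "0 < \<delta>" "summable Mb"
    "\<And>x. x \<in> piece y \<delta> \<Longrightarrow> xp x \<in> \<Omega>0"
    "\<And>k x. x \<in> piece y \<delta> \<Longrightarrow> norm (ck_term A k x) \<le> Mb k"
    "\<And>s k x. s \<le> m \<Longrightarrow> x \<in> piece y \<delta> \<Longrightarrow> norm (ck_term_deriv A s k x) \<le> Mb k"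
    "\<And>s k. s \<le> m \<Longrightarrow> continuous_on (piece y \<delta>) (ck_term_deriv A s k)"
    "\<And>s k x. s \<le> m \<Longrightarrow> x \<in> piece y \<delta> \<Longrightarrow>
       ((\<lambda>t. ck_term A k (x + t *\<^sub>R v s)) has_vector_derivative ck_term_deriv A s k x) (at 0)"
proof -
  have ysp: "y \<in> span (v ` {..p})" using domain_in_subset[OF dom] y by blast
  obtain \<rho> a where \<rho>: "0 < \<rho>" and wa: "wsummable p \<rho> a" and ls: "local_series y \<rho> A0 a"
    and box: "\<And>h. (\<And>s. s \<le> p \<Longrightarrow> \<bar>h s\<bar> \<le> \<rho>) \<Longrightarrow> y + embv v {..p} h \<in> \<Omega>0"
    using real_analytic_local_series[OF dom an y] by metis
  obtain K where K: "0 < K" and Kb: "\<And>a \<rho> \<rho>' k. wsummable p \<rho> a \<Longrightarrow> 0 < \<rho>' \<Longrightarrow> \<rho>' < \<rho> \<Longrightarrow>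
       wsummable p \<rho>' (ck_coeff a k) \<and> wnorm p \<rho>' (ck_coeff a k) \<le> wnorm p \<rho> a * (K / (\<rho> - \<rho>')) ^ k"
    using ck_coeff_bound by metis
  obtain N where N: "0 < N" "\<And>k x a. norm (E k x a) \<le> N * sqrt (r2 x) ^ k * norm a"
    "\<And>s k x a. s \<in> {p+1..m} \<Longrightarrow> norm (dE s k x a) \<le> N * (real k * sqrt (r2 x) ^ (k - 1)) * norm a"
    using E_bounds by metis
  define W where "W = wnorm p \<rho> a"
  have W: "0 \<le> W" using \<rho> by (simp add: W_def wnorm_nonneg)
  \<comment> \<open>The geometric rate of \<open>ck_coeff_bound\<close> when passing from \<rho> to
    \<rho> / 2. A further step down to \<rho> / 4 pays for one derivative of the
    coefficients.\<close>
  define q where "q = K * 2 / \<rho>"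
  have q: "0 < q" using K \<rho> by (simp add: q_def)
  have lsk: "local_series y \<rho> (A k) (ck_coeff a k)" for k
    unfolding A_def by (rule local_series_ck_fun[OF ls])
  have ck: "wsummable p (\<rho> / 2) (ck_coeff a k)" "wnorm p (\<rho> / 2) (ck_coeff a k) \<le> W * q ^ k" for k
    using Kb[OF wa, of "\<rho> / 2" k] \<rho> by (auto simp: W_def q_def)
  have ck': "wsummable p (\<rho> / 4) (mshift s (ck_coeff a k))"
     "wnorm p (\<rho> / 4) (mshift s (ck_coeff a k)) \<le> W * q ^ k * (4 / \<rho>)" if "s \<le> p" for s k
  proof -
    show "wsummable p (\<rho> / 4) (mshift s (ck_coeff a k))"
      using wnorm_mshift(1)[OF ck(1), of "\<rho> / 4"] \<rho> that by auto
    have "wnorm p (\<rho> / 4) (mshift s (ck_coeff a k)) \<le> wnorm p (\<rho> / 2) (ck_coeff a k) / (\<rho> / 2 - \<rho> / 4)"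
      using wnorm_mshift(2)[OF ck(1), of "\<rho> / 4"] \<rho> that by auto
    also have "\<dots> \<le> W * q ^ k / (\<rho> / 2 - \<rho> / 4)" using ck(2) \<rho> by (intro divide_right_mono) auto
    finally show "wnorm p (\<rho> / 4) (mshift s (ck_coeff a k)) \<le> W * q ^ k * (4 / \<rho>)" by (simp add: field_simps)
  qed
  \<comment> \<open>The first bound keeps the coordinates in the box of radius \<rho> / 4; the
    second makes |x_q| q at most 1 / 2, so powers of x_q beat the growth of the
    coefficients.\<close>
  define \<delta> where "\<delta> = min (\<rho> / 4) (1 / (2 * q))"
  have \<delta>: "0 < \<delta>" "\<delta> \<le> \<rho> / 4" "\<delta> * q \<le> 1 / 2"
  proof -
    have "\<delta> * q \<le> 1 / (2 * q) * q" using q by (intro mult_right_mono) (auto simp: \<delta>_def)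
    thus "\<delta> * q \<le> 1 / 2" using q by simp
  qed (use \<rho> q in \<open>auto simp: \<delta>_def\<close>)
  \<comment> \<open>The three summands serve the terms, the derivatives of the coefficients, and the
    derivatives of the powers, where one factor |x_q| is lost.\<close>
  define C where "C = 1 + 4 / \<rho> + 2 * q"
  have C: "1 \<le> C" "4 / \<rho> \<le> C" "2 * q \<le> C" using \<rho> q by (auto simp: C_def)
  define Mb where "Mb k = N * W * C * (real (Suc k) * (1 / 2) ^ k)" for k
  have sMb: "summable Mb" unfolding Mb_def
    by (intro summable_mult sums_summable[OF geometric_deriv_sums]) auto
  have h4: "\<bar>crd s (x - y)\<bar> < \<rho> / 4" if "x \<in> piece y \<delta>" "s \<le> p" for x s
    using that \<delta> by (force simp: piece_def)
  have r: "0 \<le> sqrt (r2 x)" "sqrt (r2 x) \<le> \<delta>" if "x \<in> piece y \<delta>" for x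
    using that \<delta>(1) by (auto simp: r2_nonneg piece_def intro!: real_le_lsqrt)
  have rq: "sqrt (r2 x) ^ k * q ^ k \<le> (1 / 2) ^ k" if "x \<in> piece y \<delta>" for x k
  proof -
    have "sqrt (r2 x) * q \<le> 1 / 2"
      using mult_right_mono[OF r(2)[OF that], of q] q \<delta>(3) by linarith
    thus ?thesis unfolding power_mult_distrib[symmetric] using r(1)[OF that] q by (intro power_mono) auto
  qed
  have Aeq: "A k (xp x) = mseries p (ck_coeff a k) (\<lambda>s. crd s (x - y))"
    and dAeq: "s \<le> p \<Longrightarrow> pderiv_v v s (A k) (xp x) = mseries p (mshift s (ck_coeff a k)) (\<lambda>s. crd s (x - y))"
    if "x \<in> piece y \<delta>" for x k s
  proof -
    have h: "\<bar>crd s (x - y)\<bar> < \<rho>" if "s \<le> p" for s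
      using h4[OF \<open>x \<in> piece y \<delta>\<close> that] \<rho> by linarith
    show "A k (xp x) = mseries p (ck_coeff a k) (\<lambda>s. crd s (x - y))"
      unfolding xp_local[OF ysp, symmetric] by (rule local_seriesD[OF lsk]) (rule h)
    show "pderiv_v v s (A k) (xp x) = mseries p (mshift s (ck_coeff a k)) (\<lambda>s. crd s (x - y))" if "s \<le> p"
      unfolding xp_local[OF ysp, symmetric] by (rule local_seriesD[OF local_series_pderiv[OF lsk that]]) (rule h)
  qed
  have Ab: "norm (A k (xp x)) \<le> W * q ^ k" if "x \<in> piece y \<delta>" for x k
    unfolding Aeq[OF that] using h4[OF that] \<rho>
    by (intro order_trans[OF norm_mseries_le[OF ck(1)] ck(2)]) force
  have dAb: "norm (pderiv_v v s (A k) (xp x)) \<le> W * q ^ k * (4 / \<rho>)" if "x \<in> piece y \<delta>" "s \<le> p" for x k s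
    unfolding dAeq[OF that] using h4[OF that(1)]
    by (intro order_trans[OF norm_mseries_le[OF ck'(1)] ck'(2)] that(2)) (auto intro: less_imp_le)
  have Eb: "norm (E k x b) \<le> N * W * (1 / 2) ^ k * c"
    if "x \<in> piece y \<delta>" "norm b \<le> W * q ^ k * c" "0 \<le> c" for k x b c
  proof -
    have "norm (E k x b) \<le> N * sqrt (r2 x) ^ k * (W * q ^ k * c)"
      using N(1) r(1)[OF that(1)] that(2) by (intro order_trans[OF N(2)] mult_left_mono) auto
    also have "\<dots> = (N * W * c) * (sqrt (r2 x) ^ k * q ^ k)" by (simp add: mult_ac)
    also have "\<dots> \<le> (N * W * c) * (1 / 2) ^ k"
      using N(1) W that(3) by (intro mult_left_mono rq that(1)) auto
    finally show ?thesis by (simp add: mult_ac)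
  qed
  have Mb_ge: "N * W * (1 / 2) ^ k * c \<le> Mb k" if "0 \<le> c" "c \<le> C" for k c
  proof -
    have "N * W * (1 / 2) ^ k * (1 * c) \<le> N * W * (1 / 2) ^ k * (real (Suc k) * C)"
      using N(1) W that by (intro mult_left_mono mult_mono) auto
    thus ?thesis by (simp add: Mb_def mult_ac)
  qed
  show ?thesis
  proof (rule that[OF \<delta>(1) sMb])
    fix x assume x: "x \<in> piece y \<delta>"
    show "xp x \<in> \<Omega>0"
      unfolding xp_local[OF ysp, symmetric] by (rule box) (use h4[OF x] \<rho> in force)
    fix k
    show "norm (ck_term A k x) \<le> Mb k"
      unfolding ck_term_def using Eb[OF x, of _ k 1] Ab[OF x, of k] Mb_ge[of 1 k] C by force
    fix s assume s: "s \<le> m"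
    show "norm (ck_term_deriv A s k x) \<le> Mb k"
    proof (cases "s \<le> p")
      case True
      have "norm (E k x (pderiv_v v s (A k) (xp x))) \<le> N * W * (1 / 2) ^ k * (4 / \<rho>)"
        using \<rho> by (intro Eb x dAb True) auto
      also have "\<dots> \<le> Mb k" using \<rho> C by (intro Mb_ge) auto
      finally show ?thesis using True by (simp add: ck_term_deriv_def)
    next
      case False
      have "norm (dE s k x (A k (xp x))) \<le> N * (real k * sqrt (r2 x) ^ (k - 1)) * (W * q ^ k)"
        using N(1) r(1)[OF x] False s by (intro order_trans[OF N(3)] mult_left_mono Ab x) auto
      also have "\<dots> \<le> Mb k"
      proof (cases k)
        case (Suc j)
        have "N * (real k * sqrt (r2 x) ^ (k - 1)) * (W * q ^ k) = N * W * real k * q * (sqrt (r2 x) ^ j * q ^ j)"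
          by (simp add: Suc mult_ac)
        also have "\<dots> \<le> N * W * real k * q * (1 / 2) ^ j"
          using N(1) W q by (intro mult_left_mono rq x) auto
        also have "\<dots> = N * W * (1 / 2) ^ k * (real k * (2 * q))" by (simp add: Suc mult_ac)
        also have "\<dots> \<le> N * W * (1 / 2) ^ k * (real (Suc k) * C)"
          using N(1) W q C by (intro mult_left_mono mult_mono) auto
        also have "\<dots> = Mb k" by (simp add: Mb_def mult_ac)
        finally show ?thesis .
      qed (use N W C in \<open>simp add: Mb_def\<close>)
      finally show ?thesis using False by (simp add: ck_term_deriv_def)
    qed
    show "((\<lambda>t. ck_term A k (x + t *\<^sub>R v s)) has_vector_derivative ck_term_deriv A s k x) (at 0)"
    proof (cases "s \<le> p")
      case True
      let ?h = "\<lambda>s. crd s (x - y)"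
      have "((\<lambda>t. A k (y + embv v {..p} ?h + t *\<^sub>R v s)) has_vector_derivative mseries p (mshift s (ck_coeff a k)) ?h) (at 0)"
        using h4[OF x] \<rho> by (intro local_series_has_vector_derivative[OF lsk True]) force
      hence "((\<lambda>t. A k (xp x + t *\<^sub>R v s)) has_vector_derivative pderiv_v v s (A k) (xp x)) (at 0)"
        unfolding xp_local[OF ysp] dAeq[OF x True] .
      hence "((\<lambda>t. E k x (A k (xp x + t *\<^sub>R v s))) has_vector_derivative E k x (pderiv_v v s (A k) (xp x))) (at 0)"
        by (rule bounded_linear.has_vector_derivative[OF E_bounded_linear])
      thus ?thesis using True p_less_m by (simp add: ck_term_def ck_term_deriv_def E_line_p xp_add xp_scale xp_v)
    next
      case False
      hence sI: "s \<in> {p+1..m}" using s by auto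
      have "((\<lambda>t. E k (x + t *\<^sub>R v s) (A k (xp x))) has_vector_derivative dE s k (x + 0 *\<^sub>R v s) (A k (xp x))) (at 0)"
        by (rule E_line_q_deriv[OF sI])
      thus ?thesis using False s by (simp add: ck_term_def ck_term_deriv_def xp_add xp_scale xp_v)
    qed
  next
    fix s k assume s: "s \<le> m"
    have h4': "\<bar>crd i (x - y)\<bar> \<le> \<rho> / 4" "\<bar>crd i (x - y)\<bar> \<le> \<rho> / 2" if "x \<in> piece y \<delta>" "i \<le> p" for x i
      using h4[OF that] \<rho> by linarith+
    have cA: "continuous_on (piece y \<delta>) (\<lambda>x. A k (xp x))"
    proof -
      have "continuous_on (piece y \<delta>) (\<lambda>x. mseries p (ck_coeff a k) (\<lambda>s. crd s (x - y)))"
        by (rule continuous_on_mseries[OF ck(1)]) (intro continuous_intros h4'(2); assumption)+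
      thus ?thesis using Aeq by (simp cong: continuous_on_cong)
    qed
    show "continuous_on (piece y \<delta>) (ck_term_deriv A s k)"
    proof (cases "s \<le> p")
      case True
      have "continuous_on (piece y \<delta>) (\<lambda>x. mseries p (mshift s (ck_coeff a k)) (\<lambda>s. crd s (x - y)))"
        by (rule continuous_on_mseries[OF ck'(1)[OF True]]) (intro continuous_intros h4'(1); assumption)+
      hence "continuous_on (piece y \<delta>) (\<lambda>x. pderiv_v v s (A k) (xp x))"
        using dAeq[OF _ True] by (simp cong: continuous_on_cong)
      thus ?thesis using True continuous_on_E by (simp add: ck_term_deriv_def[abs_def])
    next
      case False
      thus ?thesis using continuous_on_dE[OF cA] by (simp add: ck_term_deriv_def[abs_def])
    qed
  qed
qed

lemma has_vector_derivative_shift: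
  fixes f :: "'a \<Rightarrow> 'a"
  assumes "((\<lambda>t. f (x + t0 *\<^sub>R u + t *\<^sub>R u)) has_vector_derivative d) (at 0)"
  shows "((\<lambda>t. f (x + t *\<^sub>R u)) has_vector_derivative d) (at t0)"
proof -
  have D: "((\<lambda>t. t - t0) has_vector_derivative 1) (at t0)" by (auto intro!: derivative_eq_intros)
  have "((\<lambda>t. f (x + t0 *\<^sub>R u + t *\<^sub>R u)) has_vector_derivative d) (at (t0 - t0))" using assms by simp
  from vector_diff_chain_at[OF D this]
  show ?thesis by (simp add: o_def scaleR_diff_left)
qed

lemma ck_sum_derivative:
  fixes T T' :: "nat \<Rightarrow> 'a \<Rightarrow> 'a"
  assumes op: "openin (top_of_set M) X" and x: "x \<in> X" and s: "s \<le> m" and Mb: "summable Mb"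
    and "\<And>k x. x \<in> X \<Longrightarrow> norm (T k x) \<le> Mb k" "\<And>k x. x \<in> X \<Longrightarrow> norm (T' k x) \<le> Mb k"
    and d: "\<And>k x. x \<in> X \<Longrightarrow> ((\<lambda>t. T k (x + t *\<^sub>R v s)) has_vector_derivative T' k x) (at 0)"
  shows "((\<lambda>t. \<Sum>k. T k (x + t *\<^sub>R v s)) has_vector_derivative (\<Sum>k. T' k x)) (at 0)"
proof -
  obtain \<eta> where \<eta>: "0 < \<eta>" "\<And>t. \<bar>t\<bar> < \<eta> \<Longrightarrow> x + t *\<^sub>R v s \<in> X" using line_in_open[OF op x s] by blast
  have inX: "x + t *\<^sub>R v s \<in> X" if "t \<in> {-\<eta><..<\<eta>}" for t using \<eta>(2)[of t] that by auto
  have "((\<lambda>t. \<Sum>k. T k (x + t *\<^sub>R v s)) has_vector_derivative (\<Sum>k. T' k (x + 0 *\<^sub>R v s))) (at 0)"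
  proof (rule has_vector_derivative_suminf[where S = "{-\<eta><..<\<eta>}" and M = Mb
      and f = "\<lambda>k t. T k (x + t *\<^sub>R v s)" and f' = "\<lambda>k t. T' k (x + t *\<^sub>R v s)"])
    fix k t assume t: "t \<in> {-\<eta><..<\<eta>}"
    show "((\<lambda>t. T k (x + t *\<^sub>R v s)) has_vector_derivative T' k (x + t *\<^sub>R v s)) (at t)"
      by (rule has_vector_derivative_shift[OF d[OF inX[OF t]]])
    show "norm (T' k (x + t *\<^sub>R v s)) \<le> Mb k" by (intro assms inX t)
  next
    fix t assume t: "t \<in> {-\<eta><..<\<eta>}"
    show "summable (\<lambda>k. T k (x + t *\<^sub>R v s))"
      by (rule summable_comparison_test'[OF Mb]) (intro assms inX t)
  qed (use \<eta> Mb in auto)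
  thus ?thesis by simp
qed

section \<open>Slice domains assembled from pieces\<close>

lemma slice_subset_M:
  assumes "\<omega> \<in> sphere_q v p m"
  shows "{y + t *\<^sub>R \<omega> | y t. y \<in> span (v ` {..p})} \<subseteq> M"
  using assms span_p_subset_M embv_in_span[of "{p+1..m}" "{..m}"]
  by (auto simp: sphere_q_def intro!: span_add span_scale)

lemma convex_slice: "convex {y + t *\<^sub>R \<omega> | y t. y \<in> span (v ` {..p})}"
proof (rule convexI)
  let ?L = "{y + t *\<^sub>R \<omega> | y t. y \<in> span (v ` {..p})}"
  fix a b and u w :: real
  assume "a \<in> ?L" "b \<in> ?L"
  then obtain y t z r where "a = y + t *\<^sub>R \<omega>" "b = z + r *\<^sub>R \<omega>" "y \<in> span (v ` {..p})" "z \<in> span (v ` {..p})" by blast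
  moreover from this have "u *\<^sub>R a + w *\<^sub>R b = (u *\<^sub>R y + w *\<^sub>R z) + (u * t + w * r) *\<^sub>R \<omega>" by (simp add: algebra_simps)
  ultimately show "u *\<^sub>R a + w *\<^sub>R b \<in> ?L" by (blast intro: span_add span_scale)
qed

lemma sphere_coords:
  assumes w: "\<omega> \<in> sphere_q v p m" and y: "y \<in> span (v ` {..p})"
  shows "s \<le> p \<Longrightarrow> crd s (y + r *\<^sub>R \<omega>) = crd s y" "r2 (y + r *\<^sub>R \<omega>) = r\<^sup>2"
proof -
  obtain c where c: "\<omega> = embv v {p+1..m} c" "(\<Sum>s\<in>{p+1..m}. (c s)\<^sup>2) = 1"
    using w by (auto simp: sphere_q_def)
  have cw: "crd s \<omega> = (if s \<in> {p+1..m} then c s else 0)" for s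
    unfolding c(1) by (rule crd_embv) auto
  show "crd s (y + r *\<^sub>R \<omega>) = crd s y" if "s \<le> p" using that by (simp add: crd_add crd_scale cw)
  have "crd s y = 0" if "s \<in> {p+1..m}" for s using crd_xp[of s y] that by (simp add: xp_id[OF y])
  hence "r2 (y + r *\<^sub>R \<omega>) = (\<Sum>s\<in>{p+1..m}. r\<^sup>2 * (c s)\<^sup>2)"
    unfolding r2_def by (intro sum.cong) (auto simp: crd_add crd_scale cw power_mult_distrib)
  thus "r2 (y + r *\<^sub>R \<omega>) = r\<^sup>2" using c(2) by (simp add: sum_distrib_left[symmetric])
qed

lemma piece_sphere:
  assumes "y \<in> span (v ` {..p})" "\<omega> \<in> sphere_q v p m" "\<eta> \<in> sphere_q v p m" "y + r *\<^sub>R \<omega> \<in> piece z \<delta>"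
  shows "y + r *\<^sub>R \<eta> \<in> piece z \<delta>"
proof -
  have "y + r *\<^sub>R \<eta> \<in> M" using slice_subset_M[OF assms(3)] assms(1) by blast
  thus ?thesis
    using assms(4) by (auto simp: piece_def crd_diff sphere_coords[OF assms(2,1)] sphere_coords[OF assms(3,1)])
qed

text \<open>Every slice contains the connected set \<open>\<Omega>0\<close> and meets each piece in
  a convex set through its centre, so the union stays connected. The same argument with L =
  \<open>M\<close> treats the whole domain.\<close>

lemma pieces_slice_domain:
  assumes dom: "domain_in (span (v ` {..p})) \<Omega>0" and \<delta>: "\<And>y. y \<in> \<Omega>0 \<Longrightarrow> 0 < \<delta> y"
  defines "\<Omega> \<equiv> (\<Union>y\<in>\<Omega>0. piece y (\<delta> y))"
  shows "slice_domain v p m \<Omega>" "p_symmetric v p m \<Omega>" "\<Omega>0 \<subseteq> \<Omega>" "openin (top_of_set M) \<Omega>"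
proof -
  have sub: "\<Omega>0 \<subseteq> span (v ` {..p})" and ne: "\<Omega>0 \<noteq> {}" and conn: "connected \<Omega>0"
    using domain_in_subset[OF dom] dom by (auto simp: domain_in_def)
  have cen: "y \<in> piece y (\<delta> y)" if "y \<in> \<Omega>0" for y using that sub \<delta> by (intro center_in_piece) auto
  show \<Omega>0: "\<Omega>0 \<subseteq> \<Omega>" using cen by (auto simp: \<Omega>_def)
  have "\<forall>y. \<exists>U. open U \<and> piece y (\<delta> y) = M \<inter> U" using piece_open by metis
  then obtain U where U: "\<And>y. open (U y)" "\<And>y. piece y (\<delta> y) = M \<inter> U y" by metis
  define V where "V = (\<Union>y\<in>\<Omega>0. U y)"
  have V: "open V" "\<Omega> = M \<inter> V" using U by (auto simp: V_def \<Omega>_def)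
  show op: "openin (top_of_set M) \<Omega>" using V by (simp add: openin_open_Int)
  have slice: "domain_in L (\<Omega> \<inter> L)" if L: "L \<subseteq> M" "convex L" "\<Omega>0 \<subseteq> L" for L
    unfolding domain_in_def
  proof (intro conjI)
    have "\<Omega> \<inter> L = L \<inter> V" using V L by auto
    thus "openin (top_of_set L) (\<Omega> \<inter> L)" using V(1) by (simp add: openin_open_Int)
    have "\<Omega> \<inter> L = \<Omega>0 \<union> \<Union>((\<lambda>y. piece y (\<delta> y) \<inter> L) ` \<Omega>0)"
      using L \<Omega>0 by (auto simp: \<Omega>_def)
    moreover have "connected \<dots>"
    proof (rule connected_Un_UN[OF conn])
      fix X assume "X \<in> (\<lambda>y. piece y (\<delta> y) \<inter> L) ` \<Omega>0"
      then obtain y where y: "y \<in> \<Omega>0" "X = piece y (\<delta> y) \<inter> L" by blast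
      show "connected X" unfolding y(2) using \<delta>[OF y(1)] L by (intro convex_connected convex_Int convex_piece)
      show "\<Omega>0 \<inter> X \<noteq> {}" using y cen L by blast
    qed
    ultimately show "connected (\<Omega> \<inter> L)" by simp
    show "\<Omega> \<inter> L \<noteq> {}" using ne \<Omega>0 L by blast
  qed
  have s0: "y \<in> {y + t *\<^sub>R \<omega> | y t. y \<in> span (v ` {..p})}" if "y \<in> span (v ` {..p})" for y \<omega>
    using that by (intro CollectI exI[of _ y] exI[of _ "0::real"]) auto
  show "slice_domain v p m \<Omega>"
    unfolding slice_domain_def Let_def
  proof (intro conjI ballI)
    have "domain_in M (\<Omega> \<inter> M)" using sub span_p_subset_M by (intro slice) (auto simp: subspace_imp_convex)
    moreover have "\<Omega> \<inter> M = \<Omega>" using V by auto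
    ultimately show "domain_in M \<Omega>" by simp
    show "\<Omega> \<inter> span (v ` {..p}) \<noteq> {}" using ne \<Omega>0 sub by blast
    fix \<omega> assume "\<omega> \<in> sphere_q v p m"
    thus "domain_in {y + t *\<^sub>R \<omega> |y t. y \<in> span (v ` {..p})} (\<Omega> \<inter> {y + t *\<^sub>R \<omega> |y t. y \<in> span (v ` {..p})})"
      using s0 sub by (intro slice slice_subset_M convex_slice) auto
  qed
  show "p_symmetric v p m \<Omega>"
    unfolding p_symmetric_def
  proof (intro ballI allI impI)
    fix y \<omega> \<eta> and r :: real
    assume a: "y \<in> span (v ` {..p})" "\<omega> \<in> sphere_q v p m" "\<eta> \<in> sphere_q v p m"
    assume "y + r *\<^sub>R \<omega> \<in> \<Omega>"
    then obtain z where z: "z \<in> \<Omega>0" "y + r *\<^sub>R \<omega> \<in> piece z (\<delta> z)" by (auto simp: \<Omega>_def)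
    show "y + r *\<^sub>R \<eta> \<in> \<Omega>" using piece_sphere[OF a z(2)] z(1) by (auto simp: \<Omega>_def)
  qed
qed

text \<open>The recursion makes the contribution of x_q in the term k + 1 cancel that of x_p in the
  term k. The partial sums telescope to one leftover, which tends to 0 because it is built from
  terms of convergent series.\<close>

lemma ck_monogenic_identity:
  assumes sm: "\<And>s. s \<le> m \<Longrightarrow> summable (\<lambda>k. ck_term_deriv (ck_fun A0) s k x)"
  shows "(\<Sum>s\<le>m. mul (v s) (\<Sum>k. ck_term_deriv (ck_fun A0) s k x)) = 0"
proof -
  let ?A = "ck_fun A0" and ?T = "ck_term_deriv (ck_fun A0)"
  let ?w = "\<lambda>k. \<Sum>s\<le>m. mul (v s) (?T s k x)"
  let ?u = "\<lambda>k. \<Sum>s\<le>p. mul (v s) (?T s k x)"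
  have uE: "?u k = E k x (dirac k (\<lambda>s. pderiv_v v s (?A k) (xp x)))" for k
    unfolding dirac_p_E[symmetric] by (simp add: ck_term_deriv_def)
  have split: "?w k = ?u k + (\<Sum>s\<in>{p+1..m}. mul (v s) (dE s k x (?A k (xp x))))" for k
    unfolding atMost_m(1) by (subst sum.union_disjoint) (auto simp: ck_term_deriv_def intro!: sum.cong)
  have w0: "?w 0 = ?u 0" unfolding split by (simp add: dE_def mul.zero_right)
  have wS: "?w (Suc k) = ?u (Suc k) - ?u k" for k
  proof -
    have "\<gamma> k \<noteq> 0" using \<gamma>_ge[of k] by auto
    hence "(- \<gamma> k) *\<^sub>R E k x (?A (Suc k) (xp x)) = - ?u k"
      unfolding uE by (simp add: linear_scale[OF E_linear])
    thus ?thesis unfolding split[of "Suc k"] dirac_q_E by simp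
  qed
  have partial: "(\<Sum>k<Suc n. ?w k) = ?u n" for n
  proof (induction n)
    case 0
    show ?case using w0 by simp
  next
    case (Suc n)
    show ?case unfolding sum.lessThan_Suc[of _ "Suc n"] Suc wS by simp
  qed
  have T: "(\<lambda>k. mul (v s) (?T s k x)) sums mul (v s) (\<Sum>k. ?T s k x)" if "s \<le> m" for s
    by (rule bounded_linear.sums[OF mul.bounded_linear_right summable_sums[OF sm[OF that]]])
  have "?w sums (\<Sum>s\<le>m. mul (v s) (\<Sum>k. ?T s k x))" by (rule sums_sum) (use T in auto)
  hence 1: "(\<lambda>n. \<Sum>k<Suc n. ?w k) \<longlonglongrightarrow> (\<Sum>s\<le>m. mul (v s) (\<Sum>k. ?T s k x))"
    unfolding sums_def by (rule LIMSEQ_Suc)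
  have "?u \<longlonglongrightarrow> (\<Sum>s\<le>p. 0)"
    by (intro tendsto_sum summable_LIMSEQ_zero sums_summable[OF T]) (use p_less_m in auto)
  hence "(\<lambda>n. \<Sum>k<Suc n. ?w k) \<longlonglongrightarrow> 0" unfolding partial by simp
  from LIMSEQ_unique[OF 1 this] show ?thesis .
qed

lemma ck_extension_exists:
  assumes dom: "domain_in (span (v ` {..p})) \<Omega>0" and an: "real_analytic_on_v v p A0 \<Omega>0"
  obtains \<Omega> f where "CK_extension mul one v p m \<Omega>0 (ck_fun A0) \<Omega> f"
proof -
  let ?A = "ck_fun A0"
  let ?P = "\<lambda>y \<delta> Mb. 0 < \<delta> \<and> summable Mb \<and> (\<forall>x\<in>piece y \<delta>. xp x \<in> \<Omega>0 \<and> (\<forall>k. norm (ck_term ?A k x) \<le> Mb k)) \<and>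
      (\<forall>s\<le>m. \<forall>k. continuous_on (piece y \<delta>) (ck_term_deriv ?A s k) \<and> (\<forall>x\<in>piece y \<delta>.
        norm (ck_term_deriv ?A s k x) \<le> Mb k \<and>
        ((\<lambda>t. ck_term ?A k (x + t *\<^sub>R v s)) has_vector_derivative ck_term_deriv ?A s k x) (at 0)))"
  have "\<forall>y\<in>\<Omega>0. \<exists>\<delta> Mb. ?P y \<delta> Mb"
  proof
    fix y assume "y \<in> \<Omega>0"
    thus "\<exists>\<delta> Mb. ?P y \<delta> Mb"
    proof (rule ck_local_estimates[OF dom an])
      fix \<delta> Mb
      assume "0 < \<delta>" "summable Mb"
      "\<And>x. x \<in> piece y \<delta> \<Longrightarrow> xp x \<in> \<Omega>0"
      "\<And>k x. x \<in> piece y \<delta> \<Longrightarrow> norm (ck_term ?A k x) \<le> Mb k"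
      "\<And>s k x. s \<le> m \<Longrightarrow> x \<in> piece y \<delta> \<Longrightarrow> norm (ck_term_deriv ?A s k x) \<le> Mb k"
      "\<And>s k. s \<le> m \<Longrightarrow> continuous_on (piece y \<delta>) (ck_term_deriv ?A s k)"
      "\<And>s k x. s \<le> m \<Longrightarrow> x \<in> piece y \<delta> \<Longrightarrow>
       ((\<lambda>t. ck_term ?A k (x + t *\<^sub>R v s)) has_vector_derivative ck_term_deriv ?A s k x) (at 0)"
      note this [intro]
      show ?thesis by (intro exI[of _ \<delta>] exI[of _ Mb]) blast
    qed
  qed
  from bchoice[OF this] obtain \<delta> where "\<forall>y\<in>\<Omega>0. \<exists>Mb. ?P y (\<delta> y) Mb" ..
  from bchoice[OF this] obtain Mb where P: "\<forall>y\<in>\<Omega>0. ?P y (\<delta> y) (Mb y)" ..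
  define \<Omega> where "\<Omega> = (\<Union>y\<in>\<Omega>0. piece y (\<delta> y))"
  \<comment> \<open>The sum is defined by one formula everywhere, so overlapping pieces agree
    automatically.\<close>
  define f where "f x = (\<Sum>k. ck_term ?A k x)" for x
  have \<delta>: "0 < \<delta> y" if "y \<in> \<Omega>0" for y using P that by blast
  note \<Omega> = pieces_slice_domain[of \<Omega>0 \<delta>, OF dom \<delta>, folded \<Omega>_def]
  have sm: "summable (\<lambda>k. ck_term ?A k x)" if x: "x \<in> piece y (\<delta> y)" "y \<in> \<Omega>0" for x y
    by (rule summable_comparison_test'[of "Mb y" 0]) (use P x in blast)+
  have sm': "summable (\<lambda>k. ck_term_deriv ?A s k x)" if x: "x \<in> piece y (\<delta> y)" "y \<in> \<Omega>0" "s \<le> m" for x y s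
    by (rule summable_comparison_test'[of "Mb y" 0]) (use P x in blast)+
  have pop: "openin (top_of_set M) (piece y (\<delta> y))" for y
    using piece_open[of y "\<delta> y"] by (metis openin_open_Int)
  have D: "((\<lambda>t. f (x + t *\<^sub>R v s)) has_vector_derivative (\<Sum>k. ck_term_deriv ?A s k x)) (at 0)"
    if x: "x \<in> \<Omega>" and s: "s \<le> m" for x s
  proof -
    obtain y where y: "y \<in> \<Omega>0" "x \<in> piece y (\<delta> y)" using x by (auto simp: \<Omega>_def)
    show ?thesis unfolding f_def
      by (rule ck_sum_derivative[OF pop y(2) s, of "Mb y"]) (use P y(1) s in blast)+
  qed
  have pd: "pderiv_v v s f x = (\<Sum>k. ck_term_deriv ?A s k x)" if "x \<in> \<Omega>" "s \<le> m" for x s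
    unfolding pderiv_v_def by (rule vector_derivative_at[OF D[OF that]])
  have cont: "continuous_on \<Omega> (\<lambda>x. \<Sum>k. ck_term_deriv ?A s k x)" if s: "s \<le> m" for s
    unfolding continuous_on_eq_continuous_within
  proof
    fix x assume x: "x \<in> \<Omega>"
    obtain y where y: "y \<in> \<Omega>0" "x \<in> piece y (\<delta> y)" using x by (auto simp: \<Omega>_def)
    have "uniform_limit (piece y (\<delta> y)) (\<lambda>n x. \<Sum>k<n. ck_term_deriv ?A s k x) (\<lambda>x. \<Sum>k. ck_term_deriv ?A s k x) sequentially"
      by (rule Weierstrass_m_test[of _ _ "Mb y"]) (use P y(1) s in blast)+
    moreover have "continuous_on (piece y (\<delta> y)) (\<lambda>x. \<Sum>k<n. ck_term_deriv ?A s k x)" for n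
      by (intro continuous_on_sum) (use P y(1) s in blast)
    ultimately have "continuous_on (piece y (\<delta> y)) (\<lambda>x. \<Sum>k. ck_term_deriv ?A s k x)"
      by (intro uniform_limit_theorem[OF always_eventually]) auto
    hence c: "continuous (at x within piece y (\<delta> y)) (\<lambda>x. \<Sum>k. ck_term_deriv ?A s k x)"
      using y(2) by (simp add: continuous_on_eq_continuous_within)
    \<comment> \<open>A piece is relatively open, so continuity within the piece at x is continuity
      within the whole domain.\<close>
    obtain U where U: "open U" "piece y (\<delta> y) = M \<inter> U" using piece_open .
    have "\<Omega> \<subseteq> M" using openin_imp_subset[OF \<Omega>(4)] .
    hence "\<Omega> \<inter> U - {x} = piece y (\<delta> y) \<inter> U - {x}" using U y(1) by (auto simp: \<Omega>_def)
    hence "at x within \<Omega> = at x within piece y (\<delta> y)"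
      by (intro at_within_nhd[of x U]) (use U y in auto)
    with c show "continuous (at x within \<Omega>) (\<lambda>x. \<Sum>k. ck_term_deriv ?A s k x)" by simp
  qed
  show ?thesis
  proof (rule that[of \<Omega> f], unfold CK_extension_def, intro conjI allI impI)
    show "\<Omega> \<subseteq> star_set v p m \<Omega>0"
    proof
      fix x assume x: "x \<in> \<Omega>"
      obtain y where y: "y \<in> \<Omega>0" "x \<in> piece y (\<delta> y)" using x by (auto simp: \<Omega>_def)
      hence "xp x \<in> \<Omega>0" "x = xp x + xq x" using P xp_xq[of x] by (auto simp: piece_def)
      moreover have "xq x \<in> span (v ` {p+1..m})" unfolding xq_def by (rule embv_in_span) simp
      ultimately show "x \<in> star_set v p m \<Omega>0" unfolding star_set_def by blast
    qed
    fix c assume "embv v {..m} c \<in> \<Omega>"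
    then obtain y where y: "y \<in> \<Omega>0" "embv v {..m} c \<in> piece y (\<delta> y)" by (auto simp: \<Omega>_def)
    from summable_sums[OF sm[OF y(2,1)]]
    show "(\<lambda>k. mul (powA mul one (embv v {p + 1..m} c) k) (ck_fun A0 k (embv v {..p} c))) sums f (embv v {..m} c)"
      unfolding f_def[symmetric] by (simp only: ck_term_def xp_embv powA_xq[symmetric] xq_embv)
  next
    show "monogenic_on mul v m f \<Omega>"
      unfolding monogenic_on_def C1_on_def
    proof (intro conjI allI impI ballI)
      fix s x assume "s \<le> m" "x \<in> \<Omega>"
      thus "(\<lambda>t. f (x + t *\<^sub>R v s)) differentiable at 0" using D by (blast intro: differentiableI_vector)
    next
      fix s assume "s \<le> m"
      thus "continuous_on \<Omega> (pderiv_v v s f)" using cont pd by (simp cong: continuous_on_cong)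
    next
      fix x assume x: "x \<in> \<Omega>"
      obtain y where y: "y \<in> \<Omega>0" "x \<in> piece y (\<delta> y)" using x by (auto simp: \<Omega>_def)
      have "(\<Sum>s\<le>m. mul (v s) (pderiv_v v s f x)) = (\<Sum>s\<le>m. mul (v s) (\<Sum>k. ck_term_deriv ?A s k x))"
        using pd[OF x] by (intro sum.cong) auto
      also have "\<dots> = 0" by (intro ck_monogenic_identity sm'[OF y(2,1)])
      finally show "(\<Sum>s\<le>m. mul (v s) (pderiv_v v s f x)) = 0" .
    qed
  qed (use \<Omega> in auto)
qed

lemma ck_fun_analytic:
  assumes dom: "domain_in (span (v ` {..p})) \<Omega>0" and an: "real_analytic_on_v v p A0 \<Omega>0"
  shows "real_analytic_on_v v p (ck_fun A0 k) \<Omega>0"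
proof (rule local_series_imp_real_analytic)
  fix y assume "y \<in> \<Omega>0"
  from real_analytic_local_series[OF dom an this] obtain \<rho> a where "0 < \<rho>" "local_series y \<rho> A0 a" by metis
  thus "\<exists>\<rho>>0. \<exists>a. local_series y \<rho> (ck_fun A0 k) a" using local_series_ck_fun by blast
qed

section \<open>Uniqueness\<close>

lemma box_in_open:
  assumes I: "I \<subseteq> {..m}" and op: "openin (top_of_set (span (v ` I))) X" and y: "y \<in> X"
  obtains \<delta> where "0 < \<delta>"
    "\<And>x. x \<in> span (v ` I) \<Longrightarrow> (\<And>s. s \<in> I \<Longrightarrow> \<bar>crd s (x - y)\<bar> \<le> \<delta>) \<Longrightarrow> x \<in> X"
proof -
  obtain e where e: "e > 0" "\<And>z. z \<in> span (v ` I) \<Longrightarrow> dist z y < e \<Longrightarrow> z \<in> X"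
    using op y unfolding openin_euclidean_subtopology_iff by blast
  have ysp: "y \<in> span (v ` I)" using openin_imp_subset[OF op] y by blast
  define B where "B = (\<Sum>s\<in>I. norm (v s)) + 1"
  have B: "0 < B" unfolding B_def using sum_nonneg[of I "\<lambda>s. norm (v s)"] by simp
  show ?thesis
  proof (rule that[of "e / (2 * B)"])
    show "0 < e / (2 * B)" using e B by simp
    fix x assume x: "x \<in> span (v ` I)" and le: "\<And>s. s \<in> I \<Longrightarrow> \<bar>crd s (x - y)\<bar> \<le> e / (2 * B)"
    have "x - y = embv v I (\<lambda>s. crd s (x - y))" using x ysp I by (intro span_embv span_diff)
    hence "norm (x - y) = norm (\<Sum>s\<in>I. crd s (x - y) *\<^sub>R v s)" by (simp add: embv_def)
    also have "\<dots> \<le> (\<Sum>s\<in>I. e / (2 * B) * norm (v s))"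
      by (rule sum_norm_le, unfold norm_scaleR, rule mult_right_mono[OF le norm_ge_zero])
    also have "\<dots> = e / (2 * B) * (B - 1)" by (simp add: B_def sum_distrib_left)
    also have "\<dots> \<le> e / (2 * B) * B" using e B by (intro mult_left_mono) auto
    also have "\<dots> < e" using e B by simp
    finally show "x \<in> X" using x e by (simp add: dist_norm)
  qed
qed

text \<open>Away from r = 0 the k-th power of x_q is its own inverse up to a scalar. Injectivity and
  the lower bound below follow from this.\<close>

lemma E_E: "E k x (E k x a) = (if even k then 1 else - 1) *\<^sub>R (r2 x ^ k *\<^sub>R a)"
proof (cases "even k")
  case True
  then obtain l where "k = 2 * l" by (auto elim: evenE)
  thus ?thesis by (simp add: E_def power_add[symmetric] mult_2[symmetric] power_minus_even)
next
  case False
  then obtain l where k: "k = 2 * l + 1" by (auto elim: oddE)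
  have "(- r2 x) ^ l * (- r2 x) ^ l = r2 x ^ (2 * l)" by (simp add: power_add[symmetric] mult_2[symmetric])
  thus ?thesis by (simp add: E_def k mul.scaleR_right xq_mul_xq mult_ac del: scaleR_minus_left)
qed

lemma E_eq_0_iff:
  assumes "0 < r2 x"
  shows "E k x a = 0 \<longleftrightarrow> a = 0"
proof
  assume "E k x a = 0"
  hence "E k x (E k x a) = 0" by (simp add: linear_0[OF E_linear])
  thus "a = 0" using assms unfolding E_E by (auto split: if_splits)
qed (simp add: linear_0[OF E_linear])

text \<open>Apply the upper bound to the second factor in \<open>E_E\<close>; the constant stays the
  same for every k.\<close>

lemma E_lower_bound:
  assumes N: "\<And>k x a. norm (E k x a) \<le> N * sqrt (r2 x) ^ k * norm a" and r: "0 < r2 x"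
  shows "norm a * sqrt (r2 x) ^ k \<le> N * norm (E k x a)"
proof -
  let ?r = "sqrt (r2 x)"
  have r2: "r2 x ^ k = ?r ^ k * ?r ^ k"
    using r by (simp add: power_mult_distrib[symmetric])
  have "r2 x ^ k * norm a = norm (E k x (E k x a))" using r by (simp add: E_E)
  also have "\<dots> \<le> N * ?r ^ k * norm (E k x a)" by (rule N)
  finally have "?r ^ k * (norm a * ?r ^ k) \<le> ?r ^ k * (N * norm (E k x a))" by (simp add: r2 mult_ac)
  thus ?thesis using r by (simp add: mult_le_cancel_left)
qed

lemma real_analytic_continuous:
  fixes f :: "'a \<Rightarrow> 'a"
  assumes dom: "domain_in (span (v ` {..p})) \<Omega>0" and an: "real_analytic_on_v v p f \<Omega>0"
  shows "continuous_on \<Omega>0 f"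
  unfolding continuous_on_eq_continuous_within
proof
  fix y assume y: "y \<in> \<Omega>0"
  obtain \<rho> a where \<rho>: "0 < \<rho>" "local_series y \<rho> f a"
    using real_analytic_local_series[OF dom an y] by metis
  have sub: "\<Omega>0 \<subseteq> span (v ` {..p})" by (rule domain_in_subset[OF dom])
  let ?U = "\<Inter>s\<in>{..p}. {x. \<bar>crd s (x - y)\<bar> < \<rho> / 2}"
  have "continuous_on (\<Omega>0 \<inter> ?U) f"
    by (rule local_series_continuous[OF \<rho>(2), of "\<rho> / 2"]) (use \<rho> sub y in \<open>auto intro: less_imp_le\<close>)
  hence "continuous (at y within \<Omega>0 \<inter> ?U) f"
    using y \<rho> by (auto simp: continuous_on_eq_continuous_within crd_0)
  moreover have "at y within \<Omega>0 = at y within (\<Omega>0 \<inter> ?U)"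
  proof (rule at_within_nhd[of y ?U])
    show "open ?U" by (intro open_INT open_Collect_less continuous_intros ballI) auto
  qed (use \<rho> in \<open>auto simp: crd_0\<close>)
  ultimately show "continuous (at y within \<Omega>0) f" by simp
qed

text \<open>Upgrades bounds that depend on the point to one bound on a relatively open part of
  \<open>S\<close>: the closed sets \<open>T n\<close> cover \<open>S\<close>, so their complements
  cannot all be dense.\<close>

lemma baire_uniform_bound:
  fixes C :: "nat \<Rightarrow> 'a \<Rightarrow> 'a"
  assumes cont: "\<And>j. continuous_on S (C j)" and S: "closed S" "S \<noteq> {}"
    and bd: "\<And>z. z \<in> S \<Longrightarrow> \<exists>n::nat. \<forall>j. norm (C j z) * \<delta> ^ j \<le> real n"
  obtains z e and n :: nat where "z \<in> S" "0 < e"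
    "\<And>x j. x \<in> S \<Longrightarrow> dist x z < e \<Longrightarrow> norm (C j x) * \<delta> ^ j \<le> real n"
proof -
  define T where "T n = {z \<in> S. \<forall>j. norm (C j z) * \<delta> ^ j \<le> real n}" for n
  have clT: "closed (T n)" for n
  proof -
    have "T n = (\<Inter>j. {z \<in> S. norm (C j z) * \<delta> ^ j \<le> real n})" by (auto simp: T_def)
    moreover have "closed {z \<in> S. norm (C j z) * \<delta> ^ j \<le> real n}" for j
    proof -
      have "closed (S \<inter> (\<lambda>z. norm (C j z) * \<delta> ^ j) -` {..real n})"
        by (intro continuous_closed_preimage continuous_intros cont S closed_atMost)
      thus ?thesis by (simp add: vimage_def Int_def)
    qed
    ultimately show ?thesis by (simp only:) (intro closed_INT ballI)
  qed
  have "\<exists>n. \<not> S \<subseteq> closure (S - T n)"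
  proof (rule ccontr)
    assume "\<not> ?thesis"
    hence dense: "S \<subseteq> closure (S - T n)" for n by blast
    have cl: "S \<subseteq> closure (\<Inter>(range (\<lambda>n. S - T n)))"
    proof (rule Baire[OF S(1)])
      fix X assume "X \<in> range (\<lambda>n. S - T n)"
      then obtain n where n: "X = S - T n" by blast
      have "openin (top_of_set S) (S - T n)"
        using clT[of n] by (metis Diff_eq openin_open_Int open_Compl)
      thus "openin (top_of_set S) X \<and> S \<subseteq> closure X" using dense n by simp
    qed simp
    have empty: "\<Inter>(range (\<lambda>n. S - T n)) = {}" using bd by (fastforce simp: T_def)
    show False using cl S(2) unfolding empty by simp
  qed
  then obtain n z where z: "z \<in> S" "z \<notin> closure (S - T n)" by blast
  then obtain e where e: "e > 0" "\<forall>x\<in>S - T n. \<not> dist x z < e" unfolding closure_approachable by blast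
  have "norm (C j x) * \<delta> ^ j \<le> real n" if "x \<in> S" "dist x z < e" for x j
    using e(2) that by (auto simp: T_def)
  thus ?thesis using that[OF z(1) e(1)] by blast
qed

section \<open>Rescaling in the last q coordinates\<close>

lemma scaled_line:
  assumes "s \<le> m"
  shows "xp (x + \<tau> *\<^sub>R v s) + t *\<^sub>R xq (x + \<tau> *\<^sub>R v s)
    = (xp x + t *\<^sub>R xq x) + (\<tau> * (if s \<le> p then 1 else t)) *\<^sub>R v s"
  using assms by (simp add: xp_add xq_add xp_scale xq_scale xp_v xq_v algebra_simps)

lemma crd_scaled: "crd s (xp x + t *\<^sub>R xq x) = (if s \<le> p then crd s x else if s \<le> m then t * crd s x else 0)"
  by (simp add: crd_add crd_scale crd_xp crd_xq)

lemma r2_scaled: "r2 (xp x + t *\<^sub>R xq x) = t\<^sup>2 * r2 x"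
  unfolding r2_def sum_distrib_left by (rule sum.cong) (auto simp: crd_scaled power_mult_distrib)

lemma xp_scaled: "xp (xp x + t *\<^sub>R xq x) = xp x"
  unfolding xp_def[of "xp x + _"] crd_scaled unfolding xp_def embv_def by (rule sum.cong) auto

lemma scaled_in_M: "xp x + t *\<^sub>R xq x \<in> M"
  unfolding xp_def xq_def using p_less_m by (intro span_add span_scale embv_in_span) auto

text \<open>After rescaling, the remainder of the series is uniformly small, but nothing is known about its
  derivatives; the Dirac equation therefore enters only through the divergence bound.\<close>

lemma leading_coefficient_contradiction:
  assumes X: "openin (top_of_set M) X" and \<Theta>: "\<And>x. x \<in> X \<Longrightarrow> xp x \<in> \<Theta>"
    and cC: "\<And>j. continuous_on \<Theta> (C j)"
    and sm: "\<And>x. x \<in> X \<Longrightarrow> (\<lambda>j. E j x (C j (xp x))) sums h x"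
    and dc: "\<And>s. s \<le> m \<Longrightarrow> continuous_on X (d s)"
    and hd: "\<And>s x. s \<le> m \<Longrightarrow> x \<in> X \<Longrightarrow> ((\<lambda>t. h (x + t *\<^sub>R v s)) has_vector_derivative d s x) (at 0)"
    and mono: "\<And>x. x \<in> X \<Longrightarrow> (\<Sum>s\<le>m. mul (v s) (d s x)) = 0"
    and low: "\<And>j x. x \<in> X \<Longrightarrow> j < Suc k \<Longrightarrow> C j (xp x) = 0"
    and bd: "0 < \<delta>" "0 \<le> n" "\<And>x j. x \<in> X \<Longrightarrow> norm (C j (xp x)) * \<delta> ^ j \<le> n"
    and r2: "\<And>x. x \<in> X \<Longrightarrow> r2 x < (\<delta> / 2)\<^sup>2"
    and scaled: "\<And>x t. x \<in> X \<Longrightarrow> 0 < t \<Longrightarrow> t \<le> 1 \<Longrightarrow> xp x + t *\<^sub>R xq x \<in> X"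
    and z: "z \<in> X" "0 < r2 z" "C (Suc k) (xp z) \<noteq> 0"
  shows False
proof -
  let ?k = "Suc k"
  obtain N where N: "0 < N" "\<And>k x a. norm (E k x a) \<le> N * sqrt (r2 x) ^ k * norm a"
    "\<And>s a. s \<le> m \<Longrightarrow> norm (mul (v s) a) \<le> N * norm a"
    using E_bounds by metis
  have cCx: "continuous_on X (\<lambda>x. C j (xp x))" for j
    by (rule continuous_on_compose2[OF cC]) (use \<Theta> in \<open>auto intro!: continuous_intros\<close>)
  define L where "L x = E ?k x (C ?k (xp x))" for x
  have cL: "continuous_on X L" unfolding L_def by (rule continuous_on_E[OF cCx])
  have term_le: "norm (E j x (C j (xp x))) \<le> N * n * (1 / 2) ^ j" if x: "x \<in> X" for j x
  proof -
    have "sqrt (r2 x) \<le> \<delta> / 2" using r2[OF x] bd by (intro real_le_lsqrt) auto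
    hence "sqrt (r2 x) ^ j \<le> (\<delta> / 2) ^ j" using r2_nonneg by (intro power_mono) auto
    hence "N * sqrt (r2 x) ^ j * norm (C j (xp x)) \<le> N * (\<delta> / 2) ^ j * norm (C j (xp x))"
      using N by (intro mult_right_mono mult_left_mono) auto
    also have "\<dots> = N * (1 / 2) ^ j * (norm (C j (xp x)) * \<delta> ^ j)" by (simp add: power_divide)
    also have "\<dots> \<le> N * (1 / 2) ^ j * n" using N by (intro mult_left_mono bd x) auto
    finally show ?thesis using N(2)[of j x "C j (xp x)"] by (simp add: mult_ac)
  qed
  have geo: "summable (\<lambda>j. N * n * (1 / 2) ^ j)" "(\<Sum>j. N * n * (1 / 2) ^ j) = 2 * N * n"
    using suminf_mult[OF summable_geometric[of "1 / 2 :: real"], of "N * n"]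
    by (auto simp: suminf_geometric intro!: summable_mult summable_geometric)
  have ch: "continuous_on X h"
  proof -
    have "uniform_limit X (\<lambda>n x. \<Sum>j<n. E j x (C j (xp x))) (\<lambda>x. \<Sum>j. E j x (C j (xp x))) sequentially"
      by (rule Weierstrass_m_test[OF _ geo(1)]) (rule term_le)
    moreover have "continuous_on X (\<lambda>x. \<Sum>j<n. E j x (C j (xp x)))" for n
      by (intro continuous_on_sum continuous_on_E cCx)
    ultimately have "continuous_on X (\<lambda>x. \<Sum>j. E j x (C j (xp x)))"
      by (intro uniform_limit_theorem[OF always_eventually]) auto
    thus ?thesis using sums_unique[OF sm] by (simp cong: continuous_on_cong)
  qed
  \<comment> \<open>Terms below degree k + 1 vanish by \<open>low\<close>, the term of degree k + 1
    gives \<open>L x\<close>, and each higher one retains at least one factor t.\<close>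
  have remainder: "norm ((1 / t ^ ?k) *\<^sub>R h (xp x + t *\<^sub>R xq x) - L x) \<le> t * (2 * N * n)"
    if x: "x \<in> X" and t: "0 < t" "t \<le> 1" for x t
  proof -
    let ?e = "\<lambda>j. E j x (C j (xp x))"
    let ?r = "\<lambda>j. (1 / t ^ ?k) *\<^sub>R (t ^ j *\<^sub>R ?e j) - (if j = ?k then ?e j else 0)"
    have "(\<lambda>j. t ^ j *\<^sub>R ?e j) sums h (xp x + t *\<^sub>R xq x)"
      using sm[OF scaled[OF x t]] by (simp add: xp_scaled E_scale_point)
    moreover have "(\<lambda>j. if j = ?k then ?e j else 0) sums L x" unfolding L_def by (rule sums_single)
    ultimately have rs: "?r sums ((1 / t ^ ?k) *\<^sub>R h (xp x + t *\<^sub>R xq x) - L x)"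
      by (intro sums_diff bounded_linear.sums[OF bounded_linear_scaleR_right])
    have le: "norm (?r j) \<le> t * (N * n * (1 / 2) ^ j)" for j
    proof -
      consider "j < ?k" | "j = ?k" | i where "j = ?k + Suc i"
        by (metis add_Suc_right less_imp_Suc_add linorder_neqE_nat)
      thus ?thesis
      proof cases
        case 1
        thus ?thesis using low[OF x 1] t N bd by (simp add: linear_0[OF E_linear])
      next
        case 2
        thus ?thesis using t N bd by simp
      next
        case 3
        have "?r j = t ^ Suc i *\<^sub>R ?e j" using t by (simp add: 3 power_add)
        moreover have "t ^ Suc i \<le> t" using t by (simp add: mult_le_cancel_left1 power_le_one)
        ultimately have "norm (?r j) \<le> t * norm (?e j)" using t by (simp add: mult_right_mono del: power_Suc)
        also have "\<dots> \<le> t * (N * n * (1 / 2) ^ j)" using t by (intro mult_left_mono term_le x) auto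
        finally show ?thesis .
      qed
    qed
    have "norm (suminf ?r) \<le> (\<Sum>j. t * (N * n * (1 / 2) ^ j))"
      by (rule norm_suminf_le[OF le summable_mult[OF geo(1)]])
    also have "\<dots> = t * (2 * N * n)" using suminf_mult[OF geo(1), of t] geo(2) by simp
    finally show ?thesis using sums_unique[OF rs] by simp
  qed
  \<comment> \<open>Testing against the value at z makes \<Phi> positive near z; c is half of its
    value there, so \<Phi> exceeds c on a whole cube.\<close>
  define w where "w = E k z (C ?k (xp z))"
  have w: "w \<noteq> 0" using z by (simp add: w_def E_eq_0_iff)
  define \<Phi> where "\<Phi> x = w \<bullet> E k x (C ?k (xp x))" for x
  define c where "c = (w \<bullet> w) / 2"
  have c: "0 < c" using w by (simp add: c_def)
  have "continuous_on X \<Phi>" unfolding \<Phi>_def by (intro continuous_intros continuous_on_E cCx)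
  hence "openin (top_of_set X) (X \<inter> \<Phi> -` {c<..})" by (rule continuous_openin_preimage_gen) simp
  hence "openin (top_of_set M) (X \<inter> \<Phi> -` {c<..})" using X by (rule openin_trans)
  moreover have "z \<in> X \<inter> \<Phi> -` {c<..}" using z w by (simp add: \<Phi>_def c_def w_def[symmetric])
  ultimately obtain \<eta> where \<eta>: "0 < \<eta>"
    "\<And>x. x \<in> M \<Longrightarrow> (\<And>s. s \<in> {..m} \<Longrightarrow> \<bar>crd s (x - z)\<bar> \<le> \<eta>) \<Longrightarrow> x \<in> X \<inter> \<Phi> -` {c<..}"
    using box_in_open[OF order.refl] by metis
  define P where "P u = z + embv v {..m} u" for u
  have zM: "z \<in> M" using openin_imp_subset[OF X] z by blast
  have P: "P u \<in> X" "c < \<Phi> (P u)" if "u \<in> cube {..m} \<eta>" for u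
  proof -
    have "P u \<in> X \<inter> \<Phi> -` {c<..}"
    proof (rule \<eta>(2))
      show "P u \<in> M" unfolding P_def by (intro span_add zM embv_in_span) simp
      fix s assume "s \<in> {..m}"
      thus "\<bar>crd s (P u - z)\<bar> \<le> \<eta>" using that by (simp add: P_def crd_embv cube_def)
    qed
    thus "P u \<in> X" "c < \<Phi> (P u)" by auto
  qed
  have P_upd: "P (u(s := \<tau>)) = P u + (\<tau> - u s) *\<^sub>R v s" if "s \<le> m" for u s \<tau>
  proof -
    have "embv v {..m} (u(s := \<tau>)) = (\<Sum>i\<le>m. u i *\<^sub>R v i + (if i = s then (\<tau> - u s) *\<^sub>R v s else 0))"
      unfolding embv_def by (rule sum.cong) (auto simp: scaleR_diff_left)
    thus ?thesis using that by (simp add: P_def sum.distrib embv_def)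
  qed
  have cP: "continuous_on (cube {..m} \<eta>) P"
    unfolding P_def embv_def
    by (intro continuous_intros continuous_on_product_then_coordinatewise continuous_on_id)
  \<comment> \<open>The chain rule gives a factor t in the last q directions and 1 in the others.
    The weight \<open>e\<close> evens this out to t in all directions, so that the Dirac equation
    for h applies. The weight \<open>ep\<close> subtracts the limit \<open>L\<close> only in the
    last q directions; in the others the weight t already makes the field small.\<close>
  define e where "e s t = (if s \<le> p then t else 1 :: real)" for s t
  define ep where "ep s = (if s \<le> p then 0 else 1 :: real)" for s
  define G where "G t s x = w \<bullet> mul (v s) (e s t *\<^sub>R ((1 / t ^ ?k) *\<^sub>R h (xp x + t *\<^sub>R xq x)) - ep s *\<^sub>R L x)" for t s x
  define Gd where "Gd t s x = w \<bullet> mul (v s) ((t / t ^ ?k) *\<^sub>R d s (xp x + t *\<^sub>R xq x) - ep s *\<^sub>R dE s ?k x (C ?k (xp x)))" for t s x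
  have csc: "continuous_on X (\<lambda>x. F (xp x + t *\<^sub>R xq x))" if "continuous_on X F" "0 < t" "t \<le> 1"
    for F :: "'a \<Rightarrow> 'a" and t
    by (rule continuous_on_compose2[OF that(1)]) (use that scaled in \<open>auto intro!: continuous_intros\<close>)
  have cG: "continuous_on X (G t s)" and cGd: "continuous_on X (Gd t s)" if "0 < t" "t \<le> 1" "s \<le> m" for t s
    unfolding G_def Gd_def using that
    by (auto intro!: continuous_intros mul.continuous_on csc ch cL dc continuous_on_dE cCx)
  have GD: "((\<lambda>\<tau>. G t s (x + \<tau> *\<^sub>R v s)) has_vector_derivative Gd t s x) (at 0)"
    if x: "x \<in> X" and t: "0 < t" "t \<le> 1" and s: "s \<le> m" for t s x
  proof -
    let ?y = "xp x + t *\<^sub>R xq x"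
    define \<kappa> where "\<kappa> = (if s \<le> p then 1 else t)"
    have \<kappa>: "e s t * \<kappa> = t" by (simp add: e_def \<kappa>_def)
    have "((\<lambda>\<tau>. \<tau> * \<kappa>) has_vector_derivative \<kappa>) (at 0)" by (auto intro!: derivative_eq_intros)
    moreover have "((\<lambda>\<tau>. h (?y + \<tau> *\<^sub>R v s)) has_vector_derivative d s ?y) (at (0 * \<kappa>))"
      using hd[OF s scaled[OF x t]] by simp
    ultimately have "((\<lambda>\<tau>. h (?y + (\<tau> * \<kappa>) *\<^sub>R v s)) has_vector_derivative \<kappa> *\<^sub>R d s ?y) (at 0)"
      by (rule vector_diff_chain_at[unfolded o_def])
    hence 1: "((\<lambda>\<tau>. h (xp (x + \<tau> *\<^sub>R v s) + t *\<^sub>R xq (x + \<tau> *\<^sub>R v s))) has_vector_derivative \<kappa> *\<^sub>R d s ?y) (at 0)"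
      unfolding scaled_line[OF s] \<kappa>_def .
    have 2: "((\<lambda>\<tau>. ep s *\<^sub>R L (x + \<tau> *\<^sub>R v s)) has_vector_derivative ep s *\<^sub>R dE s ?k x (C ?k (xp x))) (at 0)"
    proof (cases "s \<le> p")
      case False
      hence sI: "s \<in> {p+1..m}" using s by auto
      have "((\<lambda>\<tau>. E ?k (x + \<tau> *\<^sub>R v s) (C ?k (xp x))) has_vector_derivative dE s ?k (x + 0 *\<^sub>R v s) (C ?k (xp x))) (at 0)"
        by (rule E_line_q_deriv[OF sI])
      thus ?thesis using False s by (simp add: ep_def L_def xp_add xp_scale xp_v)
    qed (simp add: ep_def)
    have "((\<lambda>\<tau>. e s t *\<^sub>R ((1 / t ^ ?k) *\<^sub>R h (xp (x + \<tau> *\<^sub>R v s) + t *\<^sub>R xq (x + \<tau> *\<^sub>R v s))) - ep s *\<^sub>R L (x + \<tau> *\<^sub>R v s))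
       has_vector_derivative e s t *\<^sub>R ((1 / t ^ ?k) *\<^sub>R (\<kappa> *\<^sub>R d s ?y)) - ep s *\<^sub>R dE s ?k x (C ?k (xp x))) (at 0)"
      by (rule has_vector_derivative_diff[OF bounded_linear.has_vector_derivative[OF bounded_linear_scaleR_right
            bounded_linear.has_vector_derivative[OF bounded_linear_scaleR_right 1]] 2])
    moreover have "e s t *\<^sub>R ((1 / t ^ ?k) *\<^sub>R (\<kappa> *\<^sub>R d s ?y)) = (t / t ^ ?k) *\<^sub>R d s ?y"
    proof -
      have "e s t * (1 / t ^ ?k * \<kappa>) = (e s t * \<kappa>) / t ^ ?k" by simp
      thus ?thesis unfolding \<kappa> by (simp only: scaleR_scaleR)
    qed
    ultimately have 3: "((\<lambda>\<tau>. e s t *\<^sub>R ((1 / t ^ ?k) *\<^sub>R h (xp (x + \<tau> *\<^sub>R v s) + t *\<^sub>R xq (x + \<tau> *\<^sub>R v s))) - ep s *\<^sub>R L (x + \<tau> *\<^sub>R v s))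
       has_vector_derivative (t / t ^ ?k) *\<^sub>R d s ?y - ep s *\<^sub>R dE s ?k x (C ?k (xp x))) (at 0)" by (simp only:)
    show ?thesis unfolding G_def Gd_def
      by (rule bounded_linear.has_vector_derivative[OF bounded_linear_inner_right
            bounded_linear.has_vector_derivative[OF mul.bounded_linear_right 3]])
  qed
  \<comment> \<open>The part coming from h drops out by the Dirac equation. What remains is minus
    the Dirac derivative of \<open>L\<close>, that is \<gamma> k times the power of degree k, whose
    product with w is \<Phi>.\<close>
  have div: "c \<le> (\<Sum>s\<le>m. Gd t s x)" if x: "x \<in> X" "c < \<Phi> x" and t: "0 < t" "t \<le> 1" for t x
  proof -
    let ?y = "xp x + t *\<^sub>R xq x"
    have "(\<Sum>s\<le>m. mul (v s) (ep s *\<^sub>R dE s ?k x (C ?k (xp x)))) = (- \<gamma> k) *\<^sub>R E k x (C ?k (xp x))"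
      unfolding dirac_q_E[symmetric] atMost_m(1) by (subst sum.union_disjoint) (auto simp: ep_def mul.zero_right)
    moreover have "(\<Sum>s\<le>m. mul (v s) ((t / t ^ ?k) *\<^sub>R d s ?y)) = (t / t ^ ?k) *\<^sub>R (\<Sum>s\<le>m. mul (v s) (d s ?y))"
      by (simp add: mul.scaleR_right scaleR_sum_right)
    ultimately have "(\<Sum>s\<le>m. Gd t s x) = w \<bullet> (\<gamma> k *\<^sub>R E k x (C ?k (xp x)))"
      using mono[OF scaled[OF x(1) t]]
      by (simp add: Gd_def inner_sum_right[symmetric] mul.diff_right sum_subtractf)
    also have "\<dots> = \<gamma> k * \<Phi> x" by (simp add: \<Phi>_def)
    also have "\<dots> \<ge> 1 * c" using \<gamma>_ge[of k] x(2) c by (intro mult_mono) auto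
    finally show ?thesis by simp
  qed
  \<comment> \<open>\<open>2 * N * n\<close> bounds the remainder and \<open>N * n\<close> bounds
    \<open>L\<close>; norm w and N come from the inner product and the left multiplication.\<close>
  define Q where "Q = norm w * N * (3 * N * n)"
  have Q: "0 \<le> Q" using N bd by (simp add: Q_def)
  have small: "\<bar>G t s x\<bar> \<le> t * Q" if x: "x \<in> X" and t: "0 < t" "t \<le> 1" and s: "s \<le> m" for t s x
  proof -
    let ?H = "(1 / t ^ ?k) *\<^sub>R h (xp x + t *\<^sub>R xq x)"
    have Lb: "norm (L x) \<le> N * n"
    proof -
      have "norm (L x) \<le> N * n * (1 / 2) ^ ?k" unfolding L_def by (rule term_le[OF x])
      also have "\<dots> \<le> N * n * 1" using N bd by (intro mult_left_mono power_le_one) auto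
      finally show ?thesis by simp
    qed
    have R: "norm (?H - L x) \<le> t * (2 * N * n)" by (rule remainder[OF x t])
    have "norm (e s t *\<^sub>R ?H - ep s *\<^sub>R L x) \<le> t * (3 * N * n)"
    proof (cases "s \<le> p")
      case True
      have "norm ?H \<le> norm (?H - L x) + norm (L x)" using norm_triangle_ineq[of "?H - L x" "L x"] by simp
      also have "\<dots> \<le> 1 * (2 * N * n) + N * n"
        using t N bd by (intro add_mono order_trans[OF R] mult_right_mono Lb) auto
      finally have "t * norm ?H \<le> t * (3 * N * n)" using t by (intro mult_left_mono) auto
      thus ?thesis using True t by (simp add: e_def ep_def)
    next
      case False
      have "t * (2 * N * n) \<le> t * (3 * N * n)" using t N bd by (intro mult_left_mono mult_right_mono) auto
      from order_trans[OF R this] show ?thesis using False by (simp add: e_def ep_def)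
    qed
    hence "N * norm (e s t *\<^sub>R ?H - ep s *\<^sub>R L x) \<le> N * (t * (3 * N * n))" using N by (intro mult_left_mono) auto
    hence "norm (mul (v s) (e s t *\<^sub>R ?H - ep s *\<^sub>R L x)) \<le> N * (t * (3 * N * n))"
      by (rule order_trans[OF N(3)[OF s]])
    hence "norm w * norm (mul (v s) (e s t *\<^sub>R ?H - ep s *\<^sub>R L x)) \<le> norm w * (N * (t * (3 * N * n)))"
      by (rule mult_left_mono) simp
    from order_trans[OF Cauchy_Schwarz_ineq2 this] show ?thesis by (simp add: G_def Q_def mult_ac)
  qed
  have bound: "c * \<eta> \<le> 2 * real (Suc m) * (t * Q)" if t: "0 < t" "t \<le> 1" for t
  proof -
    have "c * \<eta> \<le> 2 * real (card {..m}) * (t * Q)"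
    proof (rule divergence_cube_bound[where g = "\<lambda>s u. G t s (P u)" and d = "\<lambda>s u. Gd t s (P u)"])
      fix s assume "s \<in> {..m}"
      hence s: "s \<le> m" by simp
      show "continuous_on (cube {..m} \<eta>) (\<lambda>u. G t s (P u))" "continuous_on (cube {..m} \<eta>) (\<lambda>u. Gd t s (P u))"
        using P(1) by (auto intro!: continuous_on_compose2[OF cG[OF t s] cP] continuous_on_compose2[OF cGd[OF t s] cP])
      fix u assume u: "u \<in> cube {..m} \<eta>"
      show "\<bar>G t s (P u)\<bar> \<le> t * Q" by (rule small[OF P(1)[OF u] t s])
      have "((\<lambda>\<tau>. \<tau> - u s) has_vector_derivative 1) (at (u s))" by (auto intro!: derivative_eq_intros)
      moreover have "((\<lambda>\<tau>. G t s (P u + \<tau> *\<^sub>R v s)) has_vector_derivative Gd t s (P u)) (at (u s - u s))"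
        using GD[OF P(1)[OF u] t s] by simp
      ultimately have "((\<lambda>\<tau>. G t s (P u + (\<tau> - u s) *\<^sub>R v s)) has_vector_derivative 1 *\<^sub>R Gd t s (P u)) (at (u s))"
        by (rule vector_diff_chain_at[unfolded o_def])
      thus "((\<lambda>\<tau>. G t s (P (u(s := \<tau>)))) has_real_derivative Gd t s (P u)) (at (u s) within {0..\<eta>})"
        unfolding P_upd[OF s] has_real_derivative_iff_has_vector_derivative
        by (simp add: has_vector_derivative_at_within)
    next
      fix u assume "u \<in> cube {..m} \<eta>"
      thus "c \<le> (\<Sum>s\<in>{..m}. Gd t s (P u))" by (intro div P t)
    qed (use \<eta> in auto)
    thus ?thesis by simp
  qed
  define Z where "Z = 2 * real (Suc m) * Q + 1"
  have Z: "0 < Z" using Q unfolding Z_def by (intro add_nonneg_pos) auto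
  \<comment> \<open>Small enough that the flux bound is at most half of c \<eta>; the 1 added in
    \<open>Z\<close> keeps the denominator positive.\<close>
  define t where "t = min 1 (c * \<eta> / (2 * Z))"
  have t: "0 < t" "t \<le> 1" using c \<eta> Z by (auto simp: t_def)
  have "2 * real (Suc m) * (t * Q) \<le> t * Z" using t by (simp add: Z_def algebra_simps)
  also have "\<dots> \<le> c * \<eta> / (2 * Z) * Z" using Z by (intro mult_right_mono) (auto simp: t_def)
  also have "\<dots> = c * \<eta> / 2" using Z by simp
  also have "\<dots> < c * \<eta>" using c \<eta> by simp
  finally show False using bound[OF t] by simp
qed

lemma xp_star_set:
  assumes "domain_in (span (v ` {..p})) \<Omega>0" "z \<in> star_set v p m \<Omega>0"
  shows "xp z \<in> \<Omega>0"
proof -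
  obtain a b where ab: "z = a + b" "a \<in> \<Omega>0" "b \<in> span (v ` {p+1..m})"
    using assms(2) by (auto simp: star_set_def)
  have b: "b = embv v {p+1..m} (\<lambda>s. crd s b)" by (rule span_embv[OF ab(3)]) auto
  have "crd s b = 0" if "s \<le> p" for s
    using crd_embv[of "{p+1..m}" s "\<lambda>s. crd s b"] that unfolding b[symmetric] by auto
  hence "xp b = 0" by (simp add: xp_def embv_def)
  thus ?thesis using ab domain_in_subset[OF assms(1)] xp_id by (auto simp: xp_add)
qed

lemma ck_unique:
  assumes dom: "domain_in (span (v ` {..p})) \<Omega>0"
    and anA: "\<And>k. real_analytic_on_v v p (A k) \<Omega>0" and anB: "\<And>k. real_analytic_on_v v p (B k) \<Omega>0"
    and init: "\<And>x. x \<in> \<Omega>0 \<Longrightarrow> A 0 x = B 0 x"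
    and ckA: "CK_extension mul one v p m \<Omega>0 A \<Omega> f" and ckB: "CK_extension mul one v p m \<Omega>0 B \<Omega>' g"
    and x: "x \<in> \<Omega>0"
  shows "A k x = B k x"
proof (rule ccontr)
  assume neq: "A k x \<noteq> B k x"
  define C where "C j z = A j z - B j z" for j z
  define k0 where "k0 = (LEAST j. \<exists>z\<in>\<Omega>0. C j z \<noteq> 0)"
  have "\<exists>z\<in>\<Omega>0. C k z \<noteq> 0" using neq x by (auto simp: C_def)
  hence "\<exists>z\<in>\<Omega>0. C k0 z \<noteq> 0" unfolding k0_def by (rule LeastI)
  then obtain y where y: "y \<in> \<Omega>0" "C k0 y \<noteq> 0" by blast
  have low: "C j z = 0" if "j < k0" "z \<in> \<Omega>0" for j z
    using not_less_Least[of j "\<lambda>j. \<exists>z\<in>\<Omega>0. C j z \<noteq> 0"] that unfolding k0_def by blast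
  \<comment> \<open>The common initial function excludes k0 = 0, so there is a degree below k0 for
    the Dirac operator to produce.\<close>
  have "C 0 y = 0" using y init by (simp add: C_def)
  hence "k0 \<noteq> 0" using y(2) by metis
  then obtain k' where k': "k0 = Suc k'" by (cases k0) auto
  have sub: "\<Omega>0 \<subseteq> span (v ` {..p})" by (rule domain_in_subset[OF dom])
  have ysp: "y \<in> span (v ` {..p})" using sub y by blast
  have cC: "continuous_on \<Omega>0 (C j)" for j
    unfolding C_def by (intro continuous_on_diff real_analytic_continuous[OF dom] anA anB)
  \<comment> \<open>The two extensions may have different domains; their intersection is still
    relatively open and contains \<open>\<Omega>0\<close>.\<close>
  define X0 where "X0 = \<Omega> \<inter> \<Omega>'"
  have opA: "openin (top_of_set M) \<Omega>" and opB: "openin (top_of_set M) \<Omega>'"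
    using ckA ckB by (auto simp: CK_extension_def slice_domain_def domain_in_def)
  have op0: "openin (top_of_set M) X0" unfolding X0_def by (rule openin_Int[OF opA opB])
  have \<Omega>0X: "\<Omega>0 \<subseteq> X0" using ckA ckB by (auto simp: X0_def CK_extension_def)
  have X0M: "X0 \<subseteq> M" by (rule openin_imp_subset[OF op0])
  have xp0: "xp z \<in> \<Omega>0" if "z \<in> X0" for z
    by (rule xp_star_set[OF dom]) (use ckA that in \<open>auto simp: X0_def CK_extension_def\<close>)
  define h where "h z = f z - g z" for z
  define d where "d s z = pderiv_v v s f z - pderiv_v v s g z" for s z
  have ser: "(\<lambda>j. E j z (F j (xp z))) sums \<phi> z"
    if "CK_extension mul one v p m \<Omega>0 F W \<phi>" "z \<in> W" for F W \<phi> z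
  proof -
    have "z \<in> M" using that by (auto simp: CK_extension_def slice_domain_def domain_in_def dest: openin_imp_subset)
    hence "z = embv v {..m} (\<lambda>s. crd s z)" by (rule span_embv) simp
    hence "(\<lambda>j. mul (powA mul one (embv v {p+1..m} (\<lambda>s. crd s z)) j) (F j (embv v {..p} (\<lambda>s. crd s z)))) sums \<phi> z"
      using that unfolding CK_extension_def by metis
    thus ?thesis unfolding xq_def[symmetric] xp_def[symmetric] powA_xq .
  qed
  have sm: "(\<lambda>j. E j z (C j (xp z))) sums h z" if "z \<in> X0" for z
    unfolding C_def h_def linear_diff[OF E_linear] using that
    by (intro sums_diff ser[OF ckA] ser[OF ckB]) (auto simp: X0_def)
  have der: "((\<lambda>t. \<phi> (z + t *\<^sub>R v s)) has_vector_derivative pderiv_v v s \<phi> z) (at 0)"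
    and derc: "continuous_on W (pderiv_v v s \<phi>)"
    if "CK_extension mul one v p m \<Omega>0 F W \<phi>" "s \<le> m" "z \<in> W" for F W \<phi> z s
    using that unfolding CK_extension_def monogenic_on_def C1_on_def pderiv_v_def
    by (auto simp: vector_derivative_works)
  have hd: "((\<lambda>t. h (z + t *\<^sub>R v s)) has_vector_derivative d s z) (at 0)" if "s \<le> m" "z \<in> X0" for s z
    unfolding h_def d_def using that
    by (intro has_vector_derivative_diff der[OF ckA] der[OF ckB]) (auto simp: X0_def)
  have dc: "continuous_on X0 (d s)" if "s \<le> m" for s
    unfolding d_def using that \<Omega>0X x
    by (intro continuous_on_diff continuous_on_subset[OF derc[OF ckA]] continuous_on_subset[OF derc[OF ckB]])
       (auto simp: X0_def)
  have mono: "(\<Sum>s\<le>m. mul (v s) (d s z)) = 0" if "z \<in> X0" for z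
    using ckA ckB that unfolding CK_extension_def monogenic_on_def d_def
    by (auto simp: mul.diff_right sum_subtractf X0_def)
  \<comment> \<open>The position of the ball supplied by Baire's theorem cannot be prescribed, so
    the region is first shrunk until C k0 vanishes nowhere on it.\<close>
  have "continuous_on X0 (\<lambda>z. C k0 (xp z))"
    by (rule continuous_on_compose2[OF cC]) (use xp0 in \<open>auto intro!: continuous_intros\<close>)
  hence "openin (top_of_set X0) (X0 \<inter> (\<lambda>z. C k0 (xp z)) -` (- {0}))"
    by (rule continuous_openin_preimage_gen) auto
  hence "openin (top_of_set M) (X0 \<inter> (\<lambda>z. C k0 (xp z)) -` (- {0}))" using op0 by (rule openin_trans)
  moreover have "y \<in> X0 \<inter> (\<lambda>z. C k0 (xp z)) -` (- {0})" using y \<Omega>0X by (auto simp: xp_id[OF ysp])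
  ultimately obtain \<delta> where \<delta>: "0 < \<delta>"
    "\<And>z. z \<in> M \<Longrightarrow> (\<And>s. s \<in> {..m} \<Longrightarrow> \<bar>crd s (z - y)\<bar> \<le> \<delta>) \<Longrightarrow> z \<in> X0 \<inter> (\<lambda>z. C k0 (xp z)) -` (- {0})"
    using box_in_open[OF order.refl] by metis
  have crdy: "crd s y = 0" if "p < s" for s using crd_xp[of s y] that by (simp add: xp_id[OF ysp])
  have inX0: "z \<in> X0" "C k0 (xp z) \<noteq> 0"
    if "z \<in> M" "\<And>s. s \<le> p \<Longrightarrow> \<bar>crd s (z - y)\<bar> \<le> \<delta>" "r2 z \<le> \<delta>\<^sup>2" for z
  proof -
    have "\<bar>crd s (z - y)\<bar> \<le> \<delta>" if "s \<in> {..m}" for s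
    proof (cases "s \<le> p")
      case False
      hence "\<bar>crd s (z - y)\<bar> \<le> sqrt (r2 z)" using crd_le_r2[of s z] that by (simp add: crd_diff crdy)
      also have "\<dots> \<le> \<delta>" using \<open>r2 z \<le> \<delta>\<^sup>2\<close> \<delta>(1) by (intro real_le_lsqrt) auto
      finally show ?thesis .
    qed (use \<open>\<And>s. s \<le> p \<Longrightarrow> \<bar>crd s (z - y)\<bar> \<le> \<delta>\<close> in auto)
    from \<delta>(2)[OF \<open>z \<in> M\<close> this] show "z \<in> X0" "C k0 (xp z) \<noteq> 0" by auto
  qed
  define S where "S = {z \<in> span (v ` {..p}). \<forall>s\<in>{..p}. \<bar>crd s (z - y)\<bar> \<le> \<delta>}"
  have Ssub: "z \<in> span (v ` {..p})" "z \<in> X0" "z \<in> \<Omega>0" "C k0 z \<noteq> 0" if "z \<in> S" for z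
  proof -
    show sp: "z \<in> span (v ` {..p})" using that by (simp add: S_def)
    hence "z \<in> X0" "C k0 (xp z) \<noteq> 0"
      using inX0[of z] that span_p_subset_M r2_span_p[OF sp] by (auto simp: S_def)
    thus "z \<in> X0" "z \<in> \<Omega>0" "C k0 z \<noteq> 0" using xp0[of z] by (auto simp: xp_id[OF sp])
  qed
  have clS: "closed S"
  proof -
    have "S = span (v ` {..p}) \<inter> (\<Inter>s\<in>{..p}. {z. \<bar>crd s (z - y)\<bar> \<le> \<delta>})" by (auto simp: S_def)
    moreover have "closed \<dots>"
      by (intro closed_Int closed_INT ballI closed_span closed_Collect_le continuous_intros)
    ultimately show ?thesis by simp
  qed
  have yS: "y \<in> S" using ysp \<delta> by (simp add: S_def crd_0)
  obtain N where N: "0 < N" "\<And>k x a. norm (E k x a) \<le> N * sqrt (r2 x) ^ k * norm a"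
    using E_bounds by metis
  obtain z0 e and n :: nat where z0: "z0 \<in> S" "0 < e"
    "\<And>z j. z \<in> S \<Longrightarrow> dist z z0 < e \<Longrightarrow> norm (C j z) * \<delta> ^ j \<le> real n"
  proof (rule baire_uniform_bound[where S = S and C = C and \<delta> = \<delta>])
    show "continuous_on S (C j)" for j by (rule continuous_on_subset[OF cC]) (use Ssub in auto)
    fix z assume z: "z \<in> S"
    \<comment> \<open>Here |x_q| = \<delta>. Convergence at this single point bounds the terms, and
      \<open>E_lower_bound\<close> turns that into a bound for all coefficients at z.\<close>
    let ?x = "z + \<delta> *\<^sub>R v m"
    have cz: "crd s z = 0" if "p < s" for s using crd_xp[of s z] that by (simp add: xp_id[OF Ssub(1)[OF z]])
    have mI: "m \<in> {p+1..m}" using p_less_m by auto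
    have r: "r2 ?x = \<delta>\<^sup>2" using r2_line_q[OF mI, of z \<delta>] r2_span_p[OF Ssub(1)[OF z]] cz[of m] p_less_m by simp
    have xpx: "xp ?x = z" using p_less_m by (simp add: xp_add xp_scale xp_v xp_id[OF Ssub(1)[OF z]])
    have "?x \<in> M"
      using Ssub(1)[OF z] span_p_subset_M by (intro span_add span_scale) (auto intro: span_base)
    moreover have "\<bar>crd s (?x - y)\<bar> \<le> \<delta>" if "s \<le> p" for s
      using z that p_less_m by (simp add: S_def crd_diff crd_add crd_scale crd_v)
    ultimately have "?x \<in> X0" using inX0[of ?x] r by simp
    from sm[OF this] have "(\<lambda>j. E j ?x (C j z)) \<longlonglongrightarrow> 0"
      unfolding xpx by (intro summable_LIMSEQ_zero sums_summable)
    hence "Bseq (\<lambda>j. E j ?x (C j z))" by (intro convergent_imp_Bseq convergentI)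
    then obtain K where K: "\<And>j. norm (E j ?x (C j z)) \<le> K" by (auto simp: Bseq_def)
    obtain n :: nat where n: "N * K \<le> real n" using real_arch_simple by blast
    have "norm (C j z) * \<delta> ^ j \<le> real n" for j
    proof -
      have "norm (C j z) * sqrt (r2 ?x) ^ j \<le> N * norm (E j ?x (C j z))"
        by (rule E_lower_bound[OF N(2)]) (use r \<delta> in simp)
      also have "\<dots> \<le> N * K" using N(1) K by (intro mult_left_mono) auto
      finally show ?thesis using n r \<delta>(1) by simp
    qed
    thus "\<exists>n::nat. \<forall>j. norm (C j z) * \<delta> ^ j \<le> real n" by blast
  qed (use clS yS \<delta> in auto)
  define W where "W = norm (y - z0) + 1"
  \<comment> \<open>The centre z0 may lie on the boundary of the box \<open>S\<close>. A short move
    towards y reaches its interior and stays in the ball.\<close>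
  define \<theta> where "\<theta> = min 1 (e / (2 * W))"
  have npos: "0 < W" unfolding W_def by (intro add_nonneg_pos) auto
  have \<theta>: "0 < \<theta>" "\<theta> \<le> 1" using z0(2) npos by (auto simp: \<theta>_def)
  define z1 where "z1 = z0 + \<theta> *\<^sub>R (y - z0)"
  have d1: "dist z1 z0 < e"
  proof -
    have "\<theta> * norm (y - z0) \<le> \<theta> * W" using \<theta> by (intro mult_left_mono) (auto simp: W_def)
    also have "\<dots> \<le> e / (2 * W) * W"
      using npos by (intro mult_right_mono) (auto simp: \<theta>_def)
    also have "\<dots> = e / 2" using npos by simp
    also have "\<dots> < e" using z0 by simp
    finally show ?thesis using \<theta> by (simp add: z1_def dist_norm)
  qed
  have z1sp: "z1 \<in> span (v ` {..p})"
    unfolding z1_def using Ssub(1)[OF z0(1)] ysp by (intro span_add span_scale span_diff)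
  have c1: "\<bar>crd s (z1 - y)\<bar> < \<delta>" if "s \<le> p" for s
  proof -
    have "z1 - y = (1 - \<theta>) *\<^sub>R (z0 - y)" by (simp add: z1_def algebra_simps)
    hence "\<bar>crd s (z1 - y)\<bar> = (1 - \<theta>) * \<bar>crd s (z0 - y)\<bar>" using \<theta> by (simp add: crd_scale abs_mult)
    also have "\<dots> \<le> (1 - \<theta>) * \<delta>" using z0(1) that \<theta> by (intro mult_left_mono) (auto simp: S_def)
    also have "\<dots> < \<delta>" using \<theta> \<delta> by simp
    finally show ?thesis .
  qed
  let ?U = "(\<Inter>s\<in>{..p}. {z. \<bar>crd s (z - y)\<bar> < \<delta>}) \<inter> {z. dist z z0 < e}"
  have "open ?U" by (intro open_Int open_INT open_Collect_less continuous_intros ballI) auto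
  hence "openin (top_of_set (span (v ` {..p}))) (span (v ` {..p}) \<inter> ?U)" by (rule openin_open_Int)
  moreover have "z1 \<in> span (v ` {..p}) \<inter> ?U" using z1sp c1 d1 by auto
  moreover have "{..p} \<subseteq> {..m}" using p_less_m by auto
  ultimately obtain \<eta> where \<eta>: "0 < \<eta>"
    "\<And>z. z \<in> span (v ` {..p}) \<Longrightarrow> (\<And>s. s \<in> {..p} \<Longrightarrow> \<bar>crd s (z - z1)\<bar> \<le> \<eta>) \<Longrightarrow> z \<in> span (v ` {..p}) \<inter> ?U"
    using box_in_open[of "{..p}" "span (v ` {..p}) \<inter> ?U" z1] by metis
  \<comment> \<open>The bound \<eta> keeps the piece over the region with uniform bounds, and
    \<delta> / 2 gives the series the ratio 1 / 2.\<close>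
  define \<mu> where "\<mu> = min \<eta> (\<delta> / 2)"
  have \<mu>: "0 < \<mu>" "\<mu> \<le> \<eta>" "\<mu> \<le> \<delta> / 2" using \<eta> \<delta> by (auto simp: \<mu>_def)
  let ?X = "piece z1 \<mu>"
  have XU: "xp z \<in> ?U" if "z \<in> ?X" for z
  proof -
    have "\<bar>crd s (xp z - z1)\<bar> \<le> \<eta>" if "s \<in> {..p}" for s
      using \<open>z \<in> ?X\<close> that \<mu> by (force simp: piece_def crd_diff crd_xp)
    from \<eta>(2)[OF xp_in_span this] show ?thesis by blast
  qed
  have XS: "xp z \<in> S" if "z \<in> ?X" for z
    using XU[OF that] by (auto simp: S_def xp_in_span intro: less_imp_le)
  have Xr: "r2 z < (\<delta> / 2)\<^sup>2" if "z \<in> ?X" for z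
  proof -
    have "r2 z < \<mu>\<^sup>2" using that by (simp add: piece_def)
    also have "\<dots> \<le> (\<delta> / 2)\<^sup>2" using \<mu> by (intro power_mono) auto
    finally show ?thesis .
  qed
  have XX0: "?X \<subseteq> X0"
  proof
    fix z assume z: "z \<in> ?X"
    show "z \<in> X0"
    proof (rule inX0(1))
      show "z \<in> M" using z by (simp add: piece_def)
      show "\<bar>crd s (z - y)\<bar> \<le> \<delta>" if "s \<le> p" for s
        using XS[OF z] that by (auto simp: S_def crd_diff crd_xp)
      have "r2 z \<le> (\<delta> / 2)\<^sup>2" using Xr[OF z] by simp
      also have "\<dots> \<le> \<delta>\<^sup>2" using \<delta> by (intro power_mono) auto
      finally show "r2 z \<le> \<delta>\<^sup>2" .
    qed
  qed
  \<comment> \<open>A point with r > 0, where multiplication by a power of x_q is injective.\<close>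
  define x0 where "x0 = z1 + (\<mu> / 2) *\<^sub>R v m"
  have mI: "m \<in> {p+1..m}" using p_less_m by auto
  have r0: "r2 x0 = (\<mu> / 2)\<^sup>2"
    using r2_line_q[OF mI, of z1 "\<mu> / 2"] r2_span_p[OF z1sp] crd_xp[of m z1] xp_id[OF z1sp] p_less_m
    by (simp add: x0_def)
  have xp_x0: "xp x0 = z1" using p_less_m by (simp add: x0_def xp_add xp_scale xp_v xp_id[OF z1sp])
  have x0X: "x0 \<in> ?X"
  proof -
    have "x0 \<in> M" unfolding x0_def
      using z1sp span_p_subset_M by (intro span_add span_scale) (auto intro: span_base)
    moreover have "\<bar>crd s (x0 - z1)\<bar> < \<mu>" if "s \<le> p" for s
      using that p_less_m \<mu> by (simp add: x0_def crd_scale crd_v)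
    moreover have "(\<mu> / 2)\<^sup>2 < \<mu>\<^sup>2" using \<mu> by (intro power_strict_mono) auto
    ultimately show ?thesis by (simp add: piece_def r0)
  qed
  show False
  proof (rule leading_coefficient_contradiction[where X = ?X and \<Theta> = \<Omega>0 and C = C and h = h and d = d
        and k = k' and \<delta> = \<delta> and n = "real n" and z = x0])
    show "openin (top_of_set M) ?X" using piece_open[of z1 \<mu>] by (metis openin_open_Int)
    show "continuous_on ?X (d s)" if "s \<le> m" for s by (rule continuous_on_subset[OF dc[OF that] XX0])
    show "C j (xp z) = 0" if "z \<in> ?X" "j < Suc k'" for j z
      using low[of j "xp z"] that XX0 xp0 k' by auto
    show "norm (C j (xp z)) * \<delta> ^ j \<le> real n" if "z \<in> ?X" for z j
      using z0(3)[OF XS[OF that]] XU[OF that] by blast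
    show "xp z + t *\<^sub>R xq z \<in> ?X" if z: "z \<in> ?X" and t: "0 < t" "t \<le> 1" for z t
    proof -
      have "t\<^sup>2 * r2 z \<le> 1 * r2 z" using t r2_nonneg by (intro mult_right_mono power_le_one) auto
      also have "\<dots> < \<mu>\<^sup>2" using z by (simp add: piece_def)
      finally show ?thesis using z by (auto simp: piece_def r2_scaled scaled_in_M crd_diff crd_scaled)
    qed
    show "C (Suc k') (xp x0) \<noteq> 0" using Ssub(4)[OF XS[OF x0X]] k' by simp
    show "0 < r2 x0" using \<mu> by (simp add: r0)
  qed (use XX0 xp0 cC sm hd mono \<delta> Xr x0X in auto)
qed

section \<open>The Bessel form\<close>

lemma lap_coeff_funpow_scale: "(lap_coeff ^^ l) (\<lambda>\<alpha>. c *\<^sub>R b \<alpha>) = (\<lambda>\<alpha>. c *\<^sub>R (lap_coeff ^^ l) b \<alpha>)"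
  by (induction l) (simp_all add: lap_coeff_scale)

lemma D_p_eq_dirac: "D_p mul v p f = (\<lambda>x. 1 *\<^sub>R dirac 0 (\<lambda>s. pderiv_v v s f x))"
  by (simp add: D_p_def dirac_def \<sigma>_def)

text \<open>Transfers the coefficient identities to functions by expanding around x itself and
  reading off the values at the centre.\<close>

lemma ck_fun_laplace:
  assumes dom: "domain_in (span (v ` {..p})) \<Omega>0" and an: "real_analytic_on_v v p A0 \<Omega>0" and x: "x \<in> \<Omega>0"
  shows "ck_fun A0 (2 * l) x = (\<Prod>j<l. 1 / (\<gamma> (2 * j) * \<gamma> (2 * j + 1))) *\<^sub>R (lap_p v p ^^ l) A0 x"
    and "ck_fun A0 (2 * l + 1) x =
      ((\<Prod>j<l. 1 / (\<gamma> (2 * j + 1) * \<gamma> (2 * j + 2))) / \<gamma> 0) *\<^sub>R (lap_p v p ^^ l) (D_p mul v p A0) x"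
proof -
  obtain \<rho> a where \<rho>: "0 < \<rho>" and ls: "local_series x \<rho> A0 a"
    using real_analytic_local_series[OF dom an x] by metis
  have at: "f x = mseries p b (\<lambda>_. 0)" if "local_series x \<rho> f b" for f b
    using local_seriesD[OF that, of "\<lambda>_. 0"] \<rho> by (simp add: embv_def)
  show "ck_fun A0 (2 * l) x = (\<Prod>j<l. 1 / (\<gamma> (2 * j) * \<gamma> (2 * j + 1))) *\<^sub>R (lap_p v p ^^ l) A0 x"
    using at[OF local_series_ck_fun[OF ls, of "2 * l"]] at[OF local_series_lap[OF ls, of l]]
      ck_coeff_lap[of a l 0] by (simp add: mseries_scale)
  let ?b = "\<lambda>\<alpha>. dirac 0 (\<lambda>s. mshift s a \<alpha>)"
  have "local_series x \<rho> (D_p mul v p A0) (\<lambda>\<alpha>. 1 *\<^sub>R ?b \<alpha>)"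
    unfolding D_p_eq_dirac by (intro local_series_dirac local_series_pderiv ls)
  hence D: "local_series x \<rho> (D_p mul v p A0) ?b" by simp
  have c1: "ck_coeff a 1 = (\<lambda>\<alpha>. (1 / \<gamma> 0) *\<^sub>R ?b \<alpha>)" by simp
  have "ck_fun A0 (2 * l + 1) x = mseries p (ck_coeff a (2 * l + 1)) (\<lambda>_. 0)"
    by (rule at[OF local_series_ck_fun[OF ls]])
  also have "\<dots> = ((\<Prod>j<l. 1 / (\<gamma> (2 * j + 1) * \<gamma> (2 * j + 2))) / \<gamma> 0) *\<^sub>R mseries p ((lap_coeff ^^ l) ?b) (\<lambda>_. 0)"
    unfolding ck_coeff_lap c1 lap_coeff_funpow_scale mseries_scale by simp
  also have "mseries p ((lap_coeff ^^ l) ?b) (\<lambda>_. 0) = (lap_p v p ^^ l) (D_p mul v p A0) x"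
    by (rule at[OF local_series_lap[OF D], symmetric])
  finally show "ck_fun A0 (2 * l + 1) x =
      ((\<Prod>j<l. 1 / (\<gamma> (2 * j + 1) * \<gamma> (2 * j + 2))) / \<gamma> 0) *\<^sub>R (lap_p v p ^^ l) (D_p mul v p A0) x" .
qed

text \<open>Each pair multiplies to 4 (j + 1) (q/2 + j), or to 4 (j + 1) (q/2 + j + 1) in the odd
  branch, so the products are factorials and rising factorials, which the recursion of Gamma
  expresses as quotients.\<close>

lemma gamma_products:
  defines "q \<equiv> real (m - p)"
  shows "(\<Prod>j<l. 1 / (\<gamma> (2 * j) * \<gamma> (2 * j + 1))) = Gamma (q / 2) / (4 ^ l * fact l * Gamma (q / 2 + real l))"
    and "(\<Prod>j<l. 1 / (\<gamma> (2 * j + 1) * \<gamma> (2 * j + 2))) / \<gamma> 0 = Gamma (q / 2) / (2 * (4 ^ l * fact l * Gamma (q / 2 + real l + 1)))"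
proof -
  have q: "0 < q" using p_less_m by (simp add: q_def)
  have pos: "0 < Gamma (q / 2 + real i)" for i using q by (intro Gamma_real_pos) simp
  have rec: "Gamma (q / 2 + real (Suc i)) = (q / 2 + real i) * Gamma (q / 2 + real i)" for i
    using Gamma_plus1[of "q / 2 + real i"] q by (simp add: add_ac nonpos_Ints_def) 
  have \<gamma>e: "\<gamma> (2 * j) = 2 * real j + q" "\<gamma> (2 * j + 1) = 2 * real j + 2" for j
    by (simp_all add: \<gamma>_def q_def)
  show "(\<Prod>j<l. 1 / (\<gamma> (2 * j) * \<gamma> (2 * j + 1))) = Gamma (q / 2) / (4 ^ l * fact l * Gamma (q / 2 + real l))"
  proof (induction l)
    case 0
    show ?case using pos[of 0] by simp
  next
    case (Suc l)
    have eq: "(4 ^ l * fact l * Gamma (q / 2 + real l)) * ((2 * real l + q) * (2 * real l + 2))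
        = 4 ^ Suc l * fact (Suc l) * ((q / 2 + real l) * Gamma (q / 2 + real l))"
      by (simp add: algebra_simps)
    show ?case unfolding prod.lessThan_Suc Suc unfolding rec \<gamma>e
      by (simp only: times_divide_times_eq eq mult_1_right)
  qed
  have "(\<Prod>j<l. 1 / (\<gamma> (2 * j + 1) * \<gamma> (2 * j + 2))) = Gamma (q / 2 + real (Suc 0)) / (4 ^ l * fact l * Gamma (q / 2 + real (Suc l)))"
  proof (induction l)
    case 0
    show ?case using pos[of "Suc 0"] by simp
  next
    case (Suc l)
    have e2: "\<gamma> (2 * l + 2) = 2 * real (Suc l) + q" using \<gamma>e(1)[of "Suc l"] by simp
    have eq: "(4 ^ l * fact l * Gamma (q / 2 + real (Suc l))) * ((2 * real l + 2) * (2 * real (Suc l) + q))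
        = 4 ^ Suc l * fact (Suc l) * ((q / 2 + real (Suc l)) * Gamma (q / 2 + real (Suc l)))"
      by (simp add: algebra_simps)
    show ?case unfolding prod.lessThan_Suc Suc unfolding rec[of "Suc l"] \<gamma>e(2) e2
      by (simp only: times_divide_times_eq eq mult_1_right)
  qed
  \<comment> \<open>The q arising here cancels against \<gamma> 0 = q and leaves the factor 1 / 2 in
    front of x_q in the Bessel form.\<close>
  also have "Gamma (q / 2 + real (Suc 0)) = q / 2 * Gamma (q / 2)" using rec[of 0] by simp
  finally show "(\<Prod>j<l. 1 / (\<gamma> (2 * j + 1) * \<gamma> (2 * j + 2))) / \<gamma> 0 = Gamma (q / 2) / (2 * (4 ^ l * fact l * Gamma (q / 2 + real l + 1)))"
    using q \<gamma>e(1)[of 0] by (simp add: field_simps add_ac)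
qed

text \<open>One Bessel index collects the two consecutive terms 2 k and 2 k + 1: the factor (-
  r^2)^k in both powers supplies the sign and the power of r, and the odd one keeps a factor x_q.
  The index range is the one produced by \<open>sums_group\<close>.\<close>

lemma bessel_term_eq:
  assumes dom: "domain_in (span (v ` {..p})) \<Omega>0" and an: "real_analytic_on_v v p A0 \<Omega>0"
    and c: "embv v {..p} c \<in> \<Omega>0"
  shows "bessel_term mul v p m A0 c k =
     (\<Sum>j\<in>{k * 2..<k * 2 + 2}. mul (powA mul one (embv v {p+1..m} c) j) (ck_fun A0 j (embv v {..p} c)))"
proof -
  let ?x = "embv v {..m} c" and ?a = "embv v {..p} c" and ?q = "real (m - p)"
  let ?R = "\<Sum>s\<in>{p+1..m}. (c s)\<^sup>2"
  have r2: "r2 ?x = ?R" unfolding r2_def by (rule sum.cong) (auto simp: crd_embv)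
  have R: "0 \<le> ?R" by (intro sum_nonneg) auto
  have pw: "(sqrt ?R / 2) ^ (2 * k) = ?R ^ k / 4 ^ k"
    using R by (simp add: power_divide power_mult)
  have sgn: "(- ?R) ^ k = (- 1) ^ k * ?R ^ k" by (rule power_minus)
  have b0: "?q / 2 - 1 + real k + 1 = ?q / 2 + real k" by simp
  have c0: "Gamma (?q / 2) * bessel_coeff (?q / 2 - 1) k * (sqrt ?R / 2) ^ (2 * k)
      = (- ?R) ^ k * (\<Prod>j<k. 1 / (\<gamma> (2 * j) * \<gamma> (2 * j + 1)))"
    unfolding gamma_products bessel_coeff_def b0 pw sgn by (simp add: mult_ac)
  have c1: "Gamma (?q / 2) * bessel_coeff (?q / 2) k * (sqrt ?R / 2) ^ (2 * k) * (1 / 2)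
      = (- ?R) ^ k * ((\<Prod>j<k. 1 / (\<gamma> (2 * j + 1) * \<gamma> (2 * j + 2))) / \<gamma> 0)"
    unfolding gamma_products bessel_coeff_def pw sgn by (simp add: mult_ac)
  have eqE: "mul (powA mul one (embv v {p+1..m} c) j) b = E j ?x b" for j b
    unfolding xq_embv[symmetric] by (rule powA_xq)
  have "{k * 2..<k * 2 + 2} = {2 * k, 2 * k + 1}" by auto
  hence "(\<Sum>j\<in>{k * 2..<k * 2 + 2}. mul (powA mul one (embv v {p+1..m} c) j) (ck_fun A0 j ?a))
     = E (2 * k) ?x (ck_fun A0 (2 * k) ?a) + E (2 * k + 1) ?x (ck_fun A0 (2 * k + 1) ?a)"
    unfolding eqE by (simp del: ck_fun.simps)
  also have "E (2 * k) ?x (ck_fun A0 (2 * k) ?a) =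
      ((- ?R) ^ k * (\<Prod>j<k. 1 / (\<gamma> (2 * j) * \<gamma> (2 * j + 1)))) *\<^sub>R (lap_p v p ^^ k) A0 ?a"
    unfolding ck_fun_laplace(1)[OF dom an c] E_def r2 by simp
  also have "E (2 * k + 1) ?x (ck_fun A0 (2 * k + 1) ?a) =
      ((- ?R) ^ k * ((\<Prod>j<k. 1 / (\<gamma> (2 * j + 1) * \<gamma> (2 * j + 2))) / \<gamma> 0)) *\<^sub>R
        mul (embv v {p+1..m} c) ((lap_p v p ^^ k) (D_p mul v p A0) ?a)"
    unfolding ck_fun_laplace(2)[OF dom an c] E_def r2 by (simp add: mul.scaleR_right xq_embv)
  finally show ?thesis
    unfolding bessel_term_def Let_def c0[symmetric] c1[symmetric] mul.scaleR_left mul.scaleR_right scaleR_scaleR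
    by (simp only:)
qed

end

theorem theorem3p10:
  fixes mul :: "'a::euclidean_space \<Rightarrow> 'a \<Rightarrow> 'a" and one :: 'a and cj :: "'a \<Rightarrow> 'a"
    and v :: "nat \<Rightarrow> 'a" and m p :: nat and \<Omega>0 :: "'a set" and A0 :: "'a \<Rightarrow> 'a"
  assumes alg: "alt_algebra_with_anti_involution mul one cj"
    and dim: "DIM('a) > 1"
    and SA_ne: "sphereA mul one cj \<noteq> {}"
    and m1: "1 \<le> m"
    and v0: "v 0 = one"
    and vS: "\<forall>s\<in>{1..m}. v s \<in> sphereA mul one cj"
    and vanti: "\<forall>s\<in>{1..m}. \<forall>t\<in>{1..m}. s \<noteq> t \<longrightarrow> mul (v s) (v t) = - mul (v t) (v s)"
    and vinj: "inj_on v {..m}"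
    and vindep: "independent (v ` {..m})"
    and MQ: "span (v ` {..m}) \<subseteq> QA mul one cj"
    and pm: "p < m"
    and dom0: "domain_in (span (v ` {..p})) \<Omega>0"
    and A0an: "real_analytic_on_v v p A0 \<Omega>0"
  shows "\<exists>A. (\<forall>x\<in>\<Omega>0. A 0 x = A0 x) \<and>
             (\<forall>k. real_analytic_on_v v p (A k) \<Omega>0) \<and>
             (\<exists>\<Omega> f. CK_extension mul one v p m \<Omega>0 A \<Omega> f \<and>
                (\<forall>c. embv v {..m} c \<in> \<Omega> \<longrightarrow>
                   (\<lambda>k. bessel_term mul v p m A0 c k) sums f (embv v {..m} c))) \<and>
             (\<forall>B. (\<forall>x\<in>\<Omega>0. B 0 x = A0 x) \<and>
                  (\<forall>k. real_analytic_on_v v p (B k) \<Omega>0) \<and>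
                  (\<exists>\<Omega> g. CK_extension mul one v p m \<Omega>0 B \<Omega> g)
                \<longrightarrow> (\<forall>k. \<forall>x\<in>\<Omega>0. B k x = A k x))"
proof -
  interpret ck_frame mul one v m p
  proof
    show bil: "bilinear mul" using alg by (simp add: alt_algebra_with_anti_involution_def)
    show unit: "mul one a = a" "mul a one = a" for a
      using alg by (simp_all add: alt_algebra_with_anti_involution_def)
    show "mul a (mul a b) = mul (mul a a) b" for a b
      using alg by (simp add: alt_algebra_with_anti_involution_def associator_def)
    \<comment> \<open>Trace 0 makes the involution act on \<open>v s\<close> as negation, so norm 1
      becomes the square - 1.\<close>
    show "mul (v s) (v s) = - one" if "1 \<le> s" "s \<le> m" for s
    proof -
      have "v s + cj (v s) = 0" "mul (v s) (cj (v s)) = one"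
        using vS that by (auto simp: sphereA_def trA_def nA_def)
      hence "mul (v s) (- v s) = one" by (simp add: add_eq_0_iff)
      thus ?thesis using bilinear_rneg[OF bil, of "v s" "v s"] by (metis minus_minus)
    qed
    show "mul (v s) (v t) = - mul (v t) (v s)" if "1 \<le> s" "s \<le> m" "1 \<le> t" "t \<le> m" "s \<noteq> t" for s t
      by (rule vanti[rule_format]) (use that in auto)
  qed (use v0 vinj vindep pm in simp_all)
  obtain \<Omega> f where ck: "CK_extension mul one v p m \<Omega>0 (ck_fun A0) \<Omega> f"
    using ck_extension_exists[OF dom0 A0an] .
  have an: "real_analytic_on_v v p (ck_fun A0 k) \<Omega>0" for k by (rule ck_fun_analytic[OF dom0 A0an])
  have bessel: "(\<lambda>k. bessel_term mul v p m A0 c k) sums f (embv v {..m} c)" if c: "embv v {..m} c \<in> \<Omega>" for c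
  proof -
    have "embv v {..m} c \<in> star_set v p m \<Omega>0" using ck c by (auto simp: CK_extension_def)
    hence "embv v {..p} c \<in> \<Omega>0" using xp_star_set[OF dom0] by (metis xp_embv)
    note bt = bessel_term_eq[OF dom0 A0an this]
    have "(\<lambda>k. mul (powA mul one (embv v {p+1..m} c) k) (ck_fun A0 k (embv v {..p} c))) sums f (embv v {..m} c)"
      using ck c by (simp add: CK_extension_def)
    \<comment> \<open>Grouping the convergent series into consecutive pairs preserves its
      sum.\<close>
    from sums_group[OF this, of 2] show ?thesis unfolding bt by simp
  qed
  have uniq: "B k x = ck_fun A0 k x"
    if "\<forall>x\<in>\<Omega>0. B 0 x = A0 x" "\<forall>k. real_analytic_on_v v p (B k) \<Omega>0"
      "CK_extension mul one v p m \<Omega>0 B \<Omega>' g" "x \<in> \<Omega>0" for B \<Omega>' g k x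
    by (rule ck_unique[OF dom0 _ an _ that(3) ck that(4)]) (use that in auto)
  show ?thesis
  proof (intro exI[of _ "ck_fun A0"] conjI allI ballI impI)
    show "\<exists>\<Omega> f. CK_extension mul one v p m \<Omega>0 (ck_fun A0) \<Omega> f \<and>
        (\<forall>c. embv v {..m} c \<in> \<Omega> \<longrightarrow> (\<lambda>k. bessel_term mul v p m A0 c k) sums f (embv v {..m} c))"
      using ck bessel by blast
    fix B k x
    assume "(\<forall>x\<in>\<Omega>0. B 0 x = A0 x) \<and> (\<forall>k. real_analytic_on_v v p (B k) \<Omega>0) \<and>
        (\<exists>\<Omega> g. CK_extension mul one v p m \<Omega>0 B \<Omega> g)" "x \<in> \<Omega>0"
    thus "B k x = ck_fun A0 k x" using uniq by blast
  qed (use an in auto)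
qed

end
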